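(* Fix an integer $m\ge 0$ and let $\Omega\subset\mathbb{R}^d$ be a bounded domain. Suppose the activation function $\sigma\in W^{m,\infty}(\mathbb{R})$ is a non-constant periodic function. Then there is a constant $C(\sigma)$, depending (for the fixed $m$) only on $\sigma$, such that for every $f\in\mathcal{B}^m$ and every integer $n\ge 1$, $$\inf_{f_n\in\Sigma_d^n(\sigma)}\|f-f_n\|_{H^m(\Omega)}\le|\Omega|^{1/2}\,C(\sigma)\,n^{-1/2}\,\|f\|_{\mathcal{B}^m}.$$
   Context: For $\sigma:\mathbb{R}\to\mathbb{R}$, $\Sigma_d^n(\sigma)=\{x\mapsto\sum_{i=1}^n\beta_i\sigma(\omega_i\cdot x+b_i):\omega_i\in\mathbb{R}^d,\ b_i,\beta_i\in\mathbb{R}\}$. Fourier convention: $\hat f(\omega)=(2\pi)^{-d}\int_{\mathbb{R}^d} f(x)e^{-i\omega\cdot x}dx$, so that $f(x)=\int_{\mathbb{R}^d}e^{i\omega\cdot x}\hat f(\omega)d\omega$. The Barron norm of $f:\mathbb{R}^d\to\mathbb{R}$ is $\|f\|_{\mathcal{B}^s}=\int_{\mathbb{R}^d}(1+|\omega|)^s|\hat f(\omega)|\,d\omega$, and $\mathcal{B}^s=\{f:\|f\|_{\mathcal{B}^s}<\infty\}$ (real-valued functions whose Fourier transform is a function with this integral finite). $|\Omega|$ is the Lebesgue measure of $\Omega$, and $\|g\|_{H^m(\Omega)}=\big(\sum_{|\alpha|\le m}\|D^\alpha g\|_{L^2(\Omega)}^2\big)^{1/2}$. "Non-constant" means not almost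 everywhere equal to a constant. *)

theory Defs
  imports "HOL-Analysis.Analysis"
begin

text \<open>
  The constant in the approximation bound must not depend on the dimension \<open>d\<close>, so \<open>d\<close> has to be
  a term rather than a type.  A point of \<open>\<real>\<^sup>d\<close> is a function \<open>nat \<Rightarrow> real\<close> in the extensional
  product \<open>{..<d} \<rightarrow>\<^sub>E UNIV\<close>.  This is both the topspace of the product topology and the space of
  the product measure below.  Only values of functions on this set matter.
\<close>

definition Rd :: "nat \<Rightarrow> (nat \<Rightarrow> real) set" where
  "Rd d = {..<d} \<rightarrow>\<^sub>E UNIV"

definition Rd_topology :: "nat \<Rightarrow> (nat \<Rightarrow> real) topology" where
  "Rd_topology d = product_topology (\<lambda>_. euclidean) {..<d}"

definition lebesgue_Rd :: "nat \<Rightarrow> (nat \<Rightarrow> real) measure" where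
  "lebesgue_Rd d = completion (Pi\<^sub>M {..<d} (\<lambda>_. lborel))"

definition dot :: "nat \<Rightarrow> (nat \<Rightarrow> real) \<Rightarrow> (nat \<Rightarrow> real) \<Rightarrow> real" where
  "dot d x y = (\<Sum>i<d. x i * y i)"

definition norm_Rd :: "nat \<Rightarrow> (nat \<Rightarrow> real) \<Rightarrow> real" where
  "norm_Rd d x = sqrt (dot d x x)"

definition bounded_domain :: "nat \<Rightarrow> (nat \<Rightarrow> real) set \<Rightarrow> bool" where
  "bounded_domain d \<Omega> \<longleftrightarrow>
     \<Omega> \<noteq> {} \<and> openin (Rd_topology d) \<Omega> \<and> connectedin (Rd_topology d) \<Omega> \<and>
     (\<exists>B. \<forall>x\<in>\<Omega>. norm_Rd d x \<le> B)"

definition partial :: "nat \<Rightarrow> ((nat \<Rightarrow> real) \<Rightarrow> 'a::real_normed_vector) \<Rightarrow> (nat \<Rightarrow> real) \<Rightarrow> 'a" where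
  "partial i \<phi> x = vector_derivative (\<lambda>t. \<phi> (x(i := t))) (at (x i))"

definition smooth_Rd :: "nat \<Rightarrow> ((nat \<Rightarrow> real) \<Rightarrow> 'a::real_normed_vector) \<Rightarrow> bool" where
  "smooth_Rd d \<phi> \<longleftrightarrow>
     (\<forall>is\<in>lists {..<d}.
        continuous_map (Rd_topology d) euclidean (foldr partial is \<phi>) \<and>
        (\<forall>x\<in>Rd d. \<forall>i<d. (\<lambda>t. foldr partial is \<phi> (x(i := t))) differentiable (at (x i))))"

definition test_function :: "nat \<Rightarrow> (nat \<Rightarrow> real) set \<Rightarrow> ((nat \<Rightarrow> real) \<Rightarrow> real) \<Rightarrow> bool" where
  "test_function d \<Omega> \<phi> \<longleftrightarrow>
     smooth_Rd d \<phi> \<and> (\<exists>K\<subseteq>\<Omega>. compactin (Rd_topology d) K \<and> (\<forall>x\<in>Rd d - K. \<phi> x = 0))"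

definition schwartz :: "nat \<Rightarrow> ((nat \<Rightarrow> real) \<Rightarrow> complex) \<Rightarrow> bool" where
  "schwartz d \<phi> \<longleftrightarrow>
     smooth_Rd d \<phi> \<and>
     (\<forall>is\<in>lists {..<d}. \<forall>N::nat. \<exists>B. \<forall>x\<in>Rd d.
        (1 + norm_Rd d x) ^ N * cmod (foldr partial is \<phi> x) \<le> B)"

text \<open>
  Multi-indices of order at most \<open>m\<close>, as functions vanishing outside \<open>{..<d}\<close>.  The order in which
  \<open>partial_multi\<close> takes the derivatives is immaterial, since it is only used for smooth functions.
\<close>

definition multi_indices :: "nat \<Rightarrow> nat \<Rightarrow> (nat \<Rightarrow> nat) set" where
  "multi_indices d m = {\<alpha>. (\<forall>i\<ge>d. \<alpha> i = 0) \<and> (\<Sum>i<d. \<alpha> i) \<le> m}"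

definition partial_multi ::
    "nat \<Rightarrow> (nat \<Rightarrow> nat) \<Rightarrow> ((nat \<Rightarrow> real) \<Rightarrow> 'a::real_normed_vector) \<Rightarrow> (nat \<Rightarrow> real) \<Rightarrow> 'a" where
  "partial_multi d \<alpha> \<phi> = foldr (\<lambda>i. partial i ^^ \<alpha> i) [0..<d] \<phi>"

definition locally_integrable ::
    "nat \<Rightarrow> (nat \<Rightarrow> real) set \<Rightarrow> ((nat \<Rightarrow> real) \<Rightarrow> real) \<Rightarrow> bool" where
  "locally_integrable d \<Omega> g \<longleftrightarrow>
     (\<forall>K\<subseteq>\<Omega>. compactin (Rd_topology d) K \<longrightarrow> set_integrable (lebesgue_Rd d) K g)"

definition has_weak_derivative ::
    "nat \<Rightarrow> (nat \<Rightarrow> real) set \<Rightarrow> (nat \<Rightarrow> nat) \<Rightarrow> ((nat \<Rightarrow> real) \<Rightarrow> real) \<Rightarrow> ((nat \<Rightarrow> real) \<Rightarrow> real) \<Rightarrow> bool"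
  where
  "has_weak_derivative d \<Omega> \<alpha> g h \<longleftrightarrow>
     locally_integrable d \<Omega> g \<and> locally_integrable d \<Omega> h \<and>
     (\<forall>\<phi>. test_function d \<Omega> \<phi> \<longrightarrow>
        (LINT x:\<Omega>|lebesgue_Rd d. g x * partial_multi d \<alpha> \<phi> x) =
        (-1) ^ (\<Sum>i<d. \<alpha> i) * (LINT x:\<Omega>|lebesgue_Rd d. h x * \<phi> x))"

text \<open>Weak derivatives on an open set are unique up to null sets, so the choice is immaterial.\<close>

definition weak_derivative ::
    "nat \<Rightarrow> (nat \<Rightarrow> real) set \<Rightarrow> (nat \<Rightarrow> nat) \<Rightarrow> ((nat \<Rightarrow> real) \<Rightarrow> real) \<Rightarrow> (nat \<Rightarrow> real) \<Rightarrow> real" where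
  "weak_derivative d \<Omega> \<alpha> g = (SOME h. has_weak_derivative d \<Omega> \<alpha> g h)"

definition in_sobolev ::
    "nat \<Rightarrow> (nat \<Rightarrow> real) set \<Rightarrow> nat \<Rightarrow> ((nat \<Rightarrow> real) \<Rightarrow> real) \<Rightarrow> bool" where
  "in_sobolev d \<Omega> m g \<longleftrightarrow>
     (\<forall>\<alpha>\<in>multi_indices d m.
        (\<exists>h. has_weak_derivative d \<Omega> \<alpha> g h) \<and>
        set_integrable (lebesgue_Rd d) \<Omega> (\<lambda>x. (weak_derivative d \<Omega> \<alpha> g x)\<^sup>2))"

definition sobolev_norm ::
    "nat \<Rightarrow> (nat \<Rightarrow> real) set \<Rightarrow> nat \<Rightarrow> ((nat \<Rightarrow> real) \<Rightarrow> real) \<Rightarrow> ennreal" where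
  "sobolev_norm d \<Omega> m g =
     (if in_sobolev d \<Omega> m g
      then ennreal (sqrt (\<Sum>\<alpha>\<in>multi_indices d m.
             LINT x:\<Omega>|lebesgue_Rd d. (weak_derivative d \<Omega> \<alpha> g x)\<^sup>2))
      else \<infinity>)"

definition test_function_real :: "(real \<Rightarrow> real) \<Rightarrow> bool" where
  "test_function_real \<phi> \<longleftrightarrow>
     (\<forall>k x. (deriv ^^ k) \<phi> differentiable (at x)) \<and> compact (closure {x. \<phi> x \<noteq> 0})"

definition has_weak_derivative_real ::
    "nat \<Rightarrow> (real \<Rightarrow> real) \<Rightarrow> (real \<Rightarrow> real) \<Rightarrow> bool" where
  "has_weak_derivative_real k g h \<longleftrightarrow>
     (\<forall>K. compact K \<longrightarrow> set_integrable lebesgue K g \<and> set_integrable lebesgue K h) \<and>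
     (\<forall>\<phi>. test_function_real \<phi> \<longrightarrow>
        (LINT x|lebesgue. g x * (deriv ^^ k) \<phi> x) = (-1) ^ k * (LINT x|lebesgue. h x * \<phi> x))"

definition L_infinity :: "(real \<Rightarrow> real) set" where
  "L_infinity = {g \<in> borel_measurable lebesgue. \<exists>B. AE x in lebesgue. \<bar>g x\<bar> \<le> B}"

definition W_infinity :: "nat \<Rightarrow> (real \<Rightarrow> real) set" where
  "W_infinity m =
     {g \<in> L_infinity. \<forall>k\<in>{1..m}. \<exists>h\<in>L_infinity. has_weak_derivative_real k g h}"

definition fourier_integral :: "nat \<Rightarrow> ((nat \<Rightarrow> real) \<Rightarrow> complex) \<Rightarrow> (nat \<Rightarrow> real) \<Rightarrow> complex" where
  "fourier_integral d \<phi> \<omega> =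
     complex_of_real (1 / (2 * pi) ^ d) *
     (LINT x|lebesgue_Rd d. \<phi> x * exp (- \<i> * complex_of_real (dot d \<omega> x)))"

definition tempered_function :: "nat \<Rightarrow> ((nat \<Rightarrow> real) \<Rightarrow> complex) \<Rightarrow> bool" where
  "tempered_function d g \<longleftrightarrow>
     (\<exists>N::nat. integrable (lebesgue_Rd d) (\<lambda>x. g x / complex_of_real ((1 + norm_Rd d x) ^ N)))"

text \<open>
  Elements of the Barron space need not be integrable, so
  the Fourier transform is that of tempered distributions: \<open>g\<close> is the transform of \<open>f\<close> if
  \<open>\<integral> g \<phi> = \<integral> f F\<phi>\<close> for all Schwartz functions \<open>\<phi>\<close>, with \<open>F = fourier_integral d\<close>.  For
  integrable \<open>f\<close> this is the integral formula above, by Fubini.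
\<close>

definition has_fourier_transform ::
    "nat \<Rightarrow> ((nat \<Rightarrow> real) \<Rightarrow> real) \<Rightarrow> ((nat \<Rightarrow> real) \<Rightarrow> complex) \<Rightarrow> bool" where
  "has_fourier_transform d f g \<longleftrightarrow>
     tempered_function d (\<lambda>x. complex_of_real (f x)) \<and> tempered_function d g \<and>
     (\<forall>\<phi>. schwartz d \<phi> \<longrightarrow>
        (LINT \<omega>|lebesgue_Rd d. g \<omega> * \<phi> \<omega>) =
        (LINT x|lebesgue_Rd d. complex_of_real (f x) * fourier_integral d \<phi> x))"

text \<open>The transform is unique up to null sets, so the choice is immaterial.\<close>

definition fourier_transform :: "nat \<Rightarrow> ((nat \<Rightarrow> real) \<Rightarrow> real) \<Rightarrow> (nat \<Rightarrow> real) \<Rightarrow> complex" where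
  "fourier_transform d f = (SOME g. has_fourier_transform d f g)"

definition barron_norm :: "nat \<Rightarrow> real \<Rightarrow> ((nat \<Rightarrow> real) \<Rightarrow> real) \<Rightarrow> ennreal" where
  "barron_norm d s f =
     (if \<exists>g. has_fourier_transform d f g
      then \<integral>\<^sup>+ \<omega>. ennreal ((1 + norm_Rd d \<omega>) powr s * cmod (fourier_transform d f \<omega>)) \<partial>lebesgue_Rd d
      else \<infinity>)"

definition barron_space :: "nat \<Rightarrow> real \<Rightarrow> ((nat \<Rightarrow> real) \<Rightarrow> real) set" where
  "barron_space d s = {f. barron_norm d s f < \<infinity>}"

definition shallow_networks :: "nat \<Rightarrow> nat \<Rightarrow> (real \<Rightarrow> real) \<Rightarrow> ((nat \<Rightarrow> real) \<Rightarrow> real) set" where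
  "shallow_networks d n \<sigma> =
     {\<lambda>x. \<Sum>i<n. \<beta> i * \<sigma> (dot d (w i) x + b i) |w b \<beta>. \<forall>i<n. w i \<in> Rd d}"

end

theory Submission
  imports Defs "HOL-Probability.Probability"
begin

text \<open>
  A non-constant periodic \<open>\<sigma>\<close> has a non-zero Fourier coefficient \<open>c\<close> at some frequency \<open>a \<noteq> 0\<close>, so
  averaging its translates over a period against \<open>e\<^sup>i\<^sup>a\<^sup>b\<close> recovers a plane wave:
  \<open>e\<^sup>i\<^sup>\<omega>\<^sup>\<cdot>\<^sup>x = c\<inverse> \<integral> \<sigma>(b - \<omega>\<cdot>x / a) e\<^sup>i\<^sup>a\<^sup>b db\<close>.  Inserting this into Fourier inversion writes \<open>f\<close> as the
  expectation of random single neurons, with \<open>\<omega>\<close> distributed according to the weight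
  \<open>(1 + |\<omega>|)\<^sup>m |f\<hat>(\<omega>)|\<close> and \<open>b\<close> uniform on a period.  By Fubini, the expectations of the weak
  derivatives of the neurons are the weak derivatives of \<open>f\<close>, and the weight makes all of them
  bounded by a multiple of the Barron norm.  Maurey's variance argument, derandomised one neuron at
  a time, then gives the rate \<open>n\<^sup>-\<^sup>1\<^sup>/\<^sup>2\<close>.
\<close>

section \<open>Lebesgue measure on boxes\<close>

text \<open>Most objects are determined only almost everywhere: \<open>\<sigma>\<close> and its weak
  derivatives, \<open>f\<close> against its inversion integral, the choice behind
  \<open>weak_derivative\<close>. The argument runs on Borel representatives \<open>h k\<close>
  bounded at every point and returns to \<open>\<sigma>\<close> at the end: for almost every weight
  and bias the neurons built from \<open>\<sigma>\<close> and from \<open>h 0\<close> agree almost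
  everywhere.

  The constant must not see the dimension, but the number of multi-indices does. So derivatives are
  never estimated one by one: the squared monomials in \<open>\<omega>\<close>, summed over
  \<open>\<alpha>\<close>, are at most \<open>(1 + |\<omega>|^2)^m\<close>, and the sampling step
  treats all derivatives as one vector.

  Elements of the Barron space are merely tempered, so inversion damps with a Gaussian and tests
  with translated Gaussians only, whose transforms are explicit.

  Uniqueness is needed three times (weak derivatives, Fourier integrals, Fourier coefficients) and
  rests each time on one fact: an integrable function whose integral over every box is 0 vanishes
  almost everywhere.\<close>

abbreviation lborel_Rd :: "nat \<Rightarrow> (nat \<Rightarrow> real) measure" where
  "lborel_Rd d \<equiv> Pi\<^sub>M {..<d} (\<lambda>_. lborel)"

interpretation lborel_Rd: product_sigma_finite "\<lambda>_::nat. lborel :: real measure"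
  by standard

interpretation lborel_Rd_sigma: sigma_finite_measure "lborel_Rd d" for d
  by (rule lborel_Rd.sigma_finite) simp

interpretation lborel_Rd_pair: pair_sigma_finite "lborel_Rd d" "lborel_Rd d" for d
  by standard

lemma space_lborel_Rd: "space (lborel_Rd d) = Rd d"
  by (simp add: space_PiM Rd_def)

lemma measurable_dot [measurable (raw)]:
  assumes [measurable]: "f \<in> M \<rightarrow>\<^sub>M lborel_Rd d" "g \<in> M \<rightarrow>\<^sub>M lborel_Rd d"
  shows "(\<lambda>x. dot d (f x) (g x)) \<in> borel_measurable M"
proof -
  have [measurable]: "(\<lambda>x. f x i) \<in> borel_measurable M" "(\<lambda>x. g x i) \<in> borel_measurable M" if "i < d" for i
    using measurable_compose[OF assms(1) measurable_component_singleton[of i "{..<d}"]]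
      measurable_compose[OF assms(2) measurable_component_singleton[of i "{..<d}"]] that by simp_all
  show ?thesis unfolding dot_def by measurable
qed

lemma measurable_norm_Rd [measurable (raw)]:
  assumes [measurable]: "f \<in> M \<rightarrow>\<^sub>M lborel_Rd d"
  shows "(\<lambda>x. norm_Rd d (f x)) \<in> borel_measurable M"
  unfolding norm_Rd_def by measurable

lemma norm_Rd_nonneg [simp]: "0 \<le> norm_Rd d x"
  by (simp add: norm_Rd_def dot_def sum_nonneg)

lemma abs_component_le_norm_Rd: "i < d \<Longrightarrow> \<bar>x i\<bar> \<le> norm_Rd d x"
proof -
  assume "i < d"
  then have "(x i)\<^sup>2 \<le> (\<Sum>j<d. x j * x j)"
    using member_le_sum[of i "{..<d}" "\<lambda>j. x j * x j"] by (simp add: power2_eq_square)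
  then show ?thesis unfolding norm_Rd_def dot_def by (simp add: real_le_rsqrt)
qed

section \<open>Boxes as basis of the topology and generator of the sigma-algebra\<close>

definition obox :: "nat \<Rightarrow> (nat \<Rightarrow> real) \<Rightarrow> (nat \<Rightarrow> real) \<Rightarrow> (nat \<Rightarrow> real) set" where
  "obox d a b = Pi\<^sub>E {..<d} (\<lambda>i. {a i<..<b i})"

definition cbox_Rd :: "nat \<Rightarrow> (nat \<Rightarrow> real) \<Rightarrow> (nat \<Rightarrow> real) \<Rightarrow> (nat \<Rightarrow> real) set" where
  "cbox_Rd d a b = Pi\<^sub>E {..<d} (\<lambda>i. {a i..b i})"

lemma obox_sets [measurable]: "obox d a b \<in> sets (lborel_Rd d)"
  unfolding obox_def by (rule sets_PiM_I_finite) auto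

lemma cbox_Rd_sets [measurable]: "cbox_Rd d a b \<in> sets (lborel_Rd d)"
  unfolding cbox_Rd_def by (rule sets_PiM_I_finite) auto

lemma emeasure_cbox_Rd_finite: "emeasure (lborel_Rd d) (cbox_Rd d a b) < \<infinity>"
proof -
  have "emeasure (lborel_Rd d) (cbox_Rd d a b) = (\<Prod>i<d. emeasure lborel {a i..b i})"
    unfolding cbox_Rd_def by (rule lborel_Rd.emeasure_PiM) auto
  also have "\<dots> < \<infinity>"
    by (simp add: less_top[symmetric] ennreal_prod_eq_top emeasure_lborel_Icc_eq)
  finally show ?thesis .
qed

lemma compactin_cbox_Rd: "compactin (Rd_topology d) (cbox_Rd d a b)"
  unfolding Rd_topology_def cbox_Rd_def compactin_PiE by auto

lemma topspace_Rd_topology: "topspace (Rd_topology d) = Rd d"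
  by (simp add: Rd_topology_def Rd_def)

text \<open>Rational corners leave only countably many boxes. The point sits in the open box while
  the closed box stays inside \<open>U\<close>; the closed one is compact, so it can carry the
  support of a test function.\<close>

lemma openin_Rd_rational_box:
  assumes U: "openin (Rd_topology d) U" and x: "x \<in> U"
  shows "\<exists>a\<in>{..<d} \<rightarrow>\<^sub>E \<rat>. \<exists>b\<in>{..<d} \<rightarrow>\<^sub>E \<rat>. x \<in> obox d a b \<and> cbox_Rd d a b \<subseteq> U"
proof -
  obtain V where V: "\<forall>i\<in>{..<d}. open (V i)" "x \<in> Pi\<^sub>E {..<d} V" "Pi\<^sub>E {..<d} V \<subseteq> U"
    using U[unfolded Rd_topology_def openin_product_topology_alt, rule_format, OF x]
    by (metis open_openin)
  have "\<exists>p q. p \<in> \<rat> \<and> q \<in> \<rat> \<and> p < x i \<and> x i < q \<and> {p..q} \<subseteq> V i" if "i < d" for i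
  proof -
    have "x i \<in> V i" "open (V i)" using V that by auto
    then obtain e where e: "e > 0" "ball (x i) e \<subseteq> V i" by (meson openE)
    obtain p where p: "p \<in> \<rat>" "x i - e < p" "p < x i" using Rats_dense_in_real[of "x i - e" "x i"] e by auto
    obtain q where q: "q \<in> \<rat>" "x i < q" "q < x i + e" using Rats_dense_in_real[of "x i" "x i + e"] e by auto
    have "{p..q} \<subseteq> ball (x i) e" using p q by (auto simp: dist_real_def)
    then show ?thesis using p q e by blast
  qed
  then obtain p q where pq: "\<And>i. i < d \<Longrightarrow> p i \<in> \<rat> \<and> q i \<in> \<rat> \<and> p i < x i \<and> x i < q i \<and> {p i..q i} \<subseteq> V i"
    by metis
  show ?thesis
  proof (rule bexI[of _ "restrict p {..<d}"], rule bexI[of _ "restrict q {..<d}"], rule conjI)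
    show "x \<in> obox d (restrict p {..<d}) (restrict q {..<d})"
      using pq V(2) by (auto simp: obox_def PiE_iff)
    have "cbox_Rd d (restrict p {..<d}) (restrict q {..<d}) \<subseteq> Pi\<^sub>E {..<d} V"
      unfolding cbox_Rd_def by (rule PiE_mono) (use pq in auto)
    then show "cbox_Rd d (restrict p {..<d}) (restrict q {..<d}) \<subseteq> U" using V(3) by blast
  qed (use pq in auto)
qed

lemma obox_subset_cbox: "obox d a b \<subseteq> cbox_Rd d a b"
  unfolding obox_def cbox_Rd_def by (rule PiE_mono) auto

definition rational_pairs :: "nat \<Rightarrow> ((nat \<Rightarrow> real) \<times> (nat \<Rightarrow> real)) set" where
  "rational_pairs d = ({..<d} \<rightarrow>\<^sub>E \<rat>) \<times> ({..<d} \<rightarrow>\<^sub>E \<rat>)"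

lemma countable_rational_pairs: "countable (rational_pairs d)"
  unfolding rational_pairs_def by (intro countable_SIGMA countable_PiE countable_rat) auto

lemma openin_Rd_eq_Union_cbox:
  assumes "openin (Rd_topology d) U"
  shows "U = (\<Union>(a, b)\<in>{(a, b)\<in>rational_pairs d. cbox_Rd d a b \<subseteq> U}. cbox_Rd d a b)"
proof (intro subset_antisym subsetI)
  fix x assume "x \<in> U"
  then obtain a b where "a \<in> {..<d} \<rightarrow>\<^sub>E \<rat>" "b \<in> {..<d} \<rightarrow>\<^sub>E \<rat>" "x \<in> obox d a b" "cbox_Rd d a b \<subseteq> U"
    using openin_Rd_rational_box[OF assms] by blast
  then show "x \<in> (\<Union>(a, b)\<in>{(a, b)\<in>rational_pairs d. cbox_Rd d a b \<subseteq> U}. cbox_Rd d a b)"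
    using obox_subset_cbox[of d a b]
    by (intro UN_I[of "(a, b)"]) (simp_all add: rational_pairs_def subset_iff)
qed (simp add: subset_iff split_beta, blast)

text \<open>Measurability of arbitrary open sets rests on second countability: the cover by rational
  boxes is countable.\<close>

lemma openin_Rd_sets:
  assumes "openin (Rd_topology d) U"
  shows "U \<in> sets (lborel_Rd d)"
proof -
  have "(\<Union>(a, b)\<in>{(a, b)\<in>rational_pairs d. cbox_Rd d a b \<subseteq> U}. cbox_Rd d a b) \<in> sets (lborel_Rd d)"
    by (rule sets.countable_UN'') (auto intro: countable_subset[OF _ countable_rational_pairs])
  then show ?thesis using openin_Rd_eq_Union_cbox[OF assms] by simp
qed

lemma continuous_map_Rd_measurable:
  assumes "continuous_map (Rd_topology d) euclidean f"
  shows "f \<in> borel_measurable (lborel_Rd d)"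
proof (rule borel_measurableI)
  fix S :: "'a set" assume "open S"
  then have "openin (Rd_topology d) {x \<in> topspace (Rd_topology d). f x \<in> S}"
    using assms by (simp add: continuous_map_def)
  from openin_Rd_sets[OF this] show "f -` S \<inter> space (lborel_Rd d) \<in> sets (lborel_Rd d)"
    by (simp add: topspace_Rd_topology space_lborel_Rd vimage_def Int_def conj_commute)
qed

lemma compactin_Rd_sets:
  assumes "compactin (Rd_topology d) K"
  shows "K \<in> sets (lborel_Rd d)"
proof -
  have "Hausdorff_space (Rd_topology d)"
    unfolding Rd_topology_def by (auto simp: Hausdorff_space_product_topology)
  then have "closedin (Rd_topology d) K" using assms by (rule compactin_imp_closedin)
  then have "openin (Rd_topology d) (Rd d - K)" "K \<subseteq> Rd d"
    by (auto simp: closedin_def topspace_Rd_topology)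
  from openin_Rd_sets[OF this(1)] this(2) show ?thesis
    by (metis Diff_Diff_Int inf.absorb_iff2 sets.compl_sets space_lborel_Rd)
qed

text \<open>Each coordinate projection of a compact set is bounded, and the sum of the absolute
  bounds serves all coordinates at once.\<close>

lemma compactin_Rd_subset_cbox:
  assumes "compactin (Rd_topology d) K"
  shows "\<exists>B. K \<subseteq> cbox_Rd d (\<lambda>_. - B) (\<lambda>_. B)"
proof -
  have "\<exists>B. \<forall>x\<in>K. \<bar>x i\<bar> \<le> B" if "i < d" for i
  proof -
    have "compactin euclidean ((\<lambda>x. x i) ` K)"
      by (rule image_compactin[OF assms]) (use that in \<open>auto simp: Rd_topology_def intro!: continuous_map_product_projection\<close>)
    then have "bounded ((\<lambda>x. x i) ` K)" by (simp add: compact_imp_bounded)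
    then show ?thesis by (auto simp: bounded_iff)
  qed
  then obtain B where B: "\<And>i x. i < d \<Longrightarrow> x \<in> K \<Longrightarrow> \<bar>x i\<bar> \<le> B i" by metis
  have "\<bar>x i\<bar> \<le> (\<Sum>j<d. \<bar>B j\<bar>)" if "i < d" "x \<in> K" for i x
    using B[OF that] member_le_sum[of i "{..<d}" "\<lambda>j. \<bar>B j\<bar>"] that by fastforce
  then have "x \<in> cbox_Rd d (\<lambda>_. - (\<Sum>j<d. \<bar>B j\<bar>)) (\<lambda>_. \<Sum>j<d. \<bar>B j\<bar>)" if "x \<in> K" for x
    using that compactin_subset_topspace[OF assms]
    by (fastforce simp: cbox_Rd_def topspace_Rd_topology Rd_def PiE_iff abs_le_iff)
  then show ?thesis by blast
qed

lemma emeasure_compactin_Rd_finite: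
  assumes "compactin (Rd_topology d) K"
  shows "emeasure (lborel_Rd d) K < \<infinity>"
  using compactin_Rd_subset_cbox[OF assms] emeasure_cbox_Rd_finite[of d]
    emeasure_mono[OF _ cbox_Rd_sets] by (meson order_le_less_trans)

lemma obox_Int: "obox d a b \<inter> obox d a' b' = obox d (\<lambda>i. max (a i) (a' i)) (\<lambda>i. min (b i) (b' i))"
  unfolding obox_def PiE_Int by (rule PiE_cong) auto

text \<open>Open boxes are stable under intersection, so they are a generator on which equality of
  measures can be tested. The generator passes to the product because the line is a countable union
  of the intervals \<open>{- n<..<n}\<close>.\<close>

lemma sets_lborel_Rd_eq_sigma_obox:
  "sets (lborel_Rd d) = sigma_sets (Rd d) (range (\<lambda>(a, b). obox d a b))"
proof -
  let ?E = "range (\<lambda>(p, q). {p<..<q::real})"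
  \<comment> \<open>The generator in the shape in which the product theorem delivers it: all
    coordinates constrained at once, each by an open interval. It is identified with the boxes
    below.\<close>
  define P where "P = {{f \<in> (\<Pi>\<^sub>E i\<in>{..<d}. UNIV). \<forall>i\<in>j. f i \<in> A i} | A j. j \<in> {{..<d}} \<and> A \<in> Pi j (\<lambda>_. ?E)}"
  have cov: "\<exists>S\<subseteq>?E. countable S \<and> UNIV = \<Union>S"
  proof (intro exI[of _ "range (\<lambda>n::nat. {- real n<..<real n})"] conjI)
    show "UNIV = (\<Union>n::nat. {- real n<..<real n})"
    proof (rule set_eqI)
      fix x :: real
      obtain n :: nat where "\<bar>x\<bar> < real n" using reals_Archimedean2 by blast
      then have "- real n < x \<and> x < real n" by (simp add: abs_less_iff minus_less_iff)
      then show "(x \<in> UNIV) = (x \<in> (\<Union>n::nat. {- real n<..<real n}))" by auto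
    qed
  qed auto
  have "sets (lborel_Rd d) = sets (Pi\<^sub>M {..<d} (\<lambda>_. sigma UNIV ?E))"
    by (rule sets_PiM_cong) (simp_all add: borel_eq_box)
  also have "\<dots> = sets (sigma (\<Pi>\<^sub>E i\<in>{..<d}. UNIV) P)"
    unfolding P_def by (rule sets_PiM_sigma) (use cov in auto)
  also have "\<dots> = sigma_sets (Rd d) P"
    unfolding Rd_def by (rule sets_measure_of) (auto simp: P_def)
  also have "P = range (\<lambda>(a, b). obox d a b)"
  proof (intro set_eqI iffI)
    fix X assume "X \<in> P"
    then obtain A where A: "A \<in> {..<d} \<rightarrow> ?E" "X = {f \<in> (\<Pi>\<^sub>E i\<in>{..<d}. UNIV). \<forall>i\<in>{..<d}. f i \<in> A i}"
      unfolding P_def by auto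
    then have "\<forall>i\<in>{..<d}. \<exists>p q. A i = {p<..<q}" by (force simp: Pi_iff)
    then obtain p q where "\<And>i. i < d \<Longrightarrow> A i = {p i<..<q i}" by (metis lessThan_iff)
    then have "X = obox d p q" unfolding A(2) obox_def by (auto simp: PiE_iff extensional_def)
    then show "X \<in> range (\<lambda>(a, b). obox d a b)" by (intro image_eqI[of _ _ "(p, q)"]) simp_all
  next
    fix X assume "X \<in> range (\<lambda>(a, b). obox d a b)"
    then obtain a b where X: "X = obox d a b" by auto
    have "X = {f \<in> (\<Pi>\<^sub>E i\<in>{..<d}. UNIV). \<forall>i\<in>{..<d}. f i \<in> {a i<..<b i}}"
      unfolding X obox_def PiE_def Pi_def by blast
    moreover have "{a i<..<b i} \<in> ?E" for i by (intro image_eqI[of _ _ "(a i, b i)"]) simp_all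
    then have "(\<lambda>i. {a i<..<b i}) \<in> {..<d} \<rightarrow> ?E" by (intro Pi_I)
    ultimately show "X \<in> P" unfolding P_def by (intro CollectI exI[of _ "\<lambda>i. {a i<..<b i}"] exI[of _ "{..<d}"]) simp
  qed
  finally show ?thesis .
qed

lemma Union_obox: "(\<Union>n::nat. obox d (\<lambda>_. - real n) (\<lambda>_. real n)) = Rd d"
proof -
  have "x \<in> (\<Union>n::nat. obox d (\<lambda>_. - real n) (\<lambda>_. real n))" if "x \<in> Rd d" for x
  proof -
    obtain n :: nat where n: "(\<Sum>i<d. \<bar>x i\<bar>) < real n" using reals_Archimedean2 by blast
    have "\<bar>x i\<bar> < real n" if "i < d" for i
      using n member_le_sum[of i "{..<d}" "\<lambda>i. \<bar>x i\<bar>"] that by simp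
    then have "x \<in> obox d (\<lambda>_. - real n) (\<lambda>_. real n)"
      using that by (fastforce simp: obox_def Rd_def PiE_iff abs_less_iff)
    then show ?thesis by blast
  qed
  then show ?thesis by (auto simp: obox_def Rd_def PiE_iff)
qed

text \<open>The positive and the negative part of \<open>u\<close> are densities of two measures
  that agree on boxes, hence everywhere. Densities are unique almost everywhere, so the two parts
  coincide; as they are never both positive, both vanish.\<close>

lemma AE_zero_if_obox_integrals_zero:
  fixes u :: "(nat \<Rightarrow> real) \<Rightarrow> real"
  assumes u: "integrable (lborel_Rd d) u"
    and zero: "\<And>a b. (\<integral>x. indicator (obox d a b) x * u x \<partial>lborel_Rd d) = 0"
  shows "AE x in lborel_Rd d. u x = 0"
proof -
  let ?N = "lborel_Rd d"
  let ?p = "\<lambda>x. ennreal (max 0 (u x))" and ?q = "\<lambda>x. ennreal (max 0 (- u x))"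
  have [measurable]: "u \<in> borel_measurable ?N" using u by auto
  have eq: "(\<integral>\<^sup>+x\<in>A. ?p x \<partial>?N) = ennreal (\<integral>x. indicator A x * max 0 (u x) \<partial>?N)"
    "(\<integral>\<^sup>+x\<in>A. ?q x \<partial>?N) = ennreal (\<integral>x. indicator A x * max 0 (- u x) \<partial>?N)"
    "integrable ?N (\<lambda>x. indicator A x * max 0 (u x))" "integrable ?N (\<lambda>x. indicator A x * max 0 (- u x))"
    if [measurable]: "A \<in> sets ?N" for A
  proof -
    show 1: "integrable ?N (\<lambda>x. indicator A x * max 0 (u x))"
      by (rule Bochner_Integration.integrable_bound[OF u]) (auto simp: indicator_def)
    show 2: "integrable ?N (\<lambda>x. indicator A x * max 0 (- u x))"
      by (rule Bochner_Integration.integrable_bound[OF u]) (auto simp: indicator_def)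
    show "(\<integral>\<^sup>+x\<in>A. ?p x \<partial>?N) = ennreal (\<integral>x. indicator A x * max 0 (u x) \<partial>?N)"
      by (subst nn_integral_eq_integral[OF 1, symmetric]) (auto intro!: nn_integral_cong split: split_indicator)
    show "(\<integral>\<^sup>+x\<in>A. ?q x \<partial>?N) = ennreal (\<integral>x. indicator A x * max 0 (- u x) \<partial>?N)"
      by (subst nn_integral_eq_integral[OF 2, symmetric]) (auto intro!: nn_integral_cong split: split_indicator)
  qed
  have "density ?N ?p = density ?N ?q"
  proof (rule measure_eqI_generator_eq[where \<Omega>="Rd d" and E="range (\<lambda>(a, b). obox d a b)" 
        and A="\<lambda>n. obox d (\<lambda>_. - real n) (\<lambda>_. real n)"])
    show "Int_stable (range (\<lambda>(a, b). obox d a b))"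
      unfolding Int_stable_def using obox_Int by fastforce
    show "range (\<lambda>(a, b). obox d a b) \<subseteq> Pow (Rd d)" by (auto simp: obox_def Rd_def PiE_iff)
    fix X assume "X \<in> range (\<lambda>(a, b). obox d a b)"
    then obtain a b where X: "X = obox d a b" by auto
    have [measurable]: "X \<in> sets ?N" by (simp add: X)
    have "(\<integral>x. indicator X x * max 0 (u x) \<partial>?N) - (\<integral>x. indicator X x * max 0 (- u x) \<partial>?N)
       = (\<integral>x. indicator X x * max 0 (u x) - indicator X x * max 0 (- u x) \<partial>?N)"
      by (rule Bochner_Integration.integral_diff[symmetric]) (auto intro: eq)
    also have "\<dots> = (\<integral>x. indicator X x * u x \<partial>?N)"
      by (rule Bochner_Integration.integral_cong) (auto simp: max_def split: split_indicator)
    finally show "emeasure (density ?N ?p) X = emeasure (density ?N ?q) X"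
      using zero[of a b] eq(1,2)[of X] by (simp add: emeasure_density X)
  next
    fix n
    show "emeasure (density ?N ?p) (obox d (\<lambda>_. - real n) (\<lambda>_. real n)) \<noteq> \<infinity>"
      using eq(1)[of "obox d (\<lambda>_. - real n) (\<lambda>_. real n)"] by (simp add: emeasure_density)
  next
    show "range (\<lambda>n. obox d (\<lambda>_. - real n) (\<lambda>_. real n)) \<subseteq> range (\<lambda>(a, b). obox d a b)"
      by fast
  qed (simp_all add: sets_lborel_Rd_eq_sigma_obox Union_obox)
  then have "AE x in ?N. ?p x = ?q x" by (intro lborel_Rd_sigma.density_unique) auto
  then show ?thesis by eventually_elim (auto simp: max_def split: if_splits)
qed

section \<open>Tensor products and bump functions\<close>

text \<open>\<open>u i k\<close> is the \<open>k\<close>-th derivative of the factor in coordinate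
  \<open>i\<close>, and \<open>n i\<close> the order reached so far. Differentiating in direction
  \<open>j\<close> only raises \<open>n j\<close>, so all iterated partial derivatives of a product
  stay in one explicit family. Smoothness of bumps and of Gaussians is checked this way.\<close>

lemma partial_prod:
  fixes u :: "nat \<Rightarrow> nat \<Rightarrow> real \<Rightarrow> 'a::real_normed_field"
  assumes u: "\<And>i k t. (u i k has_vector_derivative u i (Suc k) t) (at t)" and j: "j < d"
  shows "((\<lambda>t. \<Prod>i<d. u i (n i) ((x(j := t)) i)) has_vector_derivative
            (\<Prod>i<d. u i (if i = j then Suc (n i) else n i) (x i))) (at (x j))"
proof -
  have split: "(\<Prod>i<d. g i) = g j * (\<Prod>i\<in>{..<d} - {j}. g i)" for g :: "nat \<Rightarrow> 'a"
    using j by (simp add: prod.remove)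
  have eq: "(\<Prod>i<d. u i (n i) ((x(j := t)) i)) = u j (n j) t * (\<Prod>i\<in>{..<d} - {j}. u i (n i) (x i))" for t
    by (subst split) (auto intro!: prod.cong)
  have "((\<lambda>t. u j (n j) t * (\<Prod>i\<in>{..<d} - {j}. u i (n i) (x i))) has_vector_derivative
      u j (Suc (n j)) (x j) * (\<Prod>i\<in>{..<d} - {j}. u i (n i) (x i))) (at (x j))"
    by (rule has_vector_derivative_mult_left[OF u])
  also have "u j (Suc (n j)) (x j) * (\<Prod>i\<in>{..<d} - {j}. u i (n i) (x i)) =
      (\<Prod>i<d. u i (if i = j then Suc (n i) else n i) (x i))"
    by (subst split) (auto intro!: prod.cong)
  finally show ?thesis unfolding eq .
qed

lemma foldr_partial_prod:
  fixes u :: "nat \<Rightarrow> nat \<Rightarrow> real \<Rightarrow> 'a::real_normed_field"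
  assumes u: "\<And>i k t. (u i k has_vector_derivative u i (Suc k) t) (at t)"
    and "is \<in> lists {..<d}"
  shows "foldr partial is (\<lambda>x. \<Prod>i<d. u i 0 (x i)) = (\<lambda>x. \<Prod>i<d. u i (count_list is i) (x i))"
  using assms(2)
proof (induction "is")
  case (Cons j js)
  then have j: "j < d" by simp
  have "foldr partial (j # js) (\<lambda>x. \<Prod>i<d. u i 0 (x i)) = partial j (\<lambda>x. \<Prod>i<d. u i (count_list js i) (x i))"
    using Cons by simp
  also have "\<dots> = (\<lambda>x. \<Prod>i<d. u i (if i = j then Suc (count_list js i) else count_list js i) (x i))"
    unfolding partial_def by (intro ext vector_derivative_at partial_prod[where u=u, OF u j])
  also have "\<dots> = (\<lambda>x. \<Prod>i<d. u i (count_list (j # js) i) (x i))"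
    by (intro ext prod.cong) auto
  finally show ?case .
qed simp

lemma smooth_Rd_prod:
  fixes u :: "nat \<Rightarrow> nat \<Rightarrow> real \<Rightarrow> 'a::real_normed_field"
  assumes u: "\<And>i k t. (u i k has_vector_derivative u i (Suc k) t) (at t)"
  shows "smooth_Rd d (\<lambda>x. \<Prod>i<d. u i 0 (x i))"
  unfolding smooth_Rd_def
proof (intro ballI conjI allI impI)
  fix "is" assume "is": "is \<in> lists {..<d}"
  note eq = foldr_partial_prod[where u=u, OF u "is"]
  have c: "continuous_map (Rd_topology d) euclidean (\<lambda>x. u i k (x i))" if "i < d" for i k
  proof -
    have "continuous_on UNIV (u i k)"
      by (intro continuous_at_imp_continuous_on ballI has_vector_derivative_continuous[OF u])
    then have "continuous_map euclidean euclidean (u i k)" by simp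
    moreover have "continuous_map (Rd_topology d) euclidean (\<lambda>x. x i)"
      unfolding Rd_topology_def using that by (intro continuous_map_product_projection) auto
    ultimately show ?thesis
      using continuous_map_compose[of "Rd_topology d" euclidean "\<lambda>x. x i" euclidean "u i k"] by (simp add: o_def)
  qed
  show "continuous_map (Rd_topology d) euclidean (foldr partial is (\<lambda>x. \<Prod>i<d. u i 0 (x i)))"
    unfolding eq using c by (auto simp: continuous_map_atin intro!: tendsto_prod)
  fix x j assume "j < d"
  show "(\<lambda>t. foldr partial is (\<lambda>x. \<Prod>i<d. u i 0 (x i)) (x(j := t))) differentiable at (x j)"
    unfolding eq by (rule differentiableI_vector[OF partial_prod[where u=u, OF u \<open>j < d\<close>]])
qed

text \<open>Dependent choice inside a set closed under differentiation: all higher derivatives are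
  obtained without a formula for them, and membership in \<open>A\<close> hands each of them the
  estimates known on \<open>A\<close>.\<close>

lemma derivative_sequence_exists:
  fixes A :: "(real \<Rightarrow> 'a::real_normed_vector) set"
  assumes "\<And>f. f \<in> A \<Longrightarrow> \<exists>g\<in>A. \<forall>t. (f has_vector_derivative g t) (at t)" and "f \<in> A"
  shows "\<exists>u. u 0 = f \<and> (\<forall>k. u k \<in> A) \<and> (\<forall>k t. (u k has_vector_derivative u (Suc k) t) (at t))"
proof -
  have "\<exists>u. \<forall>k. (u k \<in> A \<and> (k = 0 \<longrightarrow> u k = f)) \<and> (\<forall>t. (u k has_vector_derivative u (Suc k) t) (at t))"
    by (rule dependent_nat_choice) (use assms in auto)
  then show ?thesis by blast
qed

text \<open>The classical smooth function \<open>exp (- 1 / s)\<close>, with a polynomial in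
  \<open>1 / s\<close> in front so that derivatives stay in the family.\<close>

definition flat :: "real poly \<Rightarrow> real \<Rightarrow> real" where
  "flat p s = (if s \<le> 0 then 0 else poly p (1 / s) * exp (- 1 / s))"

lemma poly_exp_minus_tendsto_0:
  fixes p :: "real poly"
  shows "((\<lambda>y. poly p y * exp (- y)) \<longlongrightarrow> 0) at_top"
proof -
  have "((\<lambda>y. \<Sum>i\<le>degree p. coeff p i * (y ^ i / exp y)) \<longlongrightarrow> (\<Sum>i\<le>degree p. coeff p i * 0)) at_top"
    by (intro tendsto_intros tendsto_power_div_exp_0)
  then show ?thesis
    by (simp add: poly_altdef sum_distrib_right exp_minus divide_inverse mult.assoc)
qed

text \<open>\<open>[:0, 0, 1:]\<close> is the square of the variable: the inner derivative brings
  out \<open>1 / s^2\<close>, with sign plus from the exponential and minus from the polynomial. At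
  0 the exponential beats every power of \<open>1 / s\<close>.\<close>

lemma flat_has_derivative:
  "(flat p has_vector_derivative flat ([:0, 0, 1:] * (p - pderiv p)) s) (at s)"
proof -
  let ?q = "[:0, 0, 1:] * (p - pderiv p)"
  have "(flat p has_real_derivative flat ?q s) (at s)"
  proof (cases s "0::real" rule: linorder_cases)
    case less
    have "(flat p has_real_derivative 0) (at s)"
      by (rule has_field_derivative_transform_within_open[of "\<lambda>_. 0" _ _ "{..<0}"])
        (use less in \<open>auto simp: flat_def\<close>)
    then show ?thesis using less by (simp add: flat_def)
  next
    case greater
    have "((\<lambda>s. poly p (1 / s) * exp (- 1 / s)) has_real_derivative
        poly (pderiv p) (1 / s) * (- 1 / s\<^sup>2) * exp (- 1 / s) + poly p (1 / s) * (exp (- 1 / s) * (1 / s\<^sup>2))) (at s)"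
      using greater
      by (auto intro!: derivative_eq_intros DERIV_chain2[of "poly p"] poly_DERIV simp: power2_eq_square divide_simps)
    moreover have "poly (pderiv p) (1 / s) * (- 1 / s\<^sup>2) * exp (- 1 / s) + poly p (1 / s) * (exp (- 1 / s) * (1 / s\<^sup>2)) = flat ?q s"
      using greater by (simp add: flat_def power2_eq_square field_simps)
    ultimately have "((\<lambda>s. poly p (1 / s) * exp (- 1 / s)) has_real_derivative flat ?q s) (at s)" by simp
    then show ?thesis
      by (rule has_field_derivative_transform_within_open[of _ _ _ "{0<..}"])
        (use greater in \<open>auto simp: flat_def\<close>)
  next
    case equal
    have "((\<lambda>h. flat p h / h) \<longlongrightarrow> 0) (at_right 0)"
    proof -
      \<comment> \<open>Dividing by \<open>h\<close> multiplies the polynomial by its variable,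
        evaluated at \<open>inverse h\<close>; this is the effect of \<open>pCons 0\<close>.\<close>
      have "((\<lambda>h. poly (pCons 0 p) (inverse h) * exp (- inverse h)) \<longlongrightarrow> 0) (at_right 0)"
        by (rule filterlim_compose[OF poly_exp_minus_tendsto_0 filterlim_inverse_at_top_right])
      then show ?thesis
        by (rule Lim_transform_eventually)
          (auto simp: flat_def eventually_at_right_less field_simps intro!: eventually_mono[OF eventually_at_right_less])
    qed
    moreover have "((\<lambda>h. flat p h / h) \<longlongrightarrow> 0) (at_left 0)"
      by (rule Lim_transform_eventually[of "\<lambda>_. 0"])
        (auto simp: flat_def eventually_at_filter)
    ultimately have "((\<lambda>h. flat p h / h) \<longlongrightarrow> 0) (at 0)"
      by (simp add: filterlim_split_at)
    then show ?thesis using equal by (simp add: DERIV_def flat_def)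
  qed
  then show ?thesis by (simp add: has_real_derivative_iff_has_vector_derivative)
qed

text \<open>The algebra generated by flat functions of the scaled distances to both end points.
  Chain and product rule keep derivatives inside, so \<open>derivative_sequence_exists\<close>
  applies to the product that forms a bump.\<close>

inductive_set bump_algebra :: "real \<Rightarrow> real \<Rightarrow> real \<Rightarrow> (real \<Rightarrow> real) set" for n a b where
  left: "(\<lambda>t. flat p (n * (t - a))) \<in> bump_algebra n a b"
| right: "(\<lambda>t. flat p (n * (b - t))) \<in> bump_algebra n a b"
| const: "(\<lambda>t. c) \<in> bump_algebra n a b"
| add: "f \<in> bump_algebra n a b \<Longrightarrow> g \<in> bump_algebra n a b \<Longrightarrow> (\<lambda>t. f t + g t) \<in> bump_algebra n a b"
| mult: "f \<in> bump_algebra n a b \<Longrightarrow> g \<in> bump_algebra n a b \<Longrightarrow> (\<lambda>t. f t * g t) \<in> bump_algebra n a b"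

lemma bump_algebra_derivative:
  assumes "f \<in> bump_algebra n a b"
  shows "\<exists>g\<in>bump_algebra n a b. \<forall>t. (f has_vector_derivative g t) (at t)"
  using assms
proof induction
  case (left p)
  let ?q = "[:0, 0, 1:] * (p - pderiv p)"
  have "((\<lambda>t. flat p (n * (t - a))) has_vector_derivative n * flat ?q (n * (t - a))) (at t)" for t
  proof -
    have "((\<lambda>t. n * (t - a)) has_vector_derivative n) (at t)"
      by (auto intro!: derivative_eq_intros)
    from vector_diff_chain_at[OF this flat_has_derivative] show ?thesis by (simp add: o_def)
  qed
  then show ?case
    by (intro bexI[of _ "\<lambda>t. n * flat ?q (n * (t - a))"] allI bump_algebra.mult bump_algebra.const bump_algebra.left)
next
  case (right p)
  let ?q = "[:0, 0, 1:] * (p - pderiv p)"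
  have "((\<lambda>t. flat p (n * (b - t))) has_vector_derivative - n * flat ?q (n * (b - t))) (at t)" for t
  proof -
    have "((\<lambda>t. n * (b - t)) has_vector_derivative - n) (at t)"
      by (auto intro!: derivative_eq_intros)
    from vector_diff_chain_at[OF this flat_has_derivative] show ?thesis by (simp add: o_def)
  qed
  then show ?case
    by (intro bexI[of _ "\<lambda>t. - n * flat ?q (n * (b - t))"] allI bump_algebra.mult bump_algebra.const bump_algebra.right)
next
  case (const c)
  show ?case by (intro bexI[of _ "\<lambda>_. 0"]) (auto intro: bump_algebra.const)
next
  case (add f g)
  then obtain f' g' where "f' \<in> bump_algebra n a b" "\<forall>t. (f has_vector_derivative f' t) (at t)"
    "g' \<in> bump_algebra n a b" "\<forall>t. (g has_vector_derivative g' t) (at t)" by blast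
  then show ?case
    by (intro bexI[of _ "\<lambda>t. f' t + g' t"]) (auto intro: bump_algebra.add has_vector_derivative_add)
next
  case (mult f g)
  then obtain f' g' where "f' \<in> bump_algebra n a b" "\<forall>t. (f has_vector_derivative f' t) (at t)"
    "g' \<in> bump_algebra n a b" "\<forall>t. (g has_vector_derivative g' t) (at t)" by blast
  then show ?case using mult.hyps
    by (intro bexI[of _ "\<lambda>t. f t * g' t + f' t * g t"])
      (auto intro: bump_algebra.add bump_algebra.mult has_vector_derivative_mult)
qed

text \<open>For every \<open>n\<close> the function vanishes outside \<open>{a..b}\<close>; growing
  \<open>n\<close> steepens both flanks and drives it to the indicator of the open interval.\<close>

definition bump :: "nat \<Rightarrow> real \<Rightarrow> real \<Rightarrow> real \<Rightarrow> real" where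
  "bump n a b t = flat 1 (real n * (t - a)) * flat 1 (real n * (b - t))"

lemma bump_derivative_sequence:
  "\<exists>u. u 0 = bump n a b \<and> (\<forall>k t. (u k has_vector_derivative u (Suc k) t) (at t))"
proof -
  have "bump n a b \<in> bump_algebra (real n) a b"
    unfolding bump_def[abs_def] by (intro bump_algebra.intros)
  from derivative_sequence_exists[OF bump_algebra_derivative this] show ?thesis by blast
qed

lemma flat_1_bounds: "0 \<le> flat 1 s" "flat 1 s \<le> 1"
  by (auto simp: flat_def)

lemma bump_bounds: "0 \<le> bump n a b t" "bump n a b t \<le> 1"
  unfolding bump_def using flat_1_bounds by (auto intro: mult_le_one)

lemma bump_eq_0: "t \<notin> {a..b} \<Longrightarrow> bump n a b t = 0"
  by (auto simp: bump_def flat_def mult_nonneg_nonpos)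

lemma bump_tendsto: "(\<lambda>n. bump n a b t) \<longlonglongrightarrow> indicator {a<..<b} t"
proof -
  have flat: "(\<lambda>n. flat 1 (real n * s)) \<longlonglongrightarrow> (if 0 < s then 1 else 0)" for s
  proof (cases "0 < s")
    case True
    have "(\<lambda>n. exp (- (1 / s) * inverse (real n))) \<longlonglongrightarrow> exp (- (1 / s) * 0)"
      by (intro tendsto_intros lim_inverse_n)
    moreover have "eventually (\<lambda>n. exp (- (1 / s) * inverse (real n)) = flat 1 (real n * s)) sequentially"
      using eventually_gt_at_top[of 0]
      by eventually_elim (use True in \<open>auto simp: flat_def mult_le_0_iff field_simps\<close>)
    ultimately show ?thesis using True by (simp add: tendsto_cong)
  qed (auto simp: flat_def mult_nonneg_nonpos)
  have "(\<lambda>n. bump n a b t) \<longlonglongrightarrow> (if 0 < t - a then 1 else 0) * (if 0 < b - t then 1 else 0)"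
    unfolding bump_def by (intro tendsto_mult flat)
  then show ?thesis by (auto simp: indicator_def)
qed

lemma test_function_bump:
  assumes "cbox_Rd d a b \<subseteq> \<Omega>"
  shows "test_function d \<Omega> (\<lambda>x. \<Prod>i<d. bump n (a i) (b i) (x i))"
proof -
  have "\<forall>i. \<exists>u. u 0 = bump n (a i) (b i) \<and> (\<forall>k t. (u k has_vector_derivative u (Suc k) t) (at t))"
    using bump_derivative_sequence by blast
  then obtain u where u: "\<And>i. u i 0 = bump n (a i) (b i)"
      "\<And>i k t. (u i k has_vector_derivative u i (Suc k) t) (at t)"
    by metis
  show ?thesis unfolding test_function_def
  proof (intro conjI exI[of _ "cbox_Rd d a b"] assms compactin_cbox_Rd ballI)
    show "smooth_Rd d (\<lambda>x. \<Prod>i<d. bump n (a i) (b i) (x i))"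
      using smooth_Rd_prod[of u d] u by simp
    fix x assume "x \<in> Rd d - cbox_Rd d a b"
    then obtain i where "i < d" "x i \<notin> {a i..b i}" by (auto simp: Rd_def cbox_Rd_def PiE_iff)
    then show "(\<Prod>i<d. bump n (a i) (b i) (x i)) = 0"
      using bump_eq_0[of "x i" "a i" "b i" n] by auto
  qed
qed

section \<open>Uniqueness of weak derivatives\<close>

lemma space_lebesgue_Rd: "space (lebesgue_Rd d) = Rd d"
  by (simp add: lebesgue_Rd_def space_lborel_Rd)

lemma sets_lebesgue_Rd [intro]: "A \<in> sets (lborel_Rd d) \<Longrightarrow> A \<in> sets (lebesgue_Rd d)"
  by (simp add: lebesgue_Rd_def)

lemma measurable_lebesgue_Rd: "f \<in> lborel_Rd d \<rightarrow>\<^sub>M M \<Longrightarrow> f \<in> lebesgue_Rd d \<rightarrow>\<^sub>M M"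
  unfolding lebesgue_Rd_def by (rule measurable_completion)

section \<open>Passing between a measure and its completion\<close>

lemma completion_measurable_AE:
  fixes u v :: "'a \<Rightarrow> 'b::topological_space"
  assumes v: "v \<in> borel_measurable M" and eq: "AE x in M. u x = v x"
  shows "u \<in> borel_measurable (completion M)"
proof (rule measurableI)
  fix A :: "'b set" assume A: "A \<in> sets borel"
  show "u -` A \<inter> space (completion M) \<in> sets (completion M)"
  proof (rule complete_measure.in_sets_AE)
    show "complete_measure (completion M)" by unfold_locales
    show "AE x in completion M. x \<in> v -` A \<inter> space (completion M) \<longleftrightarrow> x \<in> u -` A \<inter> space (completion M)"
      using AE_completion[OF eq] by eventually_elim auto
    show "v -` A \<inter> space (completion M) \<in> sets (completion M)"
      using v A by (auto intro: measurable_sets)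
    show "u -` A \<inter> space (completion M) \<subseteq> space (completion M)" by blast
  qed
qed simp

text \<open>The definitions integrate against completed measures, whereas Fubini and products of
  integrals are used on the uncompleted ones. Any Borel function that agrees almost everywhere may
  stand in for the integrand.\<close>

lemma
  fixes u v :: "'a \<Rightarrow> 'b::{banach, second_countable_topology}"
  assumes v: "v \<in> borel_measurable M" and eq: "AE x in M. u x = v x"
  shows integral_completion_AE: "integral\<^sup>L (completion M) u = integral\<^sup>L M v"
    and integrable_completion_AE: "integrable (completion M) u \<longleftrightarrow> integrable M v"
proof -
  note m = completion_measurable_AE[OF assms] measurable_completion[OF v]
  have "integral\<^sup>L (completion M) u = integral\<^sup>L (completion M) v"
    by (rule integral_cong_AE) (use m eq in \<open>auto intro: AE_completion\<close>)
  then show "integral\<^sup>L (completion M) u = integral\<^sup>L M v"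
    using v by (simp add: integral_completion)
  have "integrable (completion M) u \<longleftrightarrow> integrable (completion M) v"
    by (rule integrable_cong_AE) (use m eq in \<open>auto intro: AE_completion\<close>)
  then show "integrable (completion M) u \<longleftrightarrow> integrable M v"
    using v by (simp add: integrable_completion)
qed

lemma
  fixes u v :: "_ \<Rightarrow> 'b::{banach, second_countable_topology}"
  assumes v: "v \<in> borel_measurable (lborel_Rd d)" and eq: "AE x in lborel_Rd d. u x = v x"
  shows integral_lebesgue_Rd_AE: "integral\<^sup>L (lebesgue_Rd d) u = integral\<^sup>L (lborel_Rd d) v"
    and integrable_lebesgue_Rd_AE: "integrable (lebesgue_Rd d) u \<longleftrightarrow> integrable (lborel_Rd d) v"
  unfolding lebesgue_Rd_def by (rule integral_completion_AE[OF assms], rule integrable_completion_AE[OF assms])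

lemma lebesgue_Rd_borel_version:
  fixes u :: "_ \<Rightarrow> real"
  assumes "u \<in> borel_measurable (lebesgue_Rd d)"
  shows "\<exists>v\<in>borel_measurable (lborel_Rd d). AE x in lborel_Rd d. u x = v x"
  by (rule completion_ex_borel_measurable_real[OF assms[unfolded lebesgue_Rd_def]])

lemma lebesgue_Rd_borel_version_complex:
  fixes u :: "_ \<Rightarrow> complex"
  assumes "u \<in> borel_measurable (lebesgue_Rd d)"
  shows "\<exists>v\<in>borel_measurable (lborel_Rd d). AE x in lborel_Rd d. u x = v x"
proof -
  have "(\<lambda>x. Re (u x)) \<in> borel_measurable (lebesgue_Rd d)" "(\<lambda>x. Im (u x)) \<in> borel_measurable (lebesgue_Rd d)"
    using assms by simp_all
  from this[THEN lebesgue_Rd_borel_version]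
  obtain p q where pq: "p \<in> borel_measurable (lborel_Rd d)" "AE x in lborel_Rd d. Re (u x) = p x"
      "q \<in> borel_measurable (lborel_Rd d)" "AE x in lborel_Rd d. Im (u x) = q x"
    by auto
  have "AE x in lborel_Rd d. u x = Complex (p x) (q x)"
    using pq(2,4) by eventually_elim (simp add: complex_eq_iff)
  moreover have "(\<lambda>x. Complex (p x) (q x)) \<in> borel_measurable (lborel_Rd d)"
    unfolding Complex_eq using pq(1,3) by simp
  ultimately show ?thesis by (intro bexI[of _ "\<lambda>x. Complex (p x) (q x)"])
qed

lemma lebesgue_Rd_AE_zero_if_obox_integrals_zero:
  fixes u :: "_ \<Rightarrow> real"
  assumes u: "integrable (lebesgue_Rd d) u"
    and zero: "\<And>a b. (\<integral>x. indicator (obox d a b) x * u x \<partial>lebesgue_Rd d) = 0"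
  shows "AE x in lborel_Rd d. u x = 0"
proof -
  obtain v where v: "v \<in> borel_measurable (lborel_Rd d)" "AE x in lborel_Rd d. u x = v x"
    using lebesgue_Rd_borel_version[OF borel_measurable_integrable[OF u]] by blast
  have "AE x in lborel_Rd d. v x = 0"
  proof (rule AE_zero_if_obox_integrals_zero)
    show "integrable (lborel_Rd d) v" using integrable_lebesgue_Rd_AE[OF v] u by simp
    fix a b
    have "(\<integral>x. indicator (obox d a b) x * u x \<partial>lebesgue_Rd d) = (\<integral>x. indicator (obox d a b) x * v x \<partial>lborel_Rd d)"
      by (rule integral_lebesgue_Rd_AE) (use v in auto)
    then show "(\<integral>x. indicator (obox d a b) x * v x \<partial>lborel_Rd d) = 0" using zero by simp
  qed
  with v(2) show ?thesis by eventually_elim simp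
qed

section \<open>Testing locally integrable functions\<close>

lemma test_function_cong_zero:
  assumes "K \<subseteq> \<Omega>" "\<forall>x\<in>Rd d - K. \<phi> x = (0::real)" "x \<in> Rd d"
  shows "indicator \<Omega> x * (u x * \<phi> x) = indicator K x * u x * \<phi> x"
  using assms by (auto split: split_indicator)

lemma test_function_measurable:
  assumes "test_function d \<Omega> \<phi>"
  shows "\<phi> \<in> borel_measurable (lborel_Rd d)"
proof -
  have "smooth_Rd d \<phi>" using assms by (simp add: test_function_def)
  then have "continuous_map (Rd_topology d) euclidean (foldr partial [] \<phi>)"
    unfolding smooth_Rd_def by blast
  then show ?thesis by (simp add: continuous_map_Rd_measurable)
qed

lemma test_function_bounded:
  assumes "test_function d \<Omega> \<phi>"
  shows "\<exists>B. \<forall>x\<in>Rd d. \<bar>\<phi> x\<bar> \<le> B"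
proof -
  obtain K where K: "K \<subseteq> \<Omega>" "compactin (Rd_topology d) K" "\<forall>x\<in>Rd d - K. \<phi> x = 0"
    and sm: "smooth_Rd d \<phi>" using assms by (auto simp: test_function_def)
  have "continuous_map (Rd_topology d) euclidean (foldr partial [] \<phi>)"
    using sm unfolding smooth_Rd_def by blast
  then have "compactin euclidean (\<phi> ` K)" by (intro image_compactin[OF K(2)]) simp
  then have "bounded (\<phi> ` K)" by (simp add: compact_imp_bounded)
  then obtain B where "\<And>x. x \<in> K \<Longrightarrow> \<bar>\<phi> x\<bar> \<le> B" by (auto simp: bounded_iff)
  then have "\<bar>\<phi> x\<bar> \<le> max B 0" if "x \<in> Rd d" for x
    using K(3) that by (cases "x \<in> K") (auto simp: le_max_iff_disj)
  then show ?thesis by blast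
qed

lemma locally_integrable_times_test_function:
  assumes u: "locally_integrable d \<Omega> u" and \<phi>: "test_function d \<Omega> \<phi>"
  shows "integrable (lebesgue_Rd d) (\<lambda>x. indicator \<Omega> x * (u x * \<phi> x))"
proof -
  obtain K where K: "K \<subseteq> \<Omega>" "compactin (Rd_topology d) K" "\<forall>x\<in>Rd d - K. \<phi> x = 0"
    using \<phi> by (auto simp: test_function_def)
  obtain B where B: "\<forall>x\<in>Rd d. \<bar>\<phi> x\<bar> \<le> B" using test_function_bounded[OF \<phi>] by blast
  have i: "integrable (lebesgue_Rd d) (\<lambda>x. indicator K x * u x)"
    using u K by (auto simp: locally_integrable_def set_integrable_def)
  have [measurable]: "\<phi> \<in> borel_measurable (lebesgue_Rd d)"
    by (rule measurable_lebesgue_Rd[OF test_function_measurable[OF \<phi>]])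
  have "integrable (lebesgue_Rd d) (\<lambda>x. indicator K x * u x * \<phi> x)"
  proof (rule Bochner_Integration.integrable_bound)
    show "integrable (lebesgue_Rd d) (\<lambda>x. B * (indicator K x * u x))" using i by simp
    have "\<bar>indicator K x * u x * \<phi> x\<bar> \<le> \<bar>B * (indicator K x * u x)\<bar>" if "x \<in> Rd d" for x
    proof -
      have "\<bar>\<phi> x\<bar> \<le> \<bar>B\<bar>" using B that by force
      then show ?thesis by (auto simp: abs_mult mult.commute intro: mult_right_mono split: split_indicator)
    qed
    then show "AE x in lebesgue_Rd d. norm (indicator K x * u x * \<phi> x) \<le> norm (B * (indicator K x * u x))"
      by (intro AE_I2) (simp add: space_lebesgue_Rd)
    show "(\<lambda>x. indicator K x * u x * \<phi> x) \<in> borel_measurable (lebesgue_Rd d)"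
      by (intro borel_measurable_times borel_measurable_integrable[OF i]) measurable
  qed
  then show ?thesis
    by (subst Bochner_Integration.integrable_cong[OF refl test_function_cong_zero[OF K(1,3)]])
      (auto simp: space_lebesgue_Rd)
qed

text \<open>Fundamental lemma of the calculus of variations. Since \<open>u\<close> is only locally
  integrable, it is cut off to a box whose closure lies in \<open>\<Omega>\<close>; there bumps
  increase to indicators of smaller boxes under the bound \<open>|u|\<close>, and vanishing box
  integrals suffice.\<close>

lemma AE_zero_if_test_integrals_zero:
  assumes \<Omega>: "openin (Rd_topology d) \<Omega>" and u: "locally_integrable d \<Omega> u"
    and zero: "\<And>\<phi>. test_function d \<Omega> \<phi> \<Longrightarrow> (LINT x:\<Omega>|lebesgue_Rd d. u x * \<phi> x) = 0"
  shows "AE x in lborel_Rd d. x \<in> \<Omega> \<longrightarrow> u x = 0"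
proof -
  have box: "AE x in lborel_Rd d. indicator (obox d a b) x * u x = 0" if ab: "cbox_Rd d a b \<subseteq> \<Omega>" for a b
  proof (rule lebesgue_Rd_AE_zero_if_obox_integrals_zero)
    have ic: "integrable (lebesgue_Rd d) (\<lambda>x. indicator (cbox_Rd d a b) x * u x)"
      using u ab compactin_cbox_Rd[of d a b] by (auto simp: locally_integrable_def set_integrable_def)
    have io: "integrable (lebesgue_Rd d) (\<lambda>x. indicator (obox d p q) x * u x)" if "obox d p q \<subseteq> cbox_Rd d a b" for p q
    proof -
      have "integrable (lebesgue_Rd d) (\<lambda>x. indicator (obox d p q) x *\<^sub>R (indicator (cbox_Rd d a b) x * u x))"
        by (rule integrable_mult_indicator[OF _ ic]) auto
      moreover have "(\<lambda>x. indicator (obox d p q) x *\<^sub>R (indicator (cbox_Rd d a b) x * u x)) = (\<lambda>x. indicator (obox d p q) x * u x)"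
        using that by (intro ext) (auto split: split_indicator)
      ultimately show ?thesis by (simp only:)
    qed
    show "integrable (lebesgue_Rd d) (\<lambda>x. indicator (obox d a b) x * u x)"
      by (rule io[OF obox_subset_cbox])
    fix a' b'
    \<comment> \<open>The box to be tested is intersected with \<open>obox d a b\<close>, so that
      the bumps are supported in a closed box inside \<open>\<Omega>\<close>.\<close>
    define p q where "p = (\<lambda>i. max (a' i) (a i))" and "q = (\<lambda>i. min (b' i) (b i))"
    have sub: "cbox_Rd d p q \<subseteq> cbox_Rd d a b"
      unfolding cbox_Rd_def p_def q_def by (rule PiE_mono) auto
    have osub: "obox d p q \<subseteq> cbox_Rd d p q" by (rule obox_subset_cbox)
    define \<phi> where "\<phi> n x = (\<Prod>i<d. bump n (p i) (q i) (x i))" for n x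
    have \<phi>: "test_function d \<Omega> (\<phi> n)" for n
      unfolding \<phi>_def[abs_def] by (rule test_function_bump) (use sub ab in blast)
    have \<phi>0: "\<phi> n x = 0" if x: "x \<in> Rd d" "x \<notin> cbox_Rd d p q" for n x
    proof -
      obtain i where "i < d" "x i \<notin> {p i..q i}" using x by (auto simp: Rd_def cbox_Rd_def PiE_iff)
      then show ?thesis using bump_eq_0[of "x i" "p i" "q i" n] by (auto simp: \<phi>_def)
    qed
    have \<phi>1: "\<bar>\<phi> n x\<bar> \<le> 1" for n x
      using bump_bounds by (auto simp: \<phi>_def abs_prod intro!: prod_le_1)
    have lim: "(\<lambda>n. \<phi> n x) \<longlonglongrightarrow> indicator (obox d p q) x" if x: "x \<in> Rd d" for x
    proof -
      have "(\<lambda>n. \<phi> n x) \<longlonglongrightarrow> (\<Prod>i<d. indicator {p i<..<q i} (x i))"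
        unfolding \<phi>_def by (intro tendsto_prod bump_tendsto)
      moreover have "(\<Prod>i<d. indicator {p i<..<q i} (x i)) = (indicator (obox d p q) x :: real)"
      proof (cases "x \<in> obox d p q")
        case True then show ?thesis by (auto simp: obox_def PiE_iff intro!: prod.neutral)
      next
        case False
        then obtain i where "i < d" "x i \<notin> {p i<..<q i}" using x by (auto simp: Rd_def obox_def PiE_iff)
        then show ?thesis using False by (auto intro!: bexI[of _ i])
      qed
      ultimately show ?thesis by simp
    qed
    have [measurable]: "\<phi> n \<in> borel_measurable (lebesgue_Rd d)" for n
      by (rule measurable_lebesgue_Rd[OF test_function_measurable[OF \<phi>]])
    have "(\<lambda>n. \<integral>x. (indicator (cbox_Rd d a b) x * u x) * \<phi> n x \<partial>lebesgue_Rd d) \<longlonglongrightarrow>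
        (\<integral>x. indicator (obox d p q) x * u x \<partial>lebesgue_Rd d)"
    proof (rule integral_dominated_convergence[where w="\<lambda>x. \<bar>indicator (cbox_Rd d a b) x * u x\<bar>"])
      show "AE x in lebesgue_Rd d. (\<lambda>n. indicator (cbox_Rd d a b) x * u x * \<phi> n x) \<longlonglongrightarrow> indicator (obox d p q) x * u x"
      proof (rule AE_I2)
        fix x assume "x \<in> space (lebesgue_Rd d)"
        then have "(\<lambda>n. indicator (cbox_Rd d a b) x * u x * \<phi> n x) \<longlonglongrightarrow> indicator (cbox_Rd d a b) x * u x * indicator (obox d p q) x"
          by (intro tendsto_intros lim) (simp add: space_lebesgue_Rd)
        moreover have "indicator (cbox_Rd d a b) x * u x * indicator (obox d p q) x = indicator (obox d p q) x * u x"
          using sub osub by (auto simp: indicator_def)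
        ultimately show "(\<lambda>n. indicator (cbox_Rd d a b) x * u x * \<phi> n x) \<longlonglongrightarrow> indicator (obox d p q) x * u x" by simp
      qed
      show "AE x in lebesgue_Rd d. norm (indicator (cbox_Rd d a b) x * u x * \<phi> n x) \<le> \<bar>indicator (cbox_Rd d a b) x * u x\<bar>" for n
        using \<phi>1 by (auto simp: abs_mult intro!: AE_I2 mult_left_le)
      show "(\<lambda>x. indicator (obox d p q) x * u x) \<in> borel_measurable (lebesgue_Rd d)"
        by (rule borel_measurable_integrable[OF io]) (use sub osub in blast)
      show "(\<lambda>x. indicator (cbox_Rd d a b) x * u x * \<phi> n x) \<in> borel_measurable (lebesgue_Rd d)" for n
        by (intro borel_measurable_times borel_measurable_integrable[OF ic]) measurable
      show "integrable (lebesgue_Rd d) (\<lambda>x. \<bar>indicator (cbox_Rd d a b) x * u x\<bar>)"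
        by (rule integrable_abs[OF ic])
    qed
    moreover have "(\<integral>x. (indicator (cbox_Rd d a b) x * u x) * \<phi> n x \<partial>lebesgue_Rd d) = 0" for n
    proof -
      have "(\<integral>x. (indicator (cbox_Rd d a b) x * u x) * \<phi> n x \<partial>lebesgue_Rd d) = (LINT x:\<Omega>|lebesgue_Rd d. u x * \<phi> n x)"
        unfolding set_lebesgue_integral_def
        by (rule Bochner_Integration.integral_cong)
          (use \<phi>0 sub ab in \<open>auto simp: space_lebesgue_Rd indicator_def\<close>)
      then show ?thesis using zero[OF \<phi>] by simp
    qed
    ultimately have "(\<integral>x. indicator (obox d p q) x * u x \<partial>lebesgue_Rd d) = 0"
      by (simp add: LIMSEQ_const_iff)
    moreover have "(\<lambda>x. indicator (obox d a' b') x * (indicator (obox d a b) x * u x)) = (\<lambda>x. indicator (obox d p q) x * u x)"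
      unfolding p_def q_def obox_Int[symmetric] by (intro ext) (auto split: split_indicator)
    ultimately show "(\<integral>x. indicator (obox d a' b') x * (indicator (obox d a b) x * u x) \<partial>lebesgue_Rd d) = 0"
      by (simp only:)
  qed
  \<comment> \<open>One null set per rational box, hence countably many; the open boxes among them
    cover \<open>\<Omega>\<close>.\<close>
  have "AE x in lborel_Rd d. \<forall>ab\<in>{(a, b)\<in>rational_pairs d. cbox_Rd d a b \<subseteq> \<Omega>}. indicator (obox d (fst ab) (snd ab)) x * u x = 0"
    by (rule AE_ball_countable') (use box in \<open>auto intro: countable_subset[OF _ countable_rational_pairs]\<close>)
  then show ?thesis
  proof eventually_elim
    case (elim x)
    show ?case
    proof
      assume "x \<in> \<Omega>"
      then obtain a b where "(a, b) \<in> rational_pairs d" "x \<in> obox d a b" "cbox_Rd d a b \<subseteq> \<Omega>"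
        using openin_Rd_rational_box[OF \<Omega>] unfolding rational_pairs_def by blast
      then show "u x = 0" using elim by force
    qed
  qed
qed

text \<open>The Sobolev norm refers to an arbitrarily chosen weak derivative. This allows it to be
  replaced by an explicit one.\<close>

lemma weak_derivative_unique:
  assumes \<Omega>: "openin (Rd_topology d) \<Omega>"
    and h: "has_weak_derivative d \<Omega> \<alpha> g h" and h': "has_weak_derivative d \<Omega> \<alpha> g h'"
  shows "AE x in lborel_Rd d. x \<in> \<Omega> \<longrightarrow> h x = h' x"
proof -
  have l: "locally_integrable d \<Omega> h" "locally_integrable d \<Omega> h'"
    using h h' by (auto simp: has_weak_derivative_def)
  have "AE x in lborel_Rd d. x \<in> \<Omega> \<longrightarrow> h x - h' x = 0"
  proof (rule AE_zero_if_test_integrals_zero[OF \<Omega>])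
    show "locally_integrable d \<Omega> (\<lambda>x. h x - h' x)"
      using l by (auto simp: locally_integrable_def)
    fix \<phi> assume \<phi>: "test_function d \<Omega> \<phi>"
    have "(LINT x:\<Omega>|lebesgue_Rd d. (h x - h' x) * \<phi> x) =
        (LINT x:\<Omega>|lebesgue_Rd d. h x * \<phi> x) - (LINT x:\<Omega>|lebesgue_Rd d. h' x * \<phi> x)"
      using locally_integrable_times_test_function[OF l(1) \<phi>] locally_integrable_times_test_function[OF l(2) \<phi>]
      by (simp add: set_lebesgue_integral_def left_diff_distrib right_diff_distrib)
    also have "(LINT x:\<Omega>|lebesgue_Rd d. h x * \<phi> x) = (LINT x:\<Omega>|lebesgue_Rd d. h' x * \<phi> x)"
      using h h' \<phi> unfolding has_weak_derivative_def by auto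
    finally show "(LINT x:\<Omega>|lebesgue_Rd d. (h x - h' x) * \<phi> x) = 0" by simp
  qed
  then show ?thesis by simp
qed

section \<open>Gaussians and Fourier inversion\<close>

lemma measurable_cis [measurable (raw)]:
  assumes [measurable]: "f \<in> borel_measurable M"
  shows "(\<lambda>x. cis (f x)) \<in> borel_measurable M"
proof -
  have "cis \<in> borel_measurable borel"
    by (intro borel_measurable_continuous_onI continuous_intros)
  from measurable_compose[OF assms this] show ?thesis .
qed

text \<open>Serves the exchanges of integrals against plane waves: the kernel \<open>k\<close> has
  modulus at most \<open>C\<close>, and the two factors are integrable separately.\<close>

lemma (in pair_sigma_finite) integrable_times_bounded_kernel:
  fixes f :: "'a \<Rightarrow> complex" and g :: "'b \<Rightarrow> complex" and k :: "'a \<Rightarrow> 'b \<Rightarrow> complex"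
  assumes f: "integrable M1 f" and g: "integrable M2 g"
    and k: "(\<lambda>(x, y). k x y) \<in> borel_measurable (M1 \<Otimes>\<^sub>M M2)" "\<And>x y. norm (k x y) \<le> C"
  shows "integrable (M1 \<Otimes>\<^sub>M M2) (\<lambda>(x, y). f x * g y * k x y)"
proof -
  have [measurable]: "f \<in> borel_measurable M1" "g \<in> borel_measurable M2" using f g by auto
  have "integrable (M1 \<Otimes>\<^sub>M M2) (\<lambda>p. f (fst p) * g (snd p))"
  proof (rule Fubini_integrable)
    show "integrable M1 (\<lambda>x. \<integral>y. norm (f (fst (x, y)) * g (snd (x, y))) \<partial>M2)"
      using f g by (simp add: norm_mult)
    show "AE x in M1. integrable M2 (\<lambda>y. f (fst (x, y)) * g (snd (x, y)))"
      using g by simp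
  qed measurable
  then have "integrable (M1 \<Otimes>\<^sub>M M2) (\<lambda>p. complex_of_real C * (f (fst p) * g (snd p)))"
    by (rule integrable_mult_right)
  then show ?thesis
  proof (rule Bochner_Integration.integrable_bound)
    show "(\<lambda>(x, y). f x * g y * k x y) \<in> borel_measurable (M1 \<Otimes>\<^sub>M M2)"
      unfolding split_beta using k(1) unfolding split_beta by measurable
    have "norm (f x * g y * k x y) \<le> norm (complex_of_real C * (f x * g y))" for x y
    proof -
      have "norm (k x y) \<le> \<bar>C\<bar>" using k(2)[of x y] by linarith
      then have "norm (f x * g y) * norm (k x y) \<le> norm (f x * g y) * \<bar>C\<bar>" by (rule mult_left_mono) simp
      then show ?thesis by (simp add: norm_mult mult_ac)
    qed
    then show "AE p in M1 \<Otimes>\<^sub>M M2. norm (case p of (x, y) \<Rightarrow> f x * g y * k x y) \<le> norm (complex_of_real C * (f (fst p) * g (snd p)))"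
      by (simp add: split_beta)
  qed
qed

text \<open>The polynomial factor makes the family closed under differentiation, as with Hermite
  functions; \<open>\<xi>\<close> is the centre.\<close>

definition gauss :: "real poly \<Rightarrow> real \<Rightarrow> real \<Rightarrow> complex" where
  "gauss p \<xi> t = complex_of_real (poly p (t - \<xi>) * exp (- (t - \<xi>)\<^sup>2 / 2))"

lemma gauss_has_derivative:
  "(gauss p \<xi> has_vector_derivative gauss (pderiv p - [:0, 1:] * p) \<xi> t) (at t)"
proof -
  have "((\<lambda>t. poly p (t - \<xi>) * exp (- (t - \<xi>)\<^sup>2 / 2)) has_real_derivative
      poly (pderiv p - [:0, 1:] * p) (t - \<xi>) * exp (- (t - \<xi>)\<^sup>2 / 2)) (at t)"
    by (auto intro!: derivative_eq_intros DERIV_chain2[of "poly p"] poly_DERIV simp: field_simps)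
  then show ?thesis
    unfolding gauss_def has_real_derivative_iff_has_vector_derivative
    by (rule bounded_linear.has_vector_derivative[OF bounded_linear_of_real])
qed

text \<open>\<open>|s|^k / k!\<close> is one term of the exponential series of \<open>|s|\<close>,
  and \<open>|s| - s^2 / 2\<close> is at most \<open>1 / 2\<close>.\<close>

lemma power_times_exp_minus_square_le:
  fixes s :: real
  shows "\<bar>s\<bar> ^ k * exp (- s\<^sup>2 / 2) \<le> fact k * exp (1 / 2)"
proof -
  have "\<bar>s\<bar> ^ k / fact k \<le> exp \<bar>s\<bar>"
  proof -
    have "(\<Sum>n\<in>{k}. inverse (fact n) * \<bar>s\<bar> ^ n) \<le> (\<Sum>n. inverse (fact n) * \<bar>s\<bar> ^ n)"
      by (rule sum_le_suminf) (auto intro!: summable_exp)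
    then show ?thesis by (simp add: exp_def divide_inverse mult.commute scaleR_conv_of_real)
  qed
  then have "\<bar>s\<bar> ^ k * exp (- s\<^sup>2 / 2) \<le> fact k * exp \<bar>s\<bar> * exp (- s\<^sup>2 / 2)"
    by (simp add: field_simps)
  also have "\<dots> = fact k * (exp \<bar>s\<bar> * exp (- s\<^sup>2 / 2))" by simp
  also have "\<dots> \<le> fact k * exp (1 / 2)"
  proof (rule mult_left_mono)
    have "0 \<le> (\<bar>s\<bar> - 1)\<^sup>2" by simp
    then have "\<bar>s\<bar> - s\<^sup>2 / 2 \<le> 1 / 2" by (simp add: power2_eq_square algebra_simps)
    then show "exp \<bar>s\<bar> * exp (- s\<^sup>2 / 2) \<le> exp (1 / 2)" by (simp add: exp_add[symmetric])
  qed simp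
  finally show ?thesis .
qed

lemma abs_le_one_plus_square: "\<bar>s\<bar> \<le> 1 + (s::real)\<^sup>2"
proof -
  have "0 \<le> (\<bar>s\<bar> - 1)\<^sup>2" by simp
  then have "2 * \<bar>s\<bar> \<le> 1 + s\<^sup>2" by (simp add: power2_eq_square algebra_simps)
  then show ?thesis using abs_ge_zero[of s] by linarith
qed

lemma poly_times_gaussian_bounded:
  fixes q :: "real poly"
  shows "\<exists>B. \<forall>s. \<bar>poly q s\<bar> * exp (- s\<^sup>2 / 2) \<le> B"
proof (intro exI allI)
  fix s :: real
  have "\<bar>poly q s\<bar> \<le> (\<Sum>i\<le>degree q. \<bar>coeff q i * s ^ i\<bar>)"
    unfolding poly_altdef by (rule sum_abs)
  then have "\<bar>poly q s\<bar> * exp (- s\<^sup>2 / 2) \<le> (\<Sum>i\<le>degree q. \<bar>coeff q i * s ^ i\<bar>) * exp (- s\<^sup>2 / 2)"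
    by (rule mult_right_mono) simp
  also have "\<dots> = (\<Sum>i\<le>degree q. \<bar>coeff q i\<bar> * (\<bar>s\<bar> ^ i * exp (- s\<^sup>2 / 2)))"
    by (simp add: sum_distrib_right abs_mult power_abs mult.assoc)
  also have "\<dots> \<le> (\<Sum>i\<le>degree q. \<bar>coeff q i\<bar> * (fact i * exp (1 / 2)))"
    by (intro sum_mono mult_left_mono power_times_exp_minus_square_le) simp
  finally show "\<bar>poly q s\<bar> * exp (- s\<^sup>2 / 2) \<le> (\<Sum>i\<le>degree q. \<bar>coeff q i\<bar> * (fact i * exp (1 / 2)))" .
qed

lemma gauss_decay: "\<exists>B. \<forall>t. (1 + \<bar>t\<bar>) ^ N * cmod (gauss p \<xi> t) \<le> B"
proof -
  \<comment> \<open>With \<open>s = t - \<xi>\<close> one has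
    \<open>1 + |t| \<le> (1 + |\<xi>|) * (2 + s^2)\<close>, and \<open>[:2, 0, 1:]\<close> is the
    last factor; the weight is thus absorbed into the polynomial.\<close>
  let ?q = "smult ((1 + \<bar>\<xi>\<bar>) ^ N) ([:2, 0, 1:] ^ N * p)"
  obtain B where B: "\<And>s. \<bar>poly ?q s\<bar> * exp (- s\<^sup>2 / 2) \<le> B" using poly_times_gaussian_bounded by blast
  have "(1 + \<bar>t\<bar>) ^ N * cmod (gauss p \<xi> t) \<le> B" for t
  proof -
    let ?s = "t - \<xi>"
    have "\<bar>t\<bar> \<le> \<bar>\<xi>\<bar> + \<bar>?s\<bar>" by linarith
    then have "1 + \<bar>t\<bar> \<le> (1 + \<bar>\<xi>\<bar>) + (1 + ?s\<^sup>2)" using abs_le_one_plus_square[of ?s] by simp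
    also have "\<dots> \<le> (1 + \<bar>\<xi>\<bar>) * (2 + ?s\<^sup>2)"
    proof -
      have "0 \<le> \<bar>\<xi>\<bar> * (1 + ?s\<^sup>2)" by simp
      then show ?thesis by (simp add: algebra_simps)
    qed
    finally have "(1 + \<bar>t\<bar>) ^ N \<le> ((1 + \<bar>\<xi>\<bar>) * (2 + ?s\<^sup>2)) ^ N" by (intro power_mono) auto
    then have "(1 + \<bar>t\<bar>) ^ N * cmod (gauss p \<xi> t) \<le> ((1 + \<bar>\<xi>\<bar>) * (2 + ?s\<^sup>2)) ^ N * cmod (gauss p \<xi> t)"
      by (intro mult_right_mono) auto
    also have "\<dots> = \<bar>poly ?q ?s\<bar> * exp (- ?s\<^sup>2 / 2)"
      by (simp add: gauss_def norm_mult abs_mult power_mult_distrib poly_power power_abs power2_eq_square mult_ac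
          del: of_real_mult)
    also have "\<dots> \<le> B" by (rule B)
    finally show ?thesis .
  qed
  then show ?thesis by blast
qed

text \<open>Replaces the Euclidean weight by a product weight, so that decay in each coordinate
  gives decay on \<open>Rd d\<close>.\<close>

lemma one_plus_norm_Rd_le: "1 + norm_Rd d x \<le> (\<Prod>i<d. 1 + \<bar>x i\<bar>)"
proof -
  have "norm_Rd d x = L2_set x {..<d}"
    by (simp add: norm_Rd_def dot_def L2_set_def power2_eq_square)
  also have "\<dots> \<le> (\<Sum>i<d. \<bar>x i\<bar>)" by (rule L2_set_le_sum_abs)
  also have "1 + (\<Sum>i<d. \<bar>x i\<bar>) \<le> (\<Prod>i<d. 1 + \<bar>x i\<bar>)"
  proof (induction d)
    case (Suc d)
    have "1 + (\<Sum>i<Suc d. \<bar>x i\<bar>) \<le> (1 + (\<Sum>i<d. \<bar>x i\<bar>)) * (1 + \<bar>x d\<bar>)"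
      by (simp add: algebra_simps sum_nonneg)
    also have "\<dots> \<le> (\<Prod>i<d. 1 + \<bar>x i\<bar>) * (1 + \<bar>x d\<bar>)" by (intro mult_right_mono Suc) auto
    finally show ?case by simp
  qed simp
  finally show ?thesis by simp
qed

text \<open>Translated Gaussians are the only Schwartz functions to which the duality defining the
  Fourier transform is applied. Derivatives of each factor stay in the family
  \<open>gauss p\<close>, where \<open>gauss_decay\<close> bounds them.\<close>

lemma schwartz_gaussian: "schwartz d (\<lambda>x. \<Prod>i<d. gauss 1 (\<xi> i) (x i))"
proof -
  have "\<exists>u. u 0 = gauss 1 (\<xi> i) \<and> (\<forall>k. u k \<in> range (\<lambda>p. gauss p (\<xi> i))) \<and>
      (\<forall>k t. (u k has_vector_derivative u (Suc k) t) (at t))" for i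
    by (rule derivative_sequence_exists) (use gauss_has_derivative in blast)+
  then obtain u where u0: "\<And>i. u i 0 = gauss 1 (\<xi> i)" and ur: "\<And>i k. u i k \<in> range (\<lambda>p. gauss p (\<xi> i))"
    and ud: "\<And>i k t. (u i k has_vector_derivative u i (Suc k) t) (at t)" by metis
  have dec: "\<exists>B. \<forall>t. (1 + \<bar>t\<bar>) ^ N * cmod (u i k t) \<le> B" for N i k
    using ur[of i k] gauss_decay[of N _ "\<xi> i"] by (elim rangeE) (simp only:)
  show ?thesis unfolding schwartz_def
  proof (intro conjI ballI allI)
    show "smooth_Rd d (\<lambda>x. \<Prod>i<d. gauss 1 (\<xi> i) (x i))"
      using smooth_Rd_prod[where u=u, OF ud] by (simp add: u0)
    fix "is" and N :: nat assume "is": "is \<in> lists {..<d}"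
    have eq: "foldr partial is (\<lambda>x. \<Prod>i<d. gauss 1 (\<xi> i) (x i)) = (\<lambda>x. \<Prod>i<d. u i (count_list is i) (x i))"
      using foldr_partial_prod[where u=u, OF ud "is"] by (simp add: u0)
    have "\<forall>i. \<exists>B. \<forall>t. (1 + \<bar>t\<bar>) ^ N * cmod (u i (count_list is i) t) \<le> B"
      by (intro allI dec)
    from choice[OF this] obtain B where B: "\<And>i t. (1 + \<bar>t\<bar>) ^ N * cmod (u i (count_list is i) t) \<le> B i"
      by blast
    show "\<exists>B. \<forall>x\<in>Rd d. (1 + norm_Rd d x) ^ N * cmod (foldr partial is (\<lambda>x. \<Prod>i<d. gauss 1 (\<xi> i) (x i)) x) \<le> B"
    proof (intro exI ballI)
      fix x
      have "(1 + norm_Rd d x) ^ N * cmod (\<Prod>i<d. u i (count_list is i) (x i)) \<le>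
          (\<Prod>i<d. 1 + \<bar>x i\<bar>) ^ N * cmod (\<Prod>i<d. u i (count_list is i) (x i))"
        by (intro mult_right_mono power_mono one_plus_norm_Rd_le) auto
      also have "\<dots> = (\<Prod>i<d. (1 + \<bar>x i\<bar>) ^ N * cmod (u i (count_list is i) (x i)))"
        by (simp add: prod_norm prod.distrib prod_power_distrib)
      also have "\<dots> \<le> (\<Prod>i<d. B i)" by (intro prod_mono conjI B) auto
      finally show "(1 + norm_Rd d x) ^ N * cmod (foldr partial is (\<lambda>x. \<Prod>i<d. gauss 1 (\<xi> i) (x i)) x) \<le> (\<Prod>i<d. B i)"
        unfolding eq .
    qed
  qed
qed

section \<open>Fourier transforms of Gaussians and of smoothed intervals\<close>

lemma gauss_1_eq: "gauss 1 \<xi> t = complex_of_real (sqrt (2 * pi) * std_normal_density (t - \<xi>))"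
  by (simp add: gauss_def std_normal_density_def)

lemma gauss_1_integrable: "integrable lborel (gauss 1 \<xi>)"
proof -
  have "integrable lborel (\<lambda>t. std_normal_density (- \<xi> + 1 * t))"
    by (rule lborel_integrable_real_affine) auto
  then have "integrable lborel (\<lambda>t. complex_of_real (sqrt (2 * pi) * std_normal_density (- \<xi> + 1 * t)))"
    by (intro integrable_of_real integrable_mult_right)
  then show ?thesis by (simp add: gauss_1_eq[abs_def])
qed

text \<open>The characteristic function of the standard normal law, rescaled by its normalising
  factor; moving the centre to \<open>\<xi>\<close> contributes the phase.\<close>

lemma integral_gauss_cis:
  "(\<integral>s. gauss 1 \<xi> s * cis (t * s) \<partial>lborel) = complex_of_real (sqrt (2 * pi) * exp (- t\<^sup>2 / 2)) * cis (t * \<xi>)"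
proof -
  have "complex_of_real (exp (- t\<^sup>2 / 2)) = (\<integral>s. std_normal_density s *\<^sub>R cis (t * s) \<partial>lborel)"
    using char_std_normal_distribution[THEN fun_cong, of t] unfolding char_def
    by (subst (asm) integral_density) (auto simp: cis_conv_exp mult_ac)
  then have "complex_of_real (sqrt (2 * pi) * exp (- t\<^sup>2 / 2)) = (\<integral>s. gauss 1 0 s * cis (t * s) \<partial>lborel)"
    by (simp add: gauss_1_eq scaleR_conv_of_real mult.assoc)
  then have "complex_of_real (sqrt (2 * pi) * exp (- t\<^sup>2 / 2)) * cis (t * \<xi>) = (\<integral>s. (gauss 1 0 s * cis (t * s)) * cis (t * \<xi>) \<partial>lborel)"
    by simp
  also have "\<dots> = (\<integral>s. (gauss 1 0 (- \<xi> + s) * cis (t * (- \<xi> + s))) * cis (t * \<xi>) \<partial>lborel)"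
    by (subst lborel_integral_real_affine[of 1 _ "- \<xi>"]) simp_all
  also have "\<dots> = (\<integral>s. gauss 1 \<xi> s * cis (t * s) \<partial>lborel)"
    by (intro Bochner_Integration.integral_cong refl) (simp add: gauss_def mult.assoc cis_mult algebra_simps)
  finally show ?thesis by simp
qed

lemma cis_dot: "cis (dot d x y) = (\<Prod>i<d. cis (x i * y i))"
  unfolding dot_def by (induction d) (simp_all add: cis_mult[symmetric])

lemma AE_lborel_Rd_component_neq:
  assumes "i < d"
  shows "AE x in lborel_Rd d. x i \<noteq> c"
proof (rule AE_I')
  let ?A = "Pi\<^sub>E {..<d} (\<lambda>j. if j = i then {c} else UNIV)"
  have "?A \<in> sets (lborel_Rd d)" by (rule sets_PiM_I_finite) auto
  moreover have "emeasure (lborel_Rd d) ?A = (\<Prod>j<d. emeasure lborel (if j = i then {c} else UNIV :: real set))"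
    by (rule lborel_Rd.emeasure_PiM) auto
  moreover have "\<dots> = 0" using assms by (auto intro!: bexI[of _ i])
  ultimately show "?A \<in> null_sets (lborel_Rd d)" by auto
  show "{x \<in> space (lborel_Rd d). \<not> x i \<noteq> c} \<subseteq> ?A"
    by (auto simp: space_lborel_Rd Rd_def PiE_iff extensional_def)
qed

text \<open>
  Convolving the indicator of an interval with a Gaussian of width \<open>1 / (n + 1)\<close> makes it the Fourier
  transform of an integrable function, so that it can be tested by Fubini.
\<close>

definition smoothed_interval :: "nat \<Rightarrow> real \<Rightarrow> real \<Rightarrow> real \<Rightarrow> real" where
  "smoothed_interval n a b s =
     (\<integral>z. indicator {a<..<b} (s + z / real (Suc n)) * std_normal_density z \<partial>lborel)"

definition smoothed_interval_fourier :: "nat \<Rightarrow> real \<Rightarrow> real \<Rightarrow> real \<Rightarrow> complex" where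
  "smoothed_interval_fourier n a b \<xi> =
     (\<integral>y. gauss 1 0 (\<xi> / real (Suc n)) / (2 * pi) * complex_of_real (indicator {a<..<b} y) * cis (\<xi> * y) \<partial>lborel)"

text \<open>Direct computation instead of an inversion theorem. Exchanging the integrals over
  \<open>\<xi>\<close> and \<open>y\<close> leaves a Gaussian integral in \<open>\<xi>\<close>,
  which equals \<open>N * std_normal_density (N * (y - s))\<close> with \<open>N = n + 1\<close>:
  the mollifier in the definition of \<open>smoothed_interval\<close>.\<close>

lemma
  shows smoothed_interval_fourier_integrable: "integrable lborel (smoothed_interval_fourier n a b)"
    and integral_smoothed_interval_fourier:
      "(\<integral>\<xi>. smoothed_interval_fourier n a b \<xi> * cis (- (\<xi> * s)) \<partial>lborel) = complex_of_real (smoothed_interval n a b s)"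
proof -
  define N where "N = real (Suc n)"
  have N: "N > 0" by (simp add: N_def)
  let ?f = "\<lambda>\<xi>. gauss 1 0 (\<xi> / N) / (2 * pi)" and ?g = "\<lambda>y. complex_of_real (indicator {a<..<b} y)"
  have f: "integrable lborel ?f"
    using lborel_integrable_real_affine[OF gauss_1_integrable[of 0], of "1 / N" 0] N by simp
  have g: "integrable lborel ?g"
    by (intro integrable_of_real integrable_real_indicator) (auto simp: emeasure_lborel_box_eq simp flip: box_real(1))
  have i: "integrable (lborel \<Otimes>\<^sub>M lborel) (\<lambda>(\<xi>, y). ?f \<xi> * ?g y * cis (\<xi> * (y - t)))" for t
    by (rule lborel_pair.integrable_times_bounded_kernel[where C=1, OF f g]) (auto simp: split_beta)
  show "integrable lborel (smoothed_interval_fourier n a b)"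
    using lborel_pair.integrable_fst[OF i[of 0]] by (simp add: smoothed_interval_fourier_def[abs_def] N_def)
  have inner: "(\<integral>\<xi>. ?f \<xi> * ?g y * cis (\<xi> * (y - s)) \<partial>lborel) =
      complex_of_real (indicator {a<..<b} y * (N * std_normal_density (N * (y - s))))" for y
  proof -
    have "(\<integral>\<xi>. gauss 1 0 (\<xi> / N) * cis (\<xi> * (y - s)) \<partial>lborel) =
        N *\<^sub>R (\<integral>z. gauss 1 0 z * cis (N * (y - s) * z) \<partial>lborel)"
      using N by (subst lborel_integral_real_affine[of N _ 0]) (auto simp: mult_ac)
    also have "\<dots> = complex_of_real (2 * pi * (N * std_normal_density (N * (y - s))))"
      unfolding integral_gauss_cis
      by (simp add: std_normal_density_def scaleR_conv_of_real real_sqrt_mult[symmetric] field_simps flip: of_real_mult of_real_divide)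
    finally show ?thesis by (cases "y \<in> {a<..<b}") simp_all
  qed
  have "(\<integral>\<xi>. smoothed_interval_fourier n a b \<xi> * cis (- (\<xi> * s)) \<partial>lborel) =
      (\<integral>\<xi>. (\<integral>y. ?f \<xi> * ?g y * cis (\<xi> * (y - s)) \<partial>lborel) \<partial>lborel)"
    unfolding smoothed_interval_fourier_def N_def[symmetric] integral_mult_left_zero[symmetric]
    by (intro Bochner_Integration.integral_cong refl) (simp add: mult.assoc cis_mult algebra_simps)
  also have "\<dots> = (\<integral>y. (\<integral>\<xi>. ?f \<xi> * ?g y * cis (\<xi> * (y - s)) \<partial>lborel) \<partial>lborel)"
    by (rule lborel_pair.Fubini_integral[symmetric, OF i])
  also have "\<dots> = complex_of_real (\<integral>y. indicator {a<..<b} y * (N * std_normal_density (N * (y - s))) \<partial>lborel)"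
    unfolding inner by (rule integral_complex_of_real)
  also have "(\<integral>y. indicator {a<..<b} y * (N * std_normal_density (N * (y - s))) \<partial>lborel) = smoothed_interval n a b s"
    unfolding smoothed_interval_def N_def[symmetric]
    using N by (subst lborel_integral_real_affine[of "1 / N" _ s]) (simp_all flip: integral_mult_right_zero)
  finally show "(\<integral>\<xi>. smoothed_interval_fourier n a b \<xi> * cis (- (\<xi> * s)) \<partial>lborel) = complex_of_real (smoothed_interval n a b s)" .
qed

lemma smoothed_interval_fourier_measurable [measurable]:
  "smoothed_interval_fourier n a b \<in> borel_measurable borel"
  using borel_measurable_integrable[OF smoothed_interval_fourier_integrable] by simp

lemma smoothed_interval_measurable [measurable]: "smoothed_interval n a b \<in> borel_measurable borel"
  unfolding smoothed_interval_def[abs_def] by measurable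

lemma smoothed_interval_bounds: "0 \<le> smoothed_interval n a b s" "smoothed_interval n a b s \<le> 1"
proof -
  show "0 \<le> smoothed_interval n a b s"
    unfolding smoothed_interval_def by (rule integral_nonneg_AE) simp
  have "smoothed_interval n a b s \<le> (\<integral>z. std_normal_density z \<partial>lborel)"
    unfolding smoothed_interval_def
  proof (rule integral_mono)
    show "integrable lborel (\<lambda>z. indicator {a<..<b} (s + z / real (Suc n)) * std_normal_density z)"
      by (rule Bochner_Integration.integrable_bound[OF integrable_normal_density[of 1 0]])
        (auto split: split_indicator)
  qed (auto split: split_indicator)
  then show "smoothed_interval n a b s \<le> 1" by simp
qed

text \<open>At an end point of a non-degenerate interval the limit would be \<open>1 / 2\<close>,
  hence the two exclusions. In \<open>Rd d\<close> they only remove hyperplanes, which are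
  null.\<close>

lemma smoothed_interval_tendsto:
  assumes "s \<noteq> a" "s \<noteq> b"
  shows "(\<lambda>n. smoothed_interval n a b s) \<longlonglongrightarrow> indicator {a<..<b} s"
proof -
  have lim: "(\<lambda>n. indicator {a<..<b} (s + z / real (Suc n))) \<longlonglongrightarrow> (indicator {a<..<b} s :: real)" for z
  proof -
    have "(\<lambda>n. z * inverse (real (Suc n))) \<longlonglongrightarrow> z * 0"
      by (intro tendsto_intros LIMSEQ_inverse_real_of_nat)
    then have t: "(\<lambda>n. s + z / real (Suc n)) \<longlonglongrightarrow> s + 0"
      by (intro tendsto_intros) (simp add: divide_inverse)
    have "eventually (\<lambda>n. indicator {a<..<b} (s + z / real (Suc n)) = (indicator {a<..<b} s :: real)) sequentially"
    proof (cases "s \<in> {a<..<b}")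
      case True
      then have "eventually (\<lambda>n. s + z / real (Suc n) \<in> {a<..<b}) sequentially"
        using t by (intro topological_tendstoD) auto
      then show ?thesis by eventually_elim (use True in auto)
    next
      case False
      then have "s \<in> - {a..b}" using assms by auto
      then have "eventually (\<lambda>n. s + z / real (Suc n) \<in> - {a..b}) sequentially"
        using t by (intro topological_tendstoD) auto
      then show ?thesis by eventually_elim (use False in auto)
    qed
    then show ?thesis by (rule tendsto_eventually)
  qed
  have "(\<lambda>n. smoothed_interval n a b s) \<longlonglongrightarrow> (\<integral>z. indicator {a<..<b} s * std_normal_density z \<partial>lborel)"
    unfolding smoothed_interval_def
  proof (rule integral_dominated_convergence[where w=std_normal_density])
    show "AE z in lborel. (\<lambda>n. indicator {a<..<b} (s + z / real (Suc n)) * std_normal_density z) \<longlonglongrightarrow> indicator {a<..<b} s * std_normal_density z"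
      by (intro AE_I2 tendsto_intros lim)
  qed (auto split: split_indicator)
  then show ?thesis by simp
qed

text \<open>Injectivity of the Fourier transform on integrable functions. Each \<open>q n\<close> is
  the transform of the integrable \<open>\<kappa> n\<close>, so Fubini moves the transform onto
  \<open>u\<close> and gives 0; dominated convergence passes from \<open>q n\<close> to the
  indicator of the box. The real part is taken because box integrals are compared for real
  functions, and it suffices for a real \<open>f\<close>.\<close>

lemma AE_Re_zero_if_fourier_zero:
  fixes u :: "_ \<Rightarrow> complex"
  assumes u: "integrable (lborel_Rd d) u"
    and zero: "\<And>\<xi>. (\<integral>x. u x * cis (- dot d \<xi> x) \<partial>lborel_Rd d) = 0"
  shows "AE x in lborel_Rd d. Re (u x) = 0"
proof (rule AE_zero_if_obox_integrals_zero)
  show "integrable (lborel_Rd d) (\<lambda>x. Re (u x))" using u by simp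
  fix a b
  have [measurable]: "u \<in> borel_measurable (lborel_Rd d)" using u by auto
  define q where "q n x = (\<Prod>i<d. smoothed_interval n (a i) (b i) (x i))" for n x
  define \<kappa> where "\<kappa> n \<xi> = (\<Prod>i<d. smoothed_interval_fourier n (a i) (b i) (\<xi> i))" for n \<xi>
  have \<kappa>: "integrable (lborel_Rd d) (\<kappa> n)" for n
    unfolding \<kappa>_def[abs_def]
    by (rule lborel_Rd.product_integrable_prod) (auto intro: smoothed_interval_fourier_integrable)
  have q\<kappa>: "complex_of_real (q n x) = (\<integral>\<xi>. \<kappa> n \<xi> * cis (- dot d \<xi> x) \<partial>lborel_Rd d)" for n x
  proof -
    have "complex_of_real (q n x) = (\<Prod>i<d. \<integral>t. smoothed_interval_fourier n (a i) (b i) t * cis (- (t * x i)) \<partial>lborel)"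
      by (simp add: q_def integral_smoothed_interval_fourier)
    also have "\<dots> = (\<integral>\<xi>. (\<Prod>i<d. smoothed_interval_fourier n (a i) (b i) (\<xi> i) * cis (- (\<xi> i * x i))) \<partial>lborel_Rd d)"
    proof (rule lborel_Rd.product_integral_prod[symmetric])
      fix i
      show "integrable lborel (\<lambda>t. smoothed_interval_fourier n (a i) (b i) t * cis (- (t * x i)))"
        by (rule Bochner_Integration.integrable_bound[OF smoothed_interval_fourier_integrable[of n "a i" "b i"]])
          (simp_all add: norm_mult)
    qed simp
    also have "\<dots> = (\<integral>\<xi>. \<kappa> n \<xi> * cis (- dot d \<xi> x) \<partial>lborel_Rd d)"
    proof (intro Bochner_Integration.integral_cong refl)
      fix \<xi>
      have "cis (- dot d \<xi> x) = (\<Prod>i<d. cis (- (\<xi> i * x i)))"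
        using cis_dot[of d "\<lambda>i. - \<xi> i" x] by (simp add: dot_def sum_negf)
      then show "(\<Prod>i<d. smoothed_interval_fourier n (a i) (b i) (\<xi> i) * cis (- (\<xi> i * x i))) = \<kappa> n \<xi> * cis (- dot d \<xi> x)"
        by (simp add: \<kappa>_def prod.distrib)
    qed
    finally show ?thesis .
  qed
  have "(\<integral>x. u x * complex_of_real (q n x) \<partial>lborel_Rd d) = 0" for n
  proof -
    have i: "integrable (lborel_Rd d \<Otimes>\<^sub>M lborel_Rd d) (\<lambda>(x, \<xi>). u x * \<kappa> n \<xi> * cis (- dot d \<xi> x))"
      by (rule lborel_Rd_pair.integrable_times_bounded_kernel[where C=1, OF u \<kappa>]) (auto simp: split_beta)
    have "(\<integral>x. u x * complex_of_real (q n x) \<partial>lborel_Rd d) =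
        (\<integral>x. (\<integral>\<xi>. u x * \<kappa> n \<xi> * cis (- dot d \<xi> x) \<partial>lborel_Rd d) \<partial>lborel_Rd d)"
      unfolding q\<kappa> integral_mult_right_zero[symmetric] by (simp add: mult.assoc)
    also have "\<dots> = (\<integral>\<xi>. (\<integral>x. u x * \<kappa> n \<xi> * cis (- dot d \<xi> x) \<partial>lborel_Rd d) \<partial>lborel_Rd d)"
      by (rule lborel_Rd_pair.Fubini_integral[symmetric, OF i])
    also have "\<dots> = (\<integral>\<xi>. \<kappa> n \<xi> * (\<integral>x. u x * cis (- dot d \<xi> x) \<partial>lborel_Rd d) \<partial>lborel_Rd d)"
      unfolding integral_mult_right_zero[symmetric] by (simp add: mult_ac)
    finally show ?thesis by (simp add: zero)
  qed
  moreover have "(\<lambda>n. \<integral>x. u x * complex_of_real (q n x) \<partial>lborel_Rd d) \<longlonglongrightarrow>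
      (\<integral>x. u x * complex_of_real (indicator (obox d a b) x) \<partial>lborel_Rd d)"
  proof (rule integral_dominated_convergence[where w="\<lambda>x. norm (u x)"])
    have "AE x in lborel_Rd d. \<forall>i\<in>{..<d}. x i \<noteq> a i \<and> x i \<noteq> b i"
      by (intro AE_finite_allI) (auto intro: AE_conjI AE_lborel_Rd_component_neq)
    then show "AE x in lborel_Rd d. (\<lambda>n. u x * complex_of_real (q n x)) \<longlonglongrightarrow> u x * complex_of_real (indicator (obox d a b) x)"
      using AE_space
    proof eventually_elim
      case (elim x)
      have "(\<lambda>n. q n x) \<longlonglongrightarrow> (\<Prod>i<d. indicator {a i<..<b i} (x i))"
        unfolding q_def by (intro tendsto_prod smoothed_interval_tendsto) (use elim in auto)
      moreover have "(\<Prod>i<d. indicator {a i<..<b i} (x i)) = (indicator (obox d a b) x :: real)"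
        using elim(2) by (auto simp: indicator_def obox_def space_lborel_Rd Rd_def PiE_iff)
      ultimately show ?case by (intro tendsto_intros) simp
    qed
    show "(\<lambda>x. u x * complex_of_real (q n x)) \<in> borel_measurable (lborel_Rd d)" for n
      unfolding q_def by measurable
    show "AE x in lborel_Rd d. norm (u x * complex_of_real (q n x)) \<le> norm (u x)" for n
    proof (rule AE_I2)
      fix x
      have "0 \<le> q n x" "q n x \<le> 1"
        unfolding q_def using smoothed_interval_bounds by (auto intro!: prod_nonneg prod_le_1)
      then show "norm (u x * complex_of_real (q n x)) \<le> norm (u x)"
        by (simp add: norm_mult mult_left_le)
    qed
  qed (use u in simp_all)
  ultimately have "(\<integral>x. u x * complex_of_real (indicator (obox d a b) x) \<partial>lborel_Rd d) = 0"
    by (simp add: LIMSEQ_const_iff)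
  moreover have "integrable (lborel_Rd d) (\<lambda>x. u x * complex_of_real (indicator (obox d a b) x))"
    by (rule Bochner_Integration.integrable_bound[OF u]) (auto split: split_indicator)
  ultimately have "(\<integral>x. Re (u x * complex_of_real (indicator (obox d a b) x)) \<partial>lborel_Rd d) = 0"
    by (subst integral_Re) simp_all
  then show "(\<integral>x. indicator (obox d a b) x * Re (u x) \<partial>lborel_Rd d) = 0"
    by (simp add: mult.commute)
qed


definition gaussian_Rd :: "nat \<Rightarrow> (nat \<Rightarrow> real) \<Rightarrow> real" where
  "gaussian_Rd d x = (\<Prod>i<d. exp (- (x i)\<^sup>2 / 2))"

lemma of_real_gaussian_Rd: "complex_of_real (gaussian_Rd d x) = (\<Prod>i<d. gauss 1 0 (x i))"
  by (simp add: gaussian_Rd_def gauss_def)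

lemma gaussian_Rd_pos: "0 < gaussian_Rd d x"
  unfolding gaussian_Rd_def by (intro prod_pos) simp

lemma gaussian_Rd_measurable [measurable]: "gaussian_Rd d \<in> borel_measurable (lborel_Rd d)"
  unfolding gaussian_Rd_def[abs_def] by measurable

lemma gauss_measurable [measurable]: "gauss p \<xi> \<in> borel_measurable borel"
  unfolding gauss_def[abs_def] by (intro borel_measurable_continuous_onI) (auto intro!: continuous_intros)

lemma gauss_cis_integrable: "integrable lborel (\<lambda>s. gauss 1 \<xi> s * cis (t * s))"
  by (rule Bochner_Integration.integrable_bound[OF gauss_1_integrable[of \<xi>]]) (simp_all add: norm_mult)

lemma integral_prod_gauss_cis:
  "(\<integral>x. (\<Prod>i<d. gauss 1 (\<xi> i) (x i)) * cis (dot d t x) \<partial>lborel_Rd d) =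
     complex_of_real (sqrt (2 * pi) ^ d * gaussian_Rd d t) * cis (dot d t \<xi>)"
proof -
  have "(\<integral>x. (\<Prod>i<d. gauss 1 (\<xi> i) (x i)) * cis (dot d t x) \<partial>lborel_Rd d) =
      (\<integral>x. (\<Prod>i<d. gauss 1 (\<xi> i) (x i) * cis (t i * x i)) \<partial>lborel_Rd d)"
    by (simp add: cis_dot prod.distrib)
  also have "\<dots> = (\<Prod>i<d. \<integral>s. gauss 1 (\<xi> i) s * cis (t i * s) \<partial>lborel)"
    by (rule lborel_Rd.product_integral_prod) (auto intro: gauss_cis_integrable)
  also have "\<dots> = complex_of_real (sqrt (2 * pi) ^ d * gaussian_Rd d t) * cis (dot d t \<xi>)"
    by (simp add: integral_gauss_cis prod.distrib gaussian_Rd_def cis_dot)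
  finally show ?thesis .
qed

lemma fourier_integral_gaussian:
  "fourier_integral d (\<lambda>x. \<Prod>i<d. gauss 1 (\<xi> i) (x i)) x =
     complex_of_real (1 / (2 * pi) ^ d * sqrt (2 * pi) ^ d * gaussian_Rd d x) * cis (- dot d \<xi> x)"
proof -
  have neg: "dot d (\<lambda>i. - x i) y = - dot d x y" for y by (simp add: dot_def sum_negf)
  have "(\<integral>y. (\<Prod>i<d. gauss 1 (\<xi> i) (y i)) * exp (- \<i> * complex_of_real (dot d x y)) \<partial>lebesgue_Rd d) =
      (\<integral>y. (\<Prod>i<d. gauss 1 (\<xi> i) (y i)) * cis (dot d (\<lambda>i. - x i) y) \<partial>lborel_Rd d)"
  proof (rule integral_lebesgue_Rd_AE)
    show "(\<lambda>y. (\<Prod>i<d. gauss 1 (\<xi> i) (y i)) * cis (dot d (\<lambda>i. - x i) y)) \<in> borel_measurable (lborel_Rd d)"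
      unfolding dot_def by measurable
    show "AE y in lborel_Rd d. (\<Prod>i<d. gauss 1 (\<xi> i) (y i)) * exp (- \<i> * complex_of_real (dot d x y)) =
        (\<Prod>i<d. gauss 1 (\<xi> i) (y i)) * cis (dot d (\<lambda>i. - x i) y)"
      by (simp add: neg cis_conv_exp)
  qed
  then have eq: "fourier_integral d (\<lambda>x. \<Prod>i<d. gauss 1 (\<xi> i) (x i)) x = complex_of_real (1 / (2 * pi) ^ d) *
      (complex_of_real (sqrt (2 * pi) ^ d * gaussian_Rd d (\<lambda>i. - x i)) * cis (dot d (\<lambda>i. - x i) \<xi>))"
    unfolding fourier_integral_def integral_prod_gauss_cis by (simp only:)
  have "gaussian_Rd d (\<lambda>i. - x i) = gaussian_Rd d x" by (simp add: gaussian_Rd_def)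
  moreover have "dot d (\<lambda>i. - x i) \<xi> = - dot d \<xi> x" by (simp add: dot_def mult.commute sum_negf)
  ultimately show ?thesis unfolding eq of_real_mult by (simp only: mult.assoc)
qed

lemma gaussian_Rd_integrable: "integrable (lborel_Rd d) (\<lambda>x. complex_of_real (gaussian_Rd d x))"
  unfolding of_real_gaussian_Rd by (rule lborel_Rd.product_integrable_prod) (auto intro: gauss_1_integrable)

lemma gaussian_Rd_decay: "\<exists>B. \<forall>x\<in>Rd d. (1 + norm_Rd d x) ^ N * gaussian_Rd d x \<le> B"
proof -
  obtain B where B: "\<forall>x\<in>Rd d. (1 + norm_Rd d x) ^ N * cmod (foldr partial [] (\<lambda>x. \<Prod>i<d. gauss 1 ((\<lambda>_. 0) i) (x i)) x) \<le> B"
    using schwartz_gaussian[of d "\<lambda>_. 0", unfolded schwartz_def, THEN conjunct2, THEN bspec[of _ _ "[]"], THEN spec[of _ N]]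
    by auto
  have "cmod (\<Prod>i<d. gauss 1 0 (x i)) = gaussian_Rd d x" for x
    unfolding of_real_gaussian_Rd[symmetric] using gaussian_Rd_pos[of d x] by simp
  with B show ?thesis by (intro exI[of _ B]) simp
qed

text \<open>Two Gaussian transforms contribute \<open>sqrt (2 * pi) ^ d\<close> each, one on the
  side of \<open>f\<close> and one on the side of \<open>g\<close>; together they cancel the factor
  of the Fourier convention.\<close>

lemma gaussian_constants: "1 / (2 * pi) ^ d * sqrt (2 * pi) ^ d * sqrt (2 * pi) ^ d = 1"
proof -
  have "sqrt (2 * pi) ^ d * sqrt (2 * pi) ^ d = (sqrt (2 * pi) * sqrt (2 * pi)) ^ d"
    by (rule power_mult_distrib[symmetric])
  also have "sqrt (2 * pi) * sqrt (2 * pi) = 2 * pi" by simp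
  finally show ?thesis by (simp only: mult.assoc) simp
qed

text \<open>Both \<open>f\<close> and the inverse transform \<open>ft\<close> of \<open>G\<close>
  are multiplied by the centred Gaussian \<open>E\<close>. The duality, tested with the Gaussian
  centred at \<open>\<xi>\<close>, computes the transform of \<open>f * E\<close> at
  \<open>\<xi>\<close>, and Fubini computes that of \<open>ft * E\<close>; they coincide for all
  \<open>\<xi>\<close>. Injectivity gives equality of the products, and \<open>E\<close> is
  positive.\<close>

lemma fourier_inversion:
  assumes FT: "has_fourier_transform d f g"
    and G: "integrable (lborel_Rd d) G" and gG: "AE \<omega> in lborel_Rd d. g \<omega> = G \<omega>"
  shows "AE x in lborel_Rd d. f x = Re (\<integral>\<omega>. G \<omega> * cis (dot d \<omega> x) \<partial>lborel_Rd d)"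
proof -
  let ?N = "lborel_Rd d"
  define c where "c = 1 / (2 * pi) ^ d * sqrt (2 * pi) ^ d"
  define E where "E x = complex_of_real (gaussian_Rd d x)" for x
  have [measurable]: "G \<in> borel_measurable ?N" using G by auto
  have [measurable]: "E \<in> borel_measurable ?N" unfolding E_def[abs_def] by measurable
  obtain k where k': "integrable (lebesgue_Rd d) (\<lambda>x. complex_of_real (f x) / complex_of_real ((1 + norm_Rd d x) ^ k))"
    using FT unfolding has_fourier_transform_def tempered_function_def by (elim conjE exE)
  define P where "P x = (1 + norm_Rd d x) ^ k" for x
  note k = k'[folded P_def]
  have pos: "0 < P x" for x
    using norm_Rd_nonneg[of d x] unfolding P_def by (intro zero_less_power) linarith
  have [measurable]: "P \<in> borel_measurable (lborel_Rd d)" unfolding P_def[abs_def] by measurable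
  \<comment> \<open>Temperedness speaks about \<open>f / P\<close> only; measurability of
    \<open>f\<close> itself is recovered by multiplying back.\<close>
  have fm: "f \<in> borel_measurable (lebesgue_Rd d)"
  proof -
    note [measurable] = borel_measurable_integrable[OF k] measurable_lebesgue_Rd[OF \<open>P \<in> borel_measurable (lborel_Rd d)\<close>]
    have "(\<lambda>x. Re (complex_of_real (f x) / complex_of_real (P x)) * P x) \<in> borel_measurable (lebesgue_Rd d)"
      by (intro borel_measurable_times measurable_compose[OF _ borel_measurable_Re] borel_measurable_integrable[OF k]) measurable
    moreover have "Re (complex_of_real (f x) / complex_of_real (P x)) * P x = f x" for x
      using pos[of x] by (simp flip: of_real_divide)
    ultimately show ?thesis by (simp only:)
  qed
  obtain F where F [measurable]: "F \<in> borel_measurable ?N" and fF: "AE x in ?N. f x = F x"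
    using lebesgue_Rd_borel_version[OF fm] by (elim bexE)
  have Fk: "integrable ?N (\<lambda>x. complex_of_real (F x) / complex_of_real (P x))"
    using k by (subst (asm) integrable_lebesgue_Rd_AE[where v="\<lambda>x. complex_of_real (F x) / complex_of_real (P x)"])
      (use fF in auto)
  \<comment> \<open>The Gaussian decays faster than \<open>1 / P\<close>, so the merely tempered
    function becomes integrable after damping.\<close>
  obtain B where B: "\<forall>x\<in>Rd d. P x * gaussian_Rd d x \<le> B" using gaussian_Rd_decay[of d k] unfolding P_def by blast
  have FE: "integrable ?N (\<lambda>x. complex_of_real (F x) * E x)"
  proof (rule Bochner_Integration.integrable_bound)
    show "integrable ?N (\<lambda>x. complex_of_real B * (complex_of_real (F x) / complex_of_real (P x)))"
      using Fk by (rule integrable_mult_right)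
    show "AE x in ?N. norm (complex_of_real (F x) * E x) \<le> norm (complex_of_real B * (complex_of_real (F x) / complex_of_real (P x)))"
    proof (rule AE_I2)
      fix x assume "x \<in> space ?N"
      then have "gaussian_Rd d x \<le> B / P x"
        using B pos[of x] by (simp add: space_lborel_Rd field_simps)
      moreover have "0 \<le> gaussian_Rd d x" using gaussian_Rd_pos[of d x] by simp
      ultimately have "\<bar>gaussian_Rd d x\<bar> \<le> \<bar>B / P x\<bar>" by linarith
      then have "\<bar>F x\<bar> * \<bar>gaussian_Rd d x\<bar> \<le> \<bar>F x\<bar> * \<bar>B / P x\<bar>" by (rule mult_left_mono) simp
      then show "norm (complex_of_real (F x) * E x) \<le> norm (complex_of_real B * (complex_of_real (F x) / complex_of_real (P x)))"
        using pos[of x] by (simp add: E_def norm_mult norm_divide norm_power abs_mult mult_ac)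
    qed
  qed measurable
  define ft where "ft x = (\<integral>\<omega>. G \<omega> * cis (dot d \<omega> x) \<partial>?N)" for x
  have kern: "integrable (?N \<Otimes>\<^sub>M ?N) (\<lambda>(x, \<omega>). E x * G \<omega> * cis (dot d \<omega> x - dot d \<xi> x))" for \<xi>
  proof (rule lborel_Rd_pair.integrable_times_bounded_kernel[where C=1, OF _ G])
    show "integrable ?N E" unfolding E_def[abs_def] by (rule gaussian_Rd_integrable)
    show "(\<lambda>(x, \<omega>). cis (dot d \<omega> x - dot d \<xi> x)) \<in> borel_measurable (?N \<Otimes>\<^sub>M ?N)"
      unfolding split_beta dot_def by measurable
  qed simp
  have ft_eq: "(\<integral>\<omega>. E x * G \<omega> * cis (dot d \<omega> x - dot d \<xi> x) \<partial>?N) = ft x * E x * cis (- dot d \<xi> x)" for x \<xi>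
  proof -
    have "(\<integral>\<omega>. E x * G \<omega> * cis (dot d \<omega> x - dot d \<xi> x) \<partial>?N) =
        (\<integral>\<omega>. (E x * cis (- dot d \<xi> x)) * (G \<omega> * cis (dot d \<omega> x)) \<partial>?N)"
      by (intro Bochner_Integration.integral_cong refl) (simp add: cis_mult mult_ac)
    also have "\<dots> = (E x * cis (- dot d \<xi> x)) * ft x"
      unfolding ft_def by (rule integral_mult_right_zero)
    finally show ?thesis by (simp only: mult_ac)
  qed
  have ftE: "integrable ?N (\<lambda>x. ft x * E x)"
    using lborel_Rd_pair.integrable_fst[OF kern[of "\<lambda>_. 0"]] unfolding ft_eq by (simp add: dot_def)
  have key: "(\<integral>x. ft x * E x * cis (- dot d \<xi> x) \<partial>?N) = (\<integral>x. complex_of_real (F x) * E x * cis (- dot d \<xi> x) \<partial>?N)" for \<xi>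
  proof -
    let ?\<phi> = "\<lambda>x. \<Prod>i<d. gauss 1 (\<xi> i) (x i)"
    \<comment> \<open>The transform of the centred Gaussian, evaluated at
      \<open>\<omega> - \<xi>\<close>, is up to a constant the Gaussian centred at
      \<open>\<xi>\<close>: the test function reappears.\<close>
    have inner: "(\<integral>x. E x * G \<omega> * cis (dot d \<omega> x - dot d \<xi> x) \<partial>?N) = complex_of_real (sqrt (2 * pi) ^ d) * (G \<omega> * ?\<phi> \<omega>)" for \<omega>
    proof -
      have "(\<integral>x. E x * G \<omega> * cis (dot d \<omega> x - dot d \<xi> x) \<partial>?N) =
          (\<integral>x. G \<omega> * ((\<Prod>i<d. gauss 1 ((\<lambda>_. 0) i) (x i)) * cis (dot d (\<lambda>i. \<omega> i - \<xi> i) x)) \<partial>?N)"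
      proof (intro Bochner_Integration.integral_cong refl)
        fix x
        have "dot d (\<lambda>i. \<omega> i - \<xi> i) x = dot d \<omega> x - dot d \<xi> x"
          by (simp add: dot_def left_diff_distrib sum_subtractf)
        then show "E x * G \<omega> * cis (dot d \<omega> x - dot d \<xi> x) =
            G \<omega> * ((\<Prod>i<d. gauss 1 ((\<lambda>_. 0) i) (x i)) * cis (dot d (\<lambda>i. \<omega> i - \<xi> i) x))"
          unfolding E_def of_real_gaussian_Rd by (simp only: mult_ac)
      qed
      also have "\<dots> = G \<omega> * (complex_of_real (sqrt (2 * pi) ^ d) * complex_of_real (gaussian_Rd d (\<lambda>i. \<omega> i - \<xi> i)))"
        unfolding integral_mult_right_zero integral_prod_gauss_cis by (simp add: dot_def)
      also have "complex_of_real (gaussian_Rd d (\<lambda>i. \<omega> i - \<xi> i)) = ?\<phi> \<omega>"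
        by (simp add: gaussian_Rd_def gauss_def)
      finally show ?thesis by (simp only: mult_ac)
    qed
    have "(\<integral>x. ft x * E x * cis (- dot d \<xi> x) \<partial>?N) = (\<integral>\<omega>. (\<integral>x. E x * G \<omega> * cis (dot d \<omega> x - dot d \<xi> x) \<partial>?N) \<partial>?N)"
      unfolding ft_eq[symmetric] by (rule lborel_Rd_pair.Fubini_integral[symmetric, OF kern])
    also have "\<dots> = complex_of_real (sqrt (2 * pi) ^ d) * (\<integral>\<omega>. G \<omega> * ?\<phi> \<omega> \<partial>?N)"
      unfolding inner by simp
    also have "(\<integral>\<omega>. G \<omega> * ?\<phi> \<omega> \<partial>?N) = (\<integral>\<omega>. g \<omega> * ?\<phi> \<omega> \<partial>lebesgue_Rd d)"
      by (rule integral_lebesgue_Rd_AE[symmetric]) (use gG in auto)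
    also have "\<dots> = (\<integral>x. complex_of_real (f x) * fourier_integral d ?\<phi> x \<partial>lebesgue_Rd d)"
      using FT[unfolded has_fourier_transform_def, THEN conjunct2, THEN conjunct2, rule_format, OF schwartz_gaussian[of d \<xi>]] .
    also have "\<dots> = (\<integral>x. complex_of_real (F x) * (complex_of_real (c * gaussian_Rd d x) * cis (- dot d \<xi> x)) \<partial>?N)"
    proof (rule integral_lebesgue_Rd_AE)
      show "(\<lambda>x. complex_of_real (F x) * (complex_of_real (c * gaussian_Rd d x) * cis (- dot d \<xi> x))) \<in> borel_measurable ?N"
        unfolding dot_def by measurable
    qed (use fF in \<open>auto simp: fourier_integral_gaussian c_def\<close>)
    also have "\<dots> = (\<integral>x. complex_of_real c * (complex_of_real (F x) * E x * cis (- dot d \<xi> x)) \<partial>?N)"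
      by (simp add: E_def mult_ac)
    also have "complex_of_real (sqrt (2 * pi) ^ d) * \<dots> =
        complex_of_real (c * sqrt (2 * pi) ^ d) * (\<integral>x. complex_of_real (F x) * E x * cis (- dot d \<xi> x) \<partial>?N)"
      by simp
    also have "c * sqrt (2 * pi) ^ d = 1" unfolding c_def by (rule gaussian_constants)
    finally show ?thesis by (simp only: of_real_1 mult_1)
  qed
  have "AE x in ?N. Re (complex_of_real (F x) * E x - ft x * E x) = 0"
  proof (rule AE_Re_zero_if_fourier_zero)
    show "integrable ?N (\<lambda>x. complex_of_real (F x) * E x - ft x * E x)" using FE ftE by simp
    fix \<xi>
    have i: "integrable ?N (\<lambda>x. v x * cis (- dot d \<xi> x))" if "integrable ?N v" for v
      by (rule Bochner_Integration.integrable_bound[OF that])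
        (use that in \<open>simp_all add: norm_mult dot_def\<close>)
    show "(\<integral>x. (complex_of_real (F x) * E x - ft x * E x) * cis (- dot d \<xi> x) \<partial>?N) = 0"
      using i[OF FE] i[OF ftE] key[of \<xi>] by (simp add: left_diff_distrib)
  qed
  then show ?thesis using fF
  proof eventually_elim
    case (elim x)
    then have "(F x - Re (ft x)) * gaussian_Rd d x = 0" by (simp add: E_def algebra_simps)
    then have "F x = Re (ft x)" using gaussian_Rd_pos[of d x] by simp
    then show ?case using elim by (simp add: ft_def)
  qed
qed

section \<open>Weak derivatives of ridge functions\<close>

lemma Rd_update: "x \<in> Rd d \<Longrightarrow> i < d \<Longrightarrow> x(i := t) \<in> Rd d"
  by (auto simp: Rd_def PiE_iff extensional_def)

lemma continuous_map_Rd_update: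
  assumes "x \<in> Rd d" "i < d"
  shows "continuous_map euclideanreal (Rd_topology d) (\<lambda>t. x(i := t))"
  using assms unfolding Rd_topology_def continuous_map_componentwise
  by (auto simp: Rd_def PiE_iff extensional_def image_subset_iff)

text \<open>The complement of the compact \<open>K\<close> is open, so along each line the function
  vanishes near every point outside \<open>K\<close>, and with it the derivative; the same
  \<open>K\<close> serves.\<close>

lemma test_function_partial:
  assumes \<phi>: "test_function d \<Omega> \<phi>" and i: "i < d"
  shows "test_function d \<Omega> (partial i \<phi>)"
proof -
  obtain K where K: "K \<subseteq> \<Omega>" "compactin (Rd_topology d) K" "\<forall>x\<in>Rd d - K. \<phi> x = 0"
    and sm: "smooth_Rd d \<phi>" using \<phi> by (auto simp: test_function_def)
  have "smooth_Rd d (partial i \<phi>)"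
  proof -
    have "foldr partial js (partial i \<phi>) = foldr partial (js @ [i]) \<phi>" for js by simp
    moreover have "js @ [i] \<in> lists {..<d}" if "js \<in> lists {..<d}" for js using that i by simp
    ultimately show ?thesis using sm unfolding smooth_Rd_def by metis
  qed
  moreover have "partial i \<phi> x = 0" if x: "x \<in> Rd d - K" for x
  proof -
    have "Hausdorff_space (Rd_topology d)"
      unfolding Rd_topology_def by (auto simp: Hausdorff_space_product_topology)
    then have "openin (Rd_topology d) (Rd d - K)"
      using compactin_imp_closedin K(2) by (fastforce simp: closedin_def topspace_Rd_topology)
    then have "openin euclideanreal {t \<in> topspace euclideanreal. x(i := t) \<in> Rd d - K}"
      using continuous_map_Rd_update[of x d i] x i by (intro openin_continuous_map_preimage) auto
    then have op: "open {t. x(i := t) \<in> Rd d - K}" by simp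
    have "((\<lambda>t. \<phi> (x(i := t))) has_vector_derivative 0) (at (x i))"
      by (rule has_vector_derivative_transform_within_open[OF has_vector_derivative_const[of 0] op])
        (use x K(3) in auto)
    then show ?thesis unfolding partial_def by (rule vector_derivative_at)
  qed
  ultimately show ?thesis unfolding test_function_def using K by blast
qed

lemma test_function_foldr_partial:
  assumes "test_function d \<Omega> \<phi>" "is \<in> lists {..<d}"
  shows "test_function d \<Omega> (foldr partial is \<phi>)"
  using assms(2) by induction (auto intro: test_function_partial assms(1))

lemma partial_slice: "partial i g (x(i := t)) = vector_derivative (\<lambda>s. g (x(i := s))) (at t)"
  by (simp add: partial_def)

lemma deriv_power_slice:
  fixes \<phi> :: "(nat \<Rightarrow> real) \<Rightarrow> real"
  shows "(deriv ^^ k) (\<lambda>t. \<phi> (x(i := t))) = (\<lambda>t. (partial i ^^ k) \<phi> (x(i := t)))"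
proof (induction k)
  case (Suc k)
  have "deriv (\<lambda>t. g (x(i := t))) = (\<lambda>t. partial i g (x(i := t)))" for g :: "(nat \<Rightarrow> real) \<Rightarrow> real"
    unfolding partial_slice by (rule ext) (rule field_derivative_eq_vector_derivative)
  then show ?case by (simp only: funpow.simps o_apply Suc.IH)
qed simp

text \<open>Partial derivatives in one coordinate are ordinary derivatives on the line through
  \<open>x\<close>, so weak derivatives on the line can be tested with slices.\<close>

lemma test_function_slice:
  assumes \<phi>: "test_function d \<Omega> \<phi>" and i: "i < d" and x: "x \<in> Rd d"
  shows "test_function_real (\<lambda>t. \<phi> (x(i := t)))"
  unfolding test_function_real_def
proof (intro conjI allI)
  fix k t
  have "replicate k i \<in> lists {..<d}" using i by (simp add: in_lists_conv_set)
  moreover have "foldr partial (replicate k i) \<phi> = (partial i ^^ k) \<phi>" by (simp add: foldr_replicate)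
  ultimately have "(\<lambda>s. (partial i ^^ k) \<phi> ((x(i := t))(i := s))) differentiable (at ((x(i := t)) i))"
    using \<phi> Rd_update[OF x i, of t] i unfolding test_function_def smooth_Rd_def by metis
  then show "(deriv ^^ k) (\<lambda>t. \<phi> (x(i := t))) differentiable at t"
    by (simp add: deriv_power_slice)
next
  obtain K where K: "compactin (Rd_topology d) K" "\<forall>x\<in>Rd d - K. \<phi> x = 0"
    using \<phi> by (auto simp: test_function_def)
  obtain B where B: "K \<subseteq> cbox_Rd d (\<lambda>_. - B) (\<lambda>_. B)" using compactin_Rd_subset_cbox[OF K(1)] by blast
  have "{t. \<phi> (x(i := t)) \<noteq> 0} \<subseteq> {- B..B}"
  proof
    fix t assume "t \<in> {t. \<phi> (x(i := t)) \<noteq> 0}"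
    then have "x(i := t) \<in> K" using K(2) Rd_update[OF x i] by blast
    then have "x(i := t) \<in> {..<d} \<rightarrow>\<^sub>E {- B..B}" using B unfolding cbox_Rd_def by blast
    from PiE_mem[OF this, of i] have "(x(i := t)) i \<in> {- B..B}" using i by simp
    then show "t \<in> {- B..B}" by simp
  qed
  then have "bounded {t. \<phi> (x(i := t)) \<noteq> 0}" by (rule bounded_subset[rotated]) simp
  then show "compact (closure {t. \<phi> (x(i := t)) \<noteq> 0})" by simp
qed

section \<open>Weak derivatives along a line\<close>

lemma test_function_real_affine:
  assumes \<psi>: "test_function_real \<psi>" and a: "a \<noteq> 0"
  shows "test_function_real (\<lambda>s. \<psi> ((s - c) / a))"
    and "deriv (\<lambda>s. \<psi> ((s - c) / a)) = (\<lambda>s. deriv \<psi> ((s - c) / a) / a)"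
proof -
  have d: "(deriv ^^ k) \<psi> differentiable at t" for k t using \<psi> by (simp add: test_function_real_def)
  have D: "((\<lambda>s. (deriv ^^ k) \<psi> ((s - c) / a)) has_real_derivative (deriv ^^ Suc k) \<psi> ((s - c) / a) / a) (at s)" for k s
  proof -
    have "((deriv ^^ k) \<psi> has_real_derivative deriv ((deriv ^^ k) \<psi>) ((s - c) / a)) (at ((s - c) / a))"
      using d by (simp add: DERIV_deriv_iff_real_differentiable)
    moreover have "((\<lambda>s. (s - c) / a) has_real_derivative 1 / a) (at s)"
      using a by (auto intro!: derivative_eq_intros)
    ultimately show ?thesis using DERIV_chain2 by fastforce
  qed
  have eq: "(deriv ^^ k) (\<lambda>s. \<psi> ((s - c) / a)) = (\<lambda>s. (deriv ^^ k) \<psi> ((s - c) / a) / a ^ k)" for k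
  proof (induction k)
    case (Suc k)
    have "deriv (\<lambda>s. (deriv ^^ k) \<psi> ((s - c) / a) / a ^ k) s = (deriv ^^ Suc k) \<psi> ((s - c) / a) / a ^ Suc k" for s
      using DERIV_cdivide[OF D[of k s], of "a ^ k"] by (intro DERIV_imp_deriv) (simp add: mult.commute)
    then show ?case using Suc by auto
  qed simp
  show "deriv (\<lambda>s. \<psi> ((s - c) / a)) = (\<lambda>s. deriv \<psi> ((s - c) / a) / a)"
    using eq[of 1] by simp
  have "(deriv ^^ k) (\<lambda>s. \<psi> ((s - c) / a)) differentiable at s" for k s
    unfolding eq real_differentiable_def using DERIV_cdivide[OF D[of k s]] by blast
  moreover have "bounded {s. \<psi> ((s - c) / a) \<noteq> 0}"
  proof -
    have "bounded {t. \<psi> t \<noteq> 0}" using \<psi> by (simp add: test_function_real_def)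
    then have "bounded ((\<lambda>t. c + a *\<^sub>R t) ` {t. \<psi> t \<noteq> 0})"
      using bounded_translation bounded_scaling by (metis image_image)
    moreover have "{s. \<psi> ((s - c) / a) \<noteq> 0} \<subseteq> (\<lambda>t. c + a *\<^sub>R t) ` {t. \<psi> t \<noteq> 0}"
      using a by (auto intro!: image_eqI[of _ _ "(_ - c) / a"])
    ultimately show ?thesis by (rule bounded_subset)
  qed
  ultimately show "test_function_real (\<lambda>s. \<psi> ((s - c) / a))"
    by (simp add: test_function_real_def)
qed

lemma integral_deriv_test_function_real:
  assumes \<psi>: "test_function_real \<psi>"
  shows "(\<integral>t. deriv \<psi> t \<partial>lborel) = 0"
proof -
  have d: "(deriv ^^ k) \<psi> differentiable at t" for k t using \<psi> by (simp add: test_function_real_def)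
  have "bounded {t. \<psi> t \<noteq> 0}" using \<psi> by (simp add: test_function_real_def)
  then obtain R where R: "\<And>t. \<psi> t \<noteq> 0 \<Longrightarrow> \<bar>t\<bar> \<le> R" by (auto simp: bounded_iff)
  define S where "S = \<bar>R\<bar> + 1"
  have z: "\<psi> t = 0" if "\<bar>t\<bar> > R" for t using R[of t] that by force
  have D: "(\<psi> has_real_derivative deriv \<psi> t) (at t)" for t
    using d[of 0 t] by (simp add: DERIV_deriv_iff_real_differentiable)
  have dz: "deriv \<psi> t = 0" if "t \<notin> {- S..S}" for t
  proof (rule DERIV_imp_deriv)
    have "open {t. \<bar>t\<bar> > R}" by (intro open_Collect_less continuous_intros)
    then show "(\<psi> has_real_derivative 0) (at t)"
      by (rule has_field_derivative_transform_within_open[OF DERIV_const, of _ _ 0])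
        (use that z in \<open>auto simp: S_def\<close>)
  qed
  have "(\<integral>t. indicator {- S..S} t *\<^sub>R deriv \<psi> t \<partial>lborel) = \<psi> S - \<psi> (- S)"
  proof (rule integral_FTC_Icc)
    show "continuous_on {- S..S} (deriv \<psi>)"
      using d[of 1] by (intro continuous_at_imp_continuous_on ballI) (simp add: differentiable_imp_continuous_within)
    show "(\<psi> has_vector_derivative deriv \<psi> t) (at t within {- S..S})" for t
      using D[of t] by (simp add: has_real_derivative_iff_has_vector_derivative has_vector_derivative_at_within)
  qed (simp add: S_def)
  also have "\<dots> = 0" using z[of S] z[of "- S"] by (simp add: S_def)
  also have "(\<lambda>t. indicator {- S..S} t *\<^sub>R deriv \<psi> t) = deriv \<psi>"
    using dz by (auto simp: fun_eq_iff split: split_indicator)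
  finally show ?thesis .
qed

text \<open>A relation of order one between Borel functions; a derivative of order \<open>k\<close>
  is a chain of \<open>k\<close> such pairs, which suits induction over single partial
  derivatives.\<close>

definition weak_derivative_pair :: "(real \<Rightarrow> real) \<Rightarrow> (real \<Rightarrow> real) \<Rightarrow> bool" where
  "weak_derivative_pair p q \<longleftrightarrow>
     (\<forall>\<psi>. test_function_real \<psi> \<longrightarrow> (\<integral>t. p t * deriv \<psi> t \<partial>lborel) = - (\<integral>t. q t * \<psi> t \<partial>lborel))"

text \<open>Chain rule for \<open>t \<mapsto> a * t + c\<close>: the substitution is moved onto the
  test function, and the sign of \<open>a\<close> cancels between Jacobian and inner derivative. If
  \<open>a = 0\<close>, \<open>p\<close> is constant along the line and the claim says that a
  derivative of a test function integrates to 0.\<close>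

lemma weak_derivative_pair_affine:
  assumes pq: "weak_derivative_pair p q" and \<psi>: "test_function_real \<psi>"
  shows "(\<integral>t. p (a * t + c) * deriv \<psi> t \<partial>lborel) = - a * (\<integral>t. q (a * t + c) * \<psi> t \<partial>lborel)"
proof (cases "a = 0")
  case True
  then show ?thesis using integral_deriv_test_function_real[OF \<psi>] by simp
next
  case False
  let ?\<chi> = "\<lambda>s. \<psi> ((s - c) / a)"
  note \<chi> = test_function_real_affine[OF \<psi> False, of c]
  have "(\<integral>s. p s * deriv ?\<chi> s \<partial>lborel) = \<bar>a\<bar> * (\<integral>t. p (c + a * t) * (deriv \<psi> t / a) \<partial>lborel)"
    unfolding \<chi>(2) using False by (subst lborel_integral_real_affine[of a _ c]) simp_all
  also have "\<dots> = \<bar>a\<bar> / a * (\<integral>t. p (a * t + c) * deriv \<psi> t \<partial>lborel)"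
    by (simp add: add.commute)
  finally have 1: "(\<integral>s. p s * deriv ?\<chi> s \<partial>lborel) = \<bar>a\<bar> / a * (\<integral>t. p (a * t + c) * deriv \<psi> t \<partial>lborel)" .
  have 2: "(\<integral>s. q s * ?\<chi> s \<partial>lborel) = \<bar>a\<bar> * (\<integral>t. q (a * t + c) * \<psi> t \<partial>lborel)"
    using False by (subst lborel_integral_real_affine[of a _ c]) (simp_all add: add.commute)
  have "\<bar>a\<bar> / a * (\<integral>t. p (a * t + c) * deriv \<psi> t \<partial>lborel) = - (\<bar>a\<bar> * (\<integral>t. q (a * t + c) * \<psi> t \<partial>lborel))"
    using pq \<chi>(1) unfolding weak_derivative_pair_def 1[symmetric] 2[symmetric] by simp
  then show ?thesis using False by (cases "a > 0") (simp_all add: field_simps)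
qed

lemma bounded_times_test_function_integrable:
  assumes r: "r \<in> borel_measurable (lborel_Rd d)" "\<And>x. x \<in> Rd d \<Longrightarrow> \<bar>r x\<bar> \<le> C" and \<phi>: "test_function d \<Omega> \<phi>"
  shows "integrable (lborel_Rd d) (\<lambda>x. r x * \<phi> x)"
proof -
  obtain K where K: "compactin (Rd_topology d) K" "\<forall>x\<in>Rd d - K. \<phi> x = 0"
    using \<phi> by (auto simp: test_function_def)
  obtain B where B: "\<forall>x\<in>Rd d. \<bar>\<phi> x\<bar> \<le> B" using test_function_bounded[OF \<phi>] by blast
  show ?thesis
  proof (rule Bochner_Integration.integrable_bound)
    show "integrable (lborel_Rd d) (\<lambda>x. (C * B) * indicator K x)"
      using emeasure_compactin_Rd_finite[OF K(1)] compactin_Rd_sets[OF K(1)]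
      by (intro integrable_mult_right integrable_real_indicator)
    show "(\<lambda>x. r x * \<phi> x) \<in> borel_measurable (lborel_Rd d)"
      using r(1) test_function_measurable[OF \<phi>] by simp
    show "AE x in lborel_Rd d. norm (r x * \<phi> x) \<le> norm ((C * B) * indicator K x)"
    proof (rule AE_I2)
      fix x assume "x \<in> space (lborel_Rd d)"
      then have x: "x \<in> Rd d" by (simp add: space_lborel_Rd)
      show "norm (r x * \<phi> x) \<le> norm ((C * B) * indicator K x)"
      proof (cases "x \<in> K")
        case True
        have "\<bar>r x\<bar> * \<bar>\<phi> x\<bar> \<le> \<bar>C\<bar> * \<bar>B\<bar>"
          using r(2)[OF x] B x by (intro mult_mono) (force+)
        then show ?thesis using True by (simp add: abs_mult)
      next
        case False
        then show ?thesis using K(2) x by simp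
      qed
    qed
  qed
qed

text \<open>
  On a line in direction \<open>i\<close> this is the one-dimensional weak derivative, after the substitution
  \<open>t \<mapsto> w i * t + c\<close>.
\<close>

lemma ridge_integration_by_parts_step:
  assumes pq: "weak_derivative_pair p q"
    and [measurable]: "p \<in> borel_measurable borel" "q \<in> borel_measurable borel"
    and B: "\<And>t. \<bar>p t\<bar> \<le> B" "\<And>t. \<bar>q t\<bar> \<le> B"
    and w: "w \<in> Rd d" and \<phi>: "test_function d \<Omega> \<phi>" and i: "i < d"
  shows "(\<integral>x. p (dot d w x + b) * partial i \<phi> x \<partial>lborel_Rd d) =
    - w i * (\<integral>x. q (dot d w x + b) * \<phi> x \<partial>lborel_Rd d)"
proof -
  let ?I = "{..<d} - {i}"
  have I: "insert i ?I = {..<d}" using i by auto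
  have [measurable]: "(\<lambda>x. w) \<in> lborel_Rd d \<rightarrow>\<^sub>M lborel_Rd d"
    using w by (simp add: space_lborel_Rd)
  have i1: "integrable (Pi\<^sub>M (insert i ?I) (\<lambda>_. lborel)) (\<lambda>x. p (dot d w x + b) * partial i \<phi> x)"
    unfolding I by (rule bounded_times_test_function_integrable[OF _ B(1) test_function_partial[OF \<phi> i]]) measurable
  have i2: "integrable (Pi\<^sub>M (insert i ?I) (\<lambda>_. lborel)) (\<lambda>x. q (dot d w x + b) * \<phi> x)"
    unfolding I by (rule bounded_times_test_function_integrable[OF _ B(2) \<phi>]) measurable

  have inner: "(\<integral>t. p (dot d w (y(i := t)) + b) * partial i \<phi> (y(i := t)) \<partial>lborel) =
      - w i * (\<integral>t. q (dot d w (y(i := t)) + b) * \<phi> (y(i := t)) \<partial>lborel)"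
    if "y \<in> space (Pi\<^sub>M ?I (\<lambda>_. lborel))" for y
  proof -
    \<comment> \<open>The value 0 is a placeholder that puts \<open>y\<close> into
      \<open>Rd d\<close>; every slice overwrites it.\<close>
    define x where "x = y(i := 0)"
    have x: "x \<in> Rd d" using that i by (auto simp: x_def space_PiM Rd_def PiE_iff extensional_def)
    define c where "c = (\<Sum>j\<in>?I. w j * y j) + b"
    have dot: "dot d w (y(i := t)) + b = w i * t + c" for t
    proof -
      have "dot d w (y(i := t)) = w i * t + (\<Sum>j\<in>?I. w j * (y(i := t)) j)"
        unfolding dot_def using i by (subst sum.remove[of _ i]) auto
      also have "(\<Sum>j\<in>?I. w j * (y(i := t)) j) = (\<Sum>j\<in>?I. w j * y j)" by (rule sum.cong) auto
      finally show ?thesis unfolding c_def by (simp only: add.assoc)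
    qed
    have pd: "partial i \<phi> (y(i := t)) = deriv (\<lambda>t. \<phi> (x(i := t))) t" for t
      by (simp add: partial_def field_derivative_eq_vector_derivative x_def)
    have "y(i := t) = x(i := t)" for t by (simp add: x_def)
    then show ?thesis
      using weak_derivative_pair_affine[OF pq test_function_slice[OF \<phi> i x], of "w i" c]
      unfolding dot pd by simp
  qed
  have "(\<integral>x. p (dot d w x + b) * partial i \<phi> x \<partial>lborel_Rd d) =
      (\<integral>y. (\<integral>t. p (dot d w (y(i := t)) + b) * partial i \<phi> (y(i := t)) \<partial>lborel) \<partial>Pi\<^sub>M ?I (\<lambda>_. lborel))"
    using lborel_Rd.product_integral_insert[OF _ _ i1] unfolding I by simp
  also have "\<dots> = (\<integral>y. - w i * (\<integral>t. q (dot d w (y(i := t)) + b) * \<phi> (y(i := t)) \<partial>lborel) \<partial>Pi\<^sub>M ?I (\<lambda>_. lborel))"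
    by (intro Bochner_Integration.integral_cong refl inner)
  also have "\<dots> = - w i * (\<integral>x. q (dot d w x + b) * \<phi> x \<partial>lborel_Rd d)"
    using lborel_Rd.product_integral_insert[OF _ _ i2] unfolding I by simp
  finally show ?thesis .
qed

text \<open>Each list entry \<open>i\<close> moves one derivative from the test function to the
  ridge function, raises the index of \<open>h\<close> by one and contributes the factor
  \<open>- w i\<close>.\<close>

lemma ridge_integration_by_parts_list:
  assumes pair: "\<And>k. k < m \<Longrightarrow> weak_derivative_pair (h k) (h (Suc k))"
    and [measurable]: "\<And>k. h k \<in> borel_measurable borel" and B: "\<And>k t. \<bar>h k t\<bar> \<le> B"
    and w: "w \<in> Rd d" and \<phi>: "test_function d \<Omega> \<phi>"
    and "ls \<in> lists {..<d}" "j + length ls \<le> m"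
  shows "(\<integral>x. h j (dot d w x + b) * foldr partial ls \<phi> x \<partial>lborel_Rd d) =
    (-1) ^ length ls * prod_list (map w ls) * (\<integral>x. h (j + length ls) (dot d w x + b) * \<phi> x \<partial>lborel_Rd d)"
  using assms(6,7)
proof (induction ls arbitrary: j)
  case (Cons i js)
  have "(\<integral>x. h j (dot d w x + b) * foldr partial (i # js) \<phi> x \<partial>lborel_Rd d) =
      - w i * (\<integral>x. h (Suc j) (dot d w x + b) * foldr partial js \<phi> x \<partial>lborel_Rd d)"
    using ridge_integration_by_parts_step[OF pair[of j] _ _ B B w test_function_foldr_partial[OF \<phi>, of js], of i b] Cons.hyps Cons.prems
    by simp
  also have "\<dots> = - w i * ((-1) ^ length js * prod_list (map w js) *
      (\<integral>x. h (Suc j + length js) (dot d w x + b) * \<phi> x \<partial>lborel_Rd d))"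
    using Cons.IH[of "Suc j"] Cons.hyps Cons.prems by simp
  finally show ?case by simp
qed simp

text \<open>Links the two encodings of iterated derivatives: the multi-index is spelled out as a
  list containing \<open>i\<close> exactly \<open>\<alpha> i\<close> times.\<close>

lemma partial_multi_eq_foldr:
  "partial_multi d \<alpha> \<phi> = foldr partial (concat (map (\<lambda>i. replicate (\<alpha> i) i) [0..<d])) \<phi>"
proof -
  have "foldr (\<lambda>i. partial i ^^ \<alpha> i) is \<phi> = foldr partial (concat (map (\<lambda>i. replicate (\<alpha> i) i) is)) \<phi>" for "is"
    by (induction "is") (simp_all add: foldr_replicate)
  then show ?thesis by (simp add: partial_multi_def)
qed

lemma ridge_integration_by_parts:
  assumes pair: "\<And>k. k < m \<Longrightarrow> weak_derivative_pair (h k) (h (Suc k))"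
    and meas: "\<And>k. h k \<in> borel_measurable borel" and B: "\<And>k t. \<bar>h k t\<bar> \<le> B"
    and w: "w \<in> Rd d" and \<phi>: "test_function d \<Omega> \<phi>" and \<alpha>: "\<alpha> \<in> multi_indices d m"
  shows "(\<integral>x. h 0 (dot d w x + b) * partial_multi d \<alpha> \<phi> x \<partial>lborel_Rd d) =
    (-1) ^ (\<Sum>i<d. \<alpha> i) * (\<Prod>i<d. w i ^ \<alpha> i) * (\<integral>x. h (\<Sum>i<d. \<alpha> i) (dot d w x + b) * \<phi> x \<partial>lborel_Rd d)"
proof -
  let ?is = "concat (map (\<lambda>i. replicate (\<alpha> i) i) [0..<d])"
  have len: "length ?is = (\<Sum>i<d. \<alpha> i)"
    by (simp add: length_concat o_def sum_list_distinct_conv_sum_set atLeast0LessThan)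
  have pr: "prod_list (map w ?is) = (\<Prod>i<d. w i ^ \<alpha> i)"
    by (induction d) (simp_all add: prod_list_replicate)
  have "?is \<in> lists {..<d}" by (auto simp: in_lists_conv_set)
  moreover have "0 + length ?is \<le> m" using \<alpha> len by (simp add: multi_indices_def)
  ultimately show ?thesis
    using ridge_integration_by_parts_list[where h=h and m=m and B=B and j=0 and b=b and w=w and \<phi>=\<phi> and d=d and \<Omega>=\<Omega> and ls="?is", OF pair meas B w \<phi>]
    unfolding partial_multi_eq_foldr len pr by simp
qed

section \<open>Fourier coefficients of periodic functions\<close>

text \<open>The line is identified with \<open>Rd 1\<close>, where intervals become boxes.\<close>

lemma lborel_AE_zero_if_interval_integrals_zero:
  fixes u :: "real \<Rightarrow> real"
  assumes u: "integrable lborel u"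
    and zero: "\<And>a b. (\<integral>t. indicator {a<..<b} t * u t \<partial>lborel) = 0"
  shows "AE t in lborel. u t = 0"
proof -
  have [measurable]: "u \<in> borel_measurable borel" using u by auto
  have one: "{..<1::nat} = {0}" by auto
  have single: "(\<integral>x. f (x 0) \<partial>lborel_Rd 1) = integral\<^sup>L lborel f" if "f \<in> borel_measurable borel" for f :: "real \<Rightarrow> real"
    unfolding one by (rule lborel_Rd.product_integral_singleton) (use that in simp)
  have int: "integrable (lborel_Rd 1) (\<lambda>x. u (x 0))"
    using lborel_Rd.product_integrable_prod[of "{..<1}" "\<lambda>_. u"] u by (simp add: one)
  have "AE x in lborel_Rd 1. u (x 0) = 0"
  proof (rule AE_zero_if_obox_integrals_zero[OF int])
    fix a b :: "nat \<Rightarrow> real"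
    have "(\<integral>x. indicator (obox 1 a b) x * u (x 0) \<partial>lborel_Rd 1) = (\<integral>x. indicator {a 0<..<b 0} (x 0) * u (x 0) \<partial>lborel_Rd 1)"
      by (rule Bochner_Integration.integral_cong)
        (auto simp: obox_def space_lborel_Rd Rd_def PiE_iff split: split_indicator)
    also have "\<dots> = 0" using zero by (subst single) auto
    finally show "(\<integral>x. indicator (obox 1 a b) x * u (x 0) \<partial>lborel_Rd 1) = 0" .
  qed
  then have "(\<integral>x. \<bar>u (x 0)\<bar> \<partial>lborel_Rd 1) = 0"
    by (intro integral_eq_zero_AE) auto
  then have "(\<integral>t. \<bar>u t\<bar> \<partial>lborel) = 0" by (subst (asm) single) auto
  then show ?thesis using u by (subst (asm) integral_nonneg_eq_0_iff_AE) auto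
qed

text \<open>Vanishing Fourier coefficients of all orders for the basic frequency
  \<open>\<theta>\<close>, stated for integrable functions on the whole line so that a function cut
  off to one period fits.\<close>

definition trig_annihilator :: "real \<Rightarrow> (real \<Rightarrow> complex) set" where
  "trig_annihilator \<theta> = {v. integrable lborel v \<and> (\<forall>k::int. (\<integral>t. v t * cis (of_int k * (\<theta> * t)) \<partial>lborel) = 0)}"

lemma integrable_times_bounded:
  fixes v w :: "'a \<Rightarrow> complex"
  assumes v: "integrable M v" and [measurable]: "w \<in> borel_measurable M" and B: "\<And>t. cmod (w t) \<le> B"
  shows "integrable M (\<lambda>t. v t * w t)"
proof (rule Bochner_Integration.integrable_bound)
  show "integrable M (\<lambda>t. complex_of_real B * v t)" using v by simp
  have "cmod (w t) \<le> \<bar>B\<bar>" for t using B[of t] by linarith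
  then show "AE t in M. norm (v t * w t) \<le> norm (complex_of_real B * v t)"
    by (auto simp: norm_mult mult.commute[of "cmod (v _)"] intro!: AE_I2 mult_right_mono)
  show "(\<lambda>t. v t * w t) \<in> borel_measurable M" using v by measurable
qed

lemma trig_annihilator_cis:
  assumes "v \<in> trig_annihilator \<theta>"
  shows "integrable lborel (\<lambda>t. v t * cis (of_int k * (\<theta> * t)))"
  by (rule integrable_times_bounded[where B=1]) (use assms in \<open>auto simp: trig_annihilator_def\<close>)

lemma trig_annihilator_shift:
  assumes v: "v \<in> trig_annihilator \<theta>"
  shows "(\<lambda>t. v t * cis (of_int j * (\<theta> * t))) \<in> trig_annihilator \<theta>"
proof -
  have "(v t * cis (of_int j * (\<theta> * t))) * cis (of_int k * (\<theta> * t)) = v t * cis (of_int (j + k) * (\<theta> * t))" for k t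
    by (simp add: mult.assoc cis_mult distrib_right)
  then show ?thesis using v trig_annihilator_cis[OF v, of j] unfolding trig_annihilator_def mem_Collect_eq
    by (simp only:) simp
qed

lemma trig_annihilator_linear:
  assumes "v \<in> trig_annihilator \<theta>" "w \<in> trig_annihilator \<theta>"
  shows "(\<lambda>t. c * v t + e * w t) \<in> trig_annihilator \<theta>"
proof -
  have "(c * v t + e * w t) * cis (of_int k * (\<theta> * t)) =
      c * (v t * cis (of_int k * (\<theta> * t))) + e * (w t * cis (of_int k * (\<theta> * t)))" for k t
    by (simp add: algebra_simps)
  then show ?thesis
    using assms trig_annihilator_cis[OF assms(1)] trig_annihilator_cis[OF assms(2)]
    unfolding trig_annihilator_def by simp
qed

text \<open>
  Functions whose product with every element of the annihilator stays in the annihilator form an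
  algebra for trivial reasons, so Stone-Weierstrass applies to them without trigonometric sums.
\<close>

definition annihilator_multiplier :: "real \<Rightarrow> (complex \<Rightarrow> real) \<Rightarrow> bool" where
  "annihilator_multiplier \<theta> g \<longleftrightarrow> continuous_on (sphere 0 1) g \<and>
     (\<forall>v\<in>trig_annihilator \<theta>. (\<lambda>t. v t * complex_of_real (g (cis (\<theta> * t)))) \<in> trig_annihilator \<theta>)"

text \<open>The cosine is a mean of two waves of order 1 and -1, and multiplication by either merely
  shifts the orders of the coefficients, all of which vanish.\<close>

lemma annihilator_multiplier_Re: "annihilator_multiplier \<theta> Re"
  unfolding annihilator_multiplier_def
proof (intro conjI ballI)
  fix v assume v: "v \<in> trig_annihilator \<theta>"
  have eq: "v t * complex_of_real (Re (cis (\<theta> * t))) =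
      1 / 2 * (v t * cis (of_int 1 * (\<theta> * t))) + 1 / 2 * (v t * cis (of_int (- 1) * (\<theta> * t)))" for t
    by (simp add: complex_eq_iff field_simps)
  show "(\<lambda>t. v t * complex_of_real (Re (cis (\<theta> * t)))) \<in> trig_annihilator \<theta>"
    unfolding eq by (intro trig_annihilator_linear trig_annihilator_shift v)
qed (intro continuous_intros)

lemma annihilator_multiplier_Im: "annihilator_multiplier \<theta> Im"
  unfolding annihilator_multiplier_def
proof (intro conjI ballI)
  fix v assume v: "v \<in> trig_annihilator \<theta>"
  have eq: "v t * complex_of_real (Im (cis (\<theta> * t))) =
      (- \<i> / 2) * (v t * cis (of_int 1 * (\<theta> * t))) + \<i> / 2 * (v t * cis (of_int (- 1) * (\<theta> * t)))" for t
    by (simp add: complex_eq_iff field_simps)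
  show "(\<lambda>t. v t * complex_of_real (Im (cis (\<theta> * t)))) \<in> trig_annihilator \<theta>"
    unfolding eq by (intro trig_annihilator_linear trig_annihilator_shift v)
qed (intro continuous_intros)

text \<open>Stone-Weierstrass on the unit circle, whose points \<open>Re\<close> and
  \<open>Im\<close> separate.\<close>

lemma annihilator_multiplier_dense:
  assumes "continuous_on (sphere 0 1) f" "e > 0"
  shows "\<exists>g. annihilator_multiplier \<theta> g \<and> (\<forall>z\<in>sphere 0 1. \<bar>f z - g z\<bar> < e)"
proof (rule Stone_Weierstrass_HOL[where P="annihilator_multiplier \<theta>"])
  show "annihilator_multiplier \<theta> (\<lambda>x. c)" for c
    using trig_annihilator_linear[of _ \<theta> _ "complex_of_real c" 0]
    unfolding annihilator_multiplier_def by (auto simp: mult.commute)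
  show "annihilator_multiplier \<theta> (\<lambda>x. g x + h x)" if "annihilator_multiplier \<theta> g \<and> annihilator_multiplier \<theta> h" for g h
    using that trig_annihilator_linear[of _ \<theta> _ 1 1]
    unfolding annihilator_multiplier_def by (auto intro!: continuous_intros simp: distrib_left)
  show "annihilator_multiplier \<theta> (\<lambda>x. g x * h x)" if "annihilator_multiplier \<theta> g \<and> annihilator_multiplier \<theta> h" for g h
    using that unfolding annihilator_multiplier_def by (auto intro!: continuous_intros simp: mult.assoc[symmetric])
  show "\<exists>g. annihilator_multiplier \<theta> g \<and> g x \<noteq> g y" if "x \<in> sphere 0 1 \<and> y \<in> sphere 0 1 \<and> x \<noteq> y" for x y
    using that annihilator_multiplier_Re annihilator_multiplier_Im by (auto simp: complex_eq_iff)
qed (use assms in \<open>auto simp: annihilator_multiplier_def\<close>)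

text \<open>With a multiplier \<open>g\<close> close to \<open>f\<close> on the circle the product
  stays in the annihilator, and its coefficient of order 0 is its integral. Replacing
  \<open>f\<close> by \<open>g\<close> costs at most \<open>e\<close> times the L1 norm of
  \<open>v\<close>.\<close>

lemma trig_annihilator_integral_zero:
  assumes v: "v \<in> trig_annihilator \<theta>" and f: "continuous_on UNIV f"
  shows "(\<integral>t. v t * complex_of_real (f (cis (\<theta> * t))) \<partial>lborel) = 0"
proof -
  let ?F = "\<lambda>t. v t * complex_of_real (f (cis (\<theta> * t)))"
  have vi: "integrable lborel v" using v by (simp add: trig_annihilator_def)
  have [measurable]: "f \<in> borel_measurable borel" by (rule borel_measurable_continuous_onI[OF f])
  have fS: "continuous_on (sphere 0 1) f" using f continuous_on_subset by blast
  have "bounded (f ` sphere 0 1)" by (intro compact_imp_bounded compact_continuous_image fS) simp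
  then obtain B where "\<forall>z\<in>sphere 0 1. \<bar>f z\<bar> \<le> B" by (auto simp: bounded_iff)
  then have "\<bar>f (cis x)\<bar> \<le> B" for x by simp
  then have Fi: "integrable lborel ?F"
    by (intro integrable_times_bounded[OF vi, where B=B]) auto
  have le: "cmod (integral\<^sup>L lborel ?F) \<le> e * (\<integral>t. cmod (v t) \<partial>lborel)" if e: "e > 0" for e
  proof -
    obtain g where g: "annihilator_multiplier \<theta> g" "\<And>z. z \<in> sphere 0 1 \<Longrightarrow> \<bar>f z - g z\<bar> < e"
      using annihilator_multiplier_dense[OF fS e] by blast
    let ?G = "\<lambda>t. v t * complex_of_real (g (cis (\<theta> * t)))"
    have G: "?G \<in> trig_annihilator \<theta>" using g(1) v by (simp add: annihilator_multiplier_def)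
    then have "integrable lborel ?G" and G0: "(\<integral>t. ?G t * cis (of_int 0 * (\<theta> * t)) \<partial>lborel) = 0"
      unfolding trig_annihilator_def by blast+
    have "integral\<^sup>L lborel ?F = (\<integral>t. ?F t - ?G t \<partial>lborel)"
      using Fi \<open>integrable lborel ?G\<close> G0 by simp
    also have "cmod \<dots> \<le> (\<integral>t. cmod (?F t - ?G t) \<partial>lborel)" by (rule integral_norm_bound)
    also have "\<dots> \<le> (\<integral>t. e * cmod (v t) \<partial>lborel)"
    proof (rule integral_mono)
      show "cmod (?F t - ?G t) \<le> e * cmod (v t)" for t
      proof -
        have "?F t - ?G t = v t * complex_of_real (f (cis (\<theta> * t)) - g (cis (\<theta> * t)))"
          by (simp add: algebra_simps)
        moreover have "\<bar>f (cis (\<theta> * t)) - g (cis (\<theta> * t))\<bar> \<le> e" using g(2)[of "cis (\<theta> * t)"] by simp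
        ultimately show ?thesis by (simp add: norm_mult mult.commute[of e] mult_left_mono del: of_real_diff)
      qed
    qed (use Fi \<open>integrable lborel ?G\<close> vi in simp_all)
    finally show ?thesis by simp
  qed
  \<comment> \<open>The accuracy will be \<open>\<epsilon> / (V + 1)\<close> because
    \<open>V\<close> itself may be 0.\<close>
  define V where "V = (\<integral>t. cmod (v t) \<partial>lborel)"
  have "V \<ge> 0" by (simp add: V_def)
  have "cmod (integral\<^sup>L lborel ?F) \<le> 0 + \<epsilon>" if "\<epsilon> > 0" for \<epsilon>
  proof -
    have "cmod (integral\<^sup>L lborel ?F) \<le> \<epsilon> / (V + 1) * V"
      using le[of "\<epsilon> / (V + 1)", folded V_def] that \<open>V \<ge> 0\<close> by simp
    also have "\<dots> \<le> \<epsilon>" using that \<open>V \<ge> 0\<close> by (simp add: field_simps)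
    finally show ?thesis by simp
  qed
  then have "cmod (integral\<^sup>L lborel ?F) \<le> 0" by (rule field_le_epsilon)
  then show ?thesis by simp
qed

text \<open>Within one period an interval is a superlevel set of a cosine centred at its mid-point,
  the threshold being the value at half its length. Indicators of intervals thus become limits of
  continuous functions of \<open>cis (\<theta> * t)\<close>.\<close>

lemma cos_arc_iff:
  assumes "0 < T" "0 \<le> a" "a < b" "b \<le> T" "0 \<le> t" "t \<le> T"
  shows "cos (2 * pi / T * ((b - a) / 2)) < cos (2 * pi / T * t - 2 * pi / T * ((a + b) / 2)) \<longleftrightarrow> t \<in> {a<..<b}"
proof -
  define \<theta> where "\<theta> = 2 * pi / T"
  define r where "r = (b - a) / 2"
  define s where "s = \<bar>t - (a + b) / 2\<bar>"
  have \<theta>: "\<theta> > 0" "\<theta> * T = 2 * pi" using assms by (auto simp: \<theta>_def)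
  have r: "0 < r" "2 * r \<le> T" using assms by (auto simp: r_def)
  have s: "0 \<le> s" "s \<le> T - r" using assms by (auto simp: s_def r_def field_simps abs_if)
  have in_iff: "t \<in> {a<..<b} \<longleftrightarrow> s < r" by (auto simp: s_def r_def abs_if field_simps)
  have "\<theta> * t - \<theta> * ((a + b) / 2) = \<theta> * (t - (a + b) / 2)" by (simp add: algebra_simps)
  then have cs: "cos (\<theta> * t - \<theta> * ((a + b) / 2)) = cos (\<theta> * s)"
    using \<theta> by (simp add: s_def abs_if) (metis cos_minus minus_diff_eq mult_minus_right)
  have \<theta>r: "0 \<le> \<theta> * r" "\<theta> * r \<le> pi"
  proof -
    have "\<theta> * (2 * r) \<le> \<theta> * T" using r \<theta> by (intro mult_left_mono) auto
    then show "\<theta> * r \<le> pi" using \<theta> by simp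
    show "0 \<le> \<theta> * r" using r \<theta> by simp
  qed
  have "cos (\<theta> * r) < cos (\<theta> * s) \<longleftrightarrow> s < r"
  proof (cases "\<theta> * s \<le> pi")
    case True
    then have "cos (\<theta> * r) < cos (\<theta> * s) \<longleftrightarrow> \<theta> * s < \<theta> * r"
      using \<theta>r s \<theta> by (intro cos_mono_less_eq) auto
    then show ?thesis using \<theta> by simp
  next
    case False
    \<comment> \<open>Beyond \<open>pi\<close> the angle is reflected to
      \<open>2 * pi - \<theta> * s\<close>, which lies between \<open>\<theta> * r\<close> and
      \<open>pi\<close>, where the cosine decreases.\<close>
    have "\<theta> * s \<le> \<theta> * (T - r)" using s \<theta> by (intro mult_left_mono) auto
    then have le: "\<theta> * r \<le> 2 * pi - \<theta> * s" using \<theta> by (simp add: algebra_simps)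
    have "cos (2 * pi - \<theta> * s) \<le> cos (\<theta> * r)"
      using le False \<theta>r by (intro cos_monotone_0_pi_le) auto
    moreover have "cos (2 * pi - \<theta> * s) = cos (\<theta> * s)" by (simp add: cos_diff)
    moreover have "\<not> s < r"
    proof
      assume "s < r"
      then have "\<theta> * s < \<theta> * r" using \<theta> by simp
      then show False using False \<theta>r by simp
    qed
    ultimately show ?thesis by simp
  qed
  then show ?thesis using cs in_iff by (simp add: \<theta>_def r_def)
qed

text \<open>Uniqueness of Fourier coefficients: continuous functions on the circle are already known
  to integrate to 0 against \<open>Q\<close>, and ramps above the cosine threshold approximate the
  indicator of any interval inside the period.\<close>

lemma trig_annihilator_AE_zero:
  fixes Q :: "real \<Rightarrow> real"
  assumes T: "0 < T" and Q: "(\<lambda>t. complex_of_real (Q t)) \<in> trig_annihilator (2 * pi / T)"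
    and supp: "\<And>t. t \<notin> {0..T} \<Longrightarrow> Q t = 0"
  shows "AE t in lborel. Q t = 0"
proof (rule lborel_AE_zero_if_interval_integrals_zero)
  have "integrable lborel (\<lambda>t. complex_of_real (Q t))" using Q by (simp add: trig_annihilator_def)
  then show Qi: "integrable lborel Q" by (simp add: complex_of_real_integrable_eq)
  then have [measurable]: "Q \<in> borel_measurable borel" by auto
  let ?\<theta> = "2 * pi / T"
  have main: "(\<integral>t. indicator {a<..<b} t * Q t \<partial>lborel) = 0" if ab: "0 \<le> a" "b \<le> T" "a < b" for a b
  proof -
    define c where "c = cos (?\<theta> * ((b - a) / 2))"
    define \<alpha> where "\<alpha> = ?\<theta> * ((a + b) / 2)"
    \<comment> \<open>A ramp of slope \<open>n\<close> above the threshold \<open>c\<close>, clipped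
      to values between 0 and 1; the rotation by \<open>- \<alpha>\<close> moves the mid-point of
      the interval to angle 0.\<close>
    define f :: "nat \<Rightarrow> complex \<Rightarrow> real" where "f n z = min 1 (max 0 (real n * (Re (z * cis (- \<alpha>)) - c)))" for n z
    have f: "continuous_on UNIV (f n)" for n unfolding f_def by (intro continuous_intros)
    have [measurable]: "f n \<in> borel_measurable borel" for n by (rule borel_measurable_continuous_onI[OF f])
    have lim: "(\<lambda>n. Q t * f n (cis (?\<theta> * t))) \<longlonglongrightarrow> indicator {a<..<b} t * Q t" for t
    proof (cases "t \<in> {0..T}")
      case True
      define y where "y = cos (?\<theta> * t - \<alpha>) - c"
      have y: "0 < y \<longleftrightarrow> t \<in> {a<..<b}"
        using cos_arc_iff[OF T ab(1,3,2), of t] True by (simp add: y_def c_def \<alpha>_def)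
      have fy: "f n (cis (?\<theta> * t)) = min 1 (max 0 (real n * y))" for n
        by (simp only: f_def y_def cis_mult add_uminus_conv_diff cis.sel)
      have "(\<lambda>n. min 1 (max 0 (real n * y))) \<longlonglongrightarrow> (indicator {a<..<b} t :: real)"
      proof (cases "0 < y")
        case True
        have "eventually (\<lambda>n. real n \<ge> 1 / y) sequentially" by real_asymp
        then have "eventually (\<lambda>n. min 1 (max 0 (real n * y)) = (indicator {a<..<b} t :: real)) sequentially"
          by eventually_elim (use True y in \<open>auto simp: field_simps min_def max_def\<close>)
        then show ?thesis by (rule tendsto_eventually)
      next
        case False
        then have "real n * y \<le> 0" for n by (simp add: mult_nonneg_nonpos)
        then have "max 0 (real n * y) = 0" for n by simp
        then have "min 1 (max 0 (real n * y)) = (indicator {a<..<b} t :: real)" for n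
          using y False by simp
        then show ?thesis by simp
      qed
      then show ?thesis unfolding fy by (subst mult.commute) (intro tendsto_intros)
    qed (simp add: supp)
    have "(\<lambda>n. \<integral>t. Q t * f n (cis (?\<theta> * t)) \<partial>lborel) \<longlonglongrightarrow> (\<integral>t. indicator {a<..<b} t * Q t \<partial>lborel)"
    proof (rule integral_dominated_convergence[where w="\<lambda>t. \<bar>Q t\<bar>"])
      show "AE t in lborel. norm (Q t * f n (cis (?\<theta> * t))) \<le> \<bar>Q t\<bar>" for n
        by (auto simp: abs_mult f_def intro!: AE_I2 mult_left_le)
    qed (use Qi lim in auto)
    moreover have "(\<integral>t. Q t * f n (cis (?\<theta> * t)) \<partial>lborel) = 0" for n
    proof -
      have "complex_of_real (\<integral>t. Q t * f n (cis (?\<theta> * t)) \<partial>lborel) = 0"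
        using trig_annihilator_integral_zero[OF Q f[of n]] by (simp flip: of_real_mult)
      then show ?thesis by simp
    qed
    ultimately show ?thesis by (simp add: LIMSEQ_const_iff)
  qed
  fix a b :: real
  \<comment> \<open>\<open>Q\<close> vanishes off the period, so an arbitrary interval is clipped to
    it; this changes the integrand at most in the two end points.\<close>
  have "(\<integral>t. indicator {a<..<b} t * Q t \<partial>lborel) = (\<integral>t. indicator {max a 0<..<min b T} t * Q t \<partial>lborel)"
  proof (rule integral_cong_AE)
    show "AE t in lborel. indicator {a<..<b} t * Q t = indicator {max a 0<..<min b T} t * Q t"
      using AE_lborel_singleton[of 0] AE_lborel_singleton[of T]
      by eventually_elim (use supp in \<open>auto split: split_indicator\<close>)
  qed measurable
  also have "\<dots> = 0"
  proof (cases "max a 0 < min b T")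
    case True
    then show ?thesis by (intro main) auto
  next
    case False
    then have "{max a 0<..<min b T} = {}" by auto
    then show ?thesis by simp
  qed
  finally show "(\<integral>t. indicator {a<..<b} t * Q t \<partial>lborel) = 0" .
qed


section \<open>Fourier coefficients over one period\<close>

lemma integral_cis_period:
  assumes T: "0 < T" and k: "k \<noteq> (0::int)"
  shows "(\<integral>t. complex_of_real (indicator {0..T} t) * cis (of_int k * (2 * pi / T * t)) \<partial>lborel) = 0"
proof -
  define a where "a = of_int k * (2 * pi / T)"
  have a: "a \<noteq> 0" using T k by (simp add: a_def)
  define F where "F t = - \<i> / complex_of_real a * cis (a * t)" for t
  have D: "(F has_vector_derivative cis (a * t)) (at t)" for t
  proof -
    have "((\<lambda>t. exp (\<i> * complex_of_real a * complex_of_real t)) has_vector_derivative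
        \<i> * complex_of_real a * exp (\<i> * complex_of_real a * complex_of_real t)) (at t)"
      by (rule has_vector_derivative_real_field[where f="\<lambda>z. exp (\<i> * complex_of_real a * z)"])
        (auto intro!: derivative_eq_intros)
    then have "((\<lambda>t. cis (a * t)) has_vector_derivative \<i> * complex_of_real a * cis (a * t)) (at t)"
      by (simp add: cis_conv_exp mult.assoc)
    from has_vector_derivative_mult_right[OF this, of "- \<i> / complex_of_real a"]
    show ?thesis unfolding F_def[abs_def] using a by (simp add: field_simps)
  qed
  have "(\<integral>t. indicator {0..T} t *\<^sub>R cis (a * t) \<partial>lborel) = F T - F 0"
    by (rule integral_FTC_Icc)
      (use T D in \<open>auto intro!: continuous_intros intro: has_vector_derivative_at_within\<close>)
  also have "F T = F 0"
  proof -
    have "a * T = 2 * pi * of_int k" using T by (simp add: a_def)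
    moreover have "cis (2 * pi * of_int k) = 1" by (rule cis_multiple_2pi) simp
    ultimately show ?thesis by (simp add: F_def)
  qed
  finally show ?thesis by (simp add: a_def scaleR_conv_of_real mult.assoc)
qed

text \<open>Without the factor \<open>1 / T\<close> and with a plus sign in the exponent, so
  \<open>T\<close> times the usual coefficient of order \<open>- k\<close>. This is the integral
  that the average over the bias produces.\<close>

definition fourier_coeff :: "real \<Rightarrow> (real \<Rightarrow> real) \<Rightarrow> int \<Rightarrow> complex" where
  "fourier_coeff T S k =
     (\<integral>t. complex_of_real (indicator {0..T} t * S t) * cis (of_int k * (2 * pi / T * t)) \<partial>lborel)"

lemma interval_bounded_integrable:
  fixes S :: "real \<Rightarrow> real"
  assumes [measurable]: "S \<in> borel_measurable borel" and B: "\<And>t. \<bar>S t\<bar> \<le> B"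
  shows "integrable lborel (\<lambda>t. indicator {a..b} t * S t)"
proof (rule Bochner_Integration.integrable_bound)
  show "integrable lborel (\<lambda>t. B * indicator {a..b} t)"
    by (intro integrable_mult_right integrable_real_indicator) (auto simp: emeasure_lborel_Icc_eq)
  have "\<bar>S t\<bar> \<le> \<bar>B\<bar>" for t using B[of t] by linarith
  then show "AE t in lborel. norm (indicator {a..b} t * S t) \<le> norm (B * indicator {a..b} t)"
    by (auto split: split_indicator)
qed measurable

lemma periodic_of_int:
  assumes "\<And>t. \<sigma> (t + T) = \<sigma> (t::real)"
  shows "\<sigma> (t + of_int n * T) = \<sigma> t"
proof (induction n rule: int_induct[of _ 0])
  case (step1 i)
  then show ?case using assms[of "t + of_int i * T"] by (simp add: algebra_simps)
next
  case (step2 i)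
  then show ?case using assms[of "t + of_int (i - 1) * T"] by (simp add: algebra_simps)
qed simp

text \<open>If all coefficients of non-zero order vanished, \<open>S\<close> minus its mean, cut off
  to one period, would lie in the annihilator and be null. Then \<open>\<sigma>\<close> would be
  constant almost everywhere on a period, hence on the line.\<close>

lemma exists_fourier_coeff_nonzero:
  assumes T: "0 < T" and S [measurable]: "S \<in> borel_measurable borel" and B: "\<And>t. \<bar>S t\<bar> \<le> B"
    and \<sigma>S: "AE t in lborel. \<sigma> t = S t" and per: "\<And>t. \<sigma> (t + T) = \<sigma> t"
    and nonconst: "\<not> (\<exists>c. AE t in lebesgue. \<sigma> t = (c::real))"
  shows "\<exists>k. k \<noteq> 0 \<and> fourier_coeff T S k \<noteq> 0"
proof (rule ccontr)
  assume "\<not> ?thesis"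
  then have zero: "fourier_coeff T S k = 0" if "k \<noteq> 0" for k using that by blast
  \<comment> \<open>Subtracting the mean kills the coefficient of order 0 and leaves the others
    alone, because non-trivial waves integrate to 0 over a period.\<close>
  define \<mu> where "\<mu> = (\<integral>t. indicator {0..T} t * S t \<partial>lborel) / T"
  define Q where "Q t = indicator {0..T} t * (S t - \<mu>)" for t
  have i1: "integrable lborel (\<lambda>t. complex_of_real (indicator {0..T} t * S t) * cis (of_int k * (2 * pi / T * t)))" for k :: int
    using interval_bounded_integrable[OF S B] by (intro integrable_times_bounded[where B=1] integrable_of_real) auto
  have i2: "integrable lborel (\<lambda>t. complex_of_real (indicator {0..T} t) * cis (of_int k * (2 * pi / T * t)))" for k :: int
    by (intro integrable_times_bounded[where B=1] integrable_of_real integrable_real_indicator)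
      (auto simp: emeasure_lborel_Icc_eq)
  have Qc: "complex_of_real (Q t) * cis (of_int k * (2 * pi / T * t)) =
      complex_of_real (indicator {0..T} t * S t) * cis (of_int k * (2 * pi / T * t)) -
      complex_of_real \<mu> * (complex_of_real (indicator {0..T} t) * cis (of_int k * (2 * pi / T * t)))" for k t
    by (simp add: Q_def algebra_simps)
  have "(\<integral>t. complex_of_real (Q t) * cis (of_int k * (2 * pi / T * t)) \<partial>lborel) =
      fourier_coeff T S k - complex_of_real \<mu> * (\<integral>t. complex_of_real (indicator {0..T} t) * cis (of_int k * (2 * pi / T * t)) \<partial>lborel)" for k
    unfolding Qc fourier_coeff_def using i1[of k] i2[of k] by simp
  moreover have "fourier_coeff T S 0 = complex_of_real (\<mu> * T)"
    unfolding fourier_coeff_def using T by (simp add: \<mu>_def flip: of_real_mult)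
  moreover have "(\<integral>t. complex_of_real (indicator {0..T} t) * cis (of_int 0 * (2 * pi / T * t)) \<partial>lborel) = complex_of_real T"
    using T by simp
  ultimately have "(\<integral>t. complex_of_real (Q t) * cis (of_int k * (2 * pi / T * t)) \<partial>lborel) = 0" for k
    using zero[of k] integral_cis_period[OF T, of k] by (cases "k = 0") (simp_all only:, simp_all)
  moreover have "integrable lborel (\<lambda>t. complex_of_real (Q t))"
  proof -
    have "integrable lborel (\<lambda>t. indicator {0..T} t * (S t - \<mu>))"
    proof (rule interval_bounded_integrable)
      show "\<bar>S t - \<mu>\<bar> \<le> B + \<bar>\<mu>\<bar>" for t using B[of t] by linarith
    qed measurable
    then show ?thesis unfolding Q_def[abs_def] by (rule integrable_of_real)
  qed
  ultimately have "(\<lambda>t. complex_of_real (Q t)) \<in> trig_annihilator (2 * pi / T)"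
    unfolding trig_annihilator_def by blast
  then have Q0: "AE t in lborel. Q t = 0"
    by (rule trig_annihilator_AE_zero[OF T]) (simp add: Q_def)
  have "AE t in lborel. \<sigma> t = S t \<and> Q t = 0" using \<sigma>S Q0 by eventually_elim simp
  then obtain N where N: "{t \<in> space lborel. \<not> (\<sigma> t = S t \<and> Q t = 0)} \<subseteq> N" "emeasure lborel N = 0" "N \<in> sets lborel"
    by (rule AE_E)
  have [measurable]: "N \<in> sets borel" using N(3) by simp
  have "AE t in lborel. t \<notin> N" using N(2,3) by (intro AE_not_in) auto
  \<comment> \<open>The translates of the null set by multiples of \<open>T\<close> are countably
    many. Off their union the exact periodicity of \<open>\<sigma>\<close> carries the value
    \<open>\<mu>\<close> from the period to every point; \<open>S\<close> is only almost everywhere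
    periodic.\<close>
  then have "AE t in lborel. of_int n * T + 1 * t \<notin> N" for n :: int
    by (intro AE_borel_affine) auto
  then have "AE t in lborel. \<forall>n::int. of_int n * T + 1 * t \<notin> N"
    by (simp add: AE_all_countable)
  then have "AE t in lborel. \<sigma> t = \<mu>"
  proof eventually_elim
    case (elim t)
    define n where "n = - \<lfloor>t / T\<rfloor>"
    have "of_int \<lfloor>t / T\<rfloor> * T \<le> t" "t \<le> (of_int \<lfloor>t / T\<rfloor> + 1) * T"
      using T floor_divide_lower[of T t] floor_divide_upper[of T t] by auto
    then have "t + of_int n * T \<in> {0..T}" by (simp add: n_def algebra_simps)
    moreover have "t + of_int n * T \<notin> N" using elim[rule_format, of n] by (simp add: add.commute)
    then have "\<sigma> (t + of_int n * T) = S (t + of_int n * T)" "Q (t + of_int n * T) = 0" using N(1) by auto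
    ultimately have "\<sigma> (t + of_int n * T) = \<mu>" by (simp add: Q_def)
    then show ?case by (simp add: periodic_of_int[of \<sigma>, OF per])
  qed
  then have "AE t in lebesgue. \<sigma> t = \<mu>" by (rule AE_completion)
  then show False using nonconst by blast
qed

text \<open>The windows \<open>{s..s + T}\<close> and \<open>{0..T}\<close> differ by two pieces
  that are translates of each other by \<open>T\<close>. Periodicity holds almost everywhere only,
  since \<open>G\<close> will come from a Borel representative.\<close>

lemma integral_period_shift:
  fixes G :: "real \<Rightarrow> complex"
  assumes T: "0 < T" and [measurable]: "G \<in> borel_measurable borel" and B: "\<And>t. cmod (G t) \<le> B"
    and per: "AE t in lborel. G (t + T) = G t"
  shows "(\<integral>t. complex_of_real (indicator {0..T} t) * G (s + t) \<partial>lborel) =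
    (\<integral>t. complex_of_real (indicator {0..T} t) * G t \<partial>lborel)"
proof -
  define J where "J a b = (\<integral>t. complex_of_real (indicator {a..b} t) * G t \<partial>lborel)" for a b
  have i: "integrable lborel (\<lambda>t. complex_of_real (indicator {a..b} t) * G t)" for a b
    by (intro integrable_times_bounded[OF _ _ B] integrable_of_real integrable_real_indicator)
      (auto simp: emeasure_lborel_Icc_eq)
  have add: "J a c = J a b + J b c" if "a \<le> b" "b \<le> c" for a b c
  proof -
    have "J a c = (\<integral>t. complex_of_real (indicator {a..b} t) * G t + complex_of_real (indicator {b..c} t) * G t \<partial>lborel)"
      unfolding J_def
    proof (rule integral_cong_AE)
      show "AE t in lborel. complex_of_real (indicator {a..c} t) * G t =
          complex_of_real (indicator {a..b} t) * G t + complex_of_real (indicator {b..c} t) * G t"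
        using AE_lborel_singleton[of b] by eventually_elim (use that in \<open>auto split: split_indicator\<close>)
    qed measurable
    then show ?thesis using i by (simp add: J_def)
  qed
  have shift: "(\<integral>t. complex_of_real (indicator {a..b} t) * G (c + t) \<partial>lborel) = J (a + c) (b + c)" for a b c
    unfolding J_def
    by (subst lborel_integral_real_affine[of 1 _ c])
      (auto intro!: Bochner_Integration.integral_cong split: split_indicator)
  have shiftT: "J (a + T) (b + T) = J a b" for a b
  proof -
    have "J (a + T) (b + T) = (\<integral>t. complex_of_real (indicator {a..b} t) * G (T + t) \<partial>lborel)"
      by (rule shift[symmetric])
    also have "\<dots> = J a b"
      unfolding J_def by (rule integral_cong_AE) (use per in \<open>auto simp: add.commute\<close>)
    finally show ?thesis .
  qed
  have "J s (s + T) = J 0 T"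
  proof (cases "0 \<le> s")
    case True
    have "J 0 s + J s (s + T) = J 0 (s + T)" using add[of 0 s "s + T"] True T by simp
    also have "\<dots> = J 0 T + J T (s + T)" using add[of 0 T "s + T"] True T by simp
    also have "J T (s + T) = J 0 s" using shiftT[of 0 s] by simp
    finally show ?thesis by simp
  next
    case False
    have "J s (s + T) + J (s + T) T = J s T" using add[of s "s + T" T] False T by simp
    also have "\<dots> = J s 0 + J 0 T" using add[of s 0 T] False T by simp
    also have "J (s + T) T = J s 0" using shiftT[of s 0] by simp
    finally show ?thesis by simp
  qed
  then show ?thesis unfolding shift by (simp add: J_def add.commute)
qed

text \<open>Translation turns into modulation. With \<open>s = - dot d \<omega> x / a\<close> and
  \<open>a = of_int k * (2 * pi / T)\<close> the phase is \<open>cis (dot d \<omega> x)\<close>: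
  this is where plane waves arise from neurons.\<close>

lemma fourier_coeff_translate:
  assumes T: "0 < T" and S [measurable]: "S \<in> borel_measurable borel" and B: "\<And>t. \<bar>S t\<bar> \<le> B"
    and per: "AE t in lborel. S (t + T) = S t"
  shows "(\<integral>b. complex_of_real (indicator {0..T} b * S (s + b)) * cis (of_int k * (2 * pi / T * b)) \<partial>lborel) =
    cis (- (of_int k * (2 * pi / T * s))) * fourier_coeff T S k"
proof -
  define G where "G t = complex_of_real (S t) * cis (of_int k * (2 * pi / T * t))" for t
  have [measurable]: "G \<in> borel_measurable borel" unfolding G_def[abs_def] by measurable
  have "cmod (G t) \<le> B" for t using B by (simp add: G_def norm_mult)
  moreover have "AE t in lborel. G (t + T) = G t"
    using per
  proof eventually_elim
    case (elim t)
    have "cis (of_int k * (2 * pi / T * (t + T))) = cis (of_int k * (2 * pi / T * t)) * cis (2 * pi * of_int k)"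
      using T by (simp add: cis_mult field_simps)
    also have "cis (2 * pi * of_int k) = 1" by (rule cis_multiple_2pi) simp
    finally show ?case using elim by (simp add: G_def)
  qed
  ultimately have "(\<integral>t. complex_of_real (indicator {0..T} t) * G (s + t) \<partial>lborel) =
      (\<integral>t. complex_of_real (indicator {0..T} t) * G t \<partial>lborel)"
    by (intro integral_period_shift[OF T]) auto
  moreover have "complex_of_real (indicator {0..T} b * S (s + b)) * cis (of_int k * (2 * pi / T * b)) =
      cis (- (of_int k * (2 * pi / T * s))) * (complex_of_real (indicator {0..T} b) * G (s + b))" for b
  proof -
    have e: "cis (- (of_int k * (2 * pi / T * s))) * cis (of_int k * (2 * pi / T * (s + b))) = cis (of_int k * (2 * pi / T * b))"
    proof -
      have "- (K * (c * s)) + K * (c * (s + b)) = K * (c * b)" for K c :: real by (simp add: algebra_simps)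
      then show ?thesis by (simp only: cis_mult)
    qed
    show ?thesis unfolding G_def of_real_mult e[symmetric] by (simp only: mult_ac)
  qed
  moreover have "(\<integral>t. complex_of_real (indicator {0..T} t) * G t \<partial>lborel) = fourier_coeff T S k"
    by (simp add: G_def fourier_coeff_def mult.assoc)
  ultimately show ?thesis by (simp only: integral_mult_right_zero)
qed

section \<open>Multi-indices and Maurey's sampling argument\<close>

text \<open>An index of order at most \<open>m + 1\<close> either has order at most
  \<open>m\<close>, encoded by \<open>i = d\<close>, or arises by raising one coordinate
  \<open>i < d\<close>. The two cases mirror the summands of the factor
  \<open>1 + (\<Sum>i<d. y i)\<close> in the next estimate.\<close>

lemma multi_indices_Suc_subset:
  "multi_indices d (Suc m) \<subseteq>
     (\<lambda>(i, \<beta>). if i = d then \<beta> else \<beta>(i := Suc (\<beta> i))) ` ({..d} \<times> multi_indices d m)"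
proof
  fix \<alpha> assume \<alpha>: "\<alpha> \<in> multi_indices d (Suc m)"
  show "\<alpha> \<in> (\<lambda>(i, \<beta>). if i = d then \<beta> else \<beta>(i := Suc (\<beta> i))) ` ({..d} \<times> multi_indices d m)"
  proof (cases "(\<Sum>i<d. \<alpha> i) \<le> m")
    case True
    then show ?thesis using \<alpha> by (intro image_eqI[of _ _ "(d, \<alpha>)"]) (auto simp: multi_indices_def)
  next
    case False
    have "\<exists>i<d. \<alpha> i \<noteq> 0"
    proof (rule ccontr)
      assume "\<not> ?thesis"
      then have "(\<Sum>i<d. \<alpha> i) = 0" by simp
      then show False using False by simp
    qed
    then obtain i where i: "i < d" "\<alpha> i \<noteq> 0" by blast
    let ?\<beta> = "\<alpha>(i := \<alpha> i - 1)"
    have "(\<Sum>j<d. \<alpha> j) = \<alpha> i + (\<Sum>j\<in>{..<d} - {i}. \<alpha> j)" using i by (simp add: sum.remove)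
    moreover have "(\<Sum>j<d. ?\<beta> j) = ?\<beta> i + (\<Sum>j\<in>{..<d} - {i}. ?\<beta> j)"
      using i by (intro sum.remove) auto
    moreover have "(\<Sum>j\<in>{..<d} - {i}. ?\<beta> j) = (\<Sum>j\<in>{..<d} - {i}. \<alpha> j)" by (rule sum.cong) auto
    ultimately have "Suc (\<Sum>j<d. ?\<beta> j) = (\<Sum>j<d. \<alpha> j)" using i by simp
    moreover have "(\<Sum>j<d. \<alpha> j) \<le> Suc m" using \<alpha> by (simp add: multi_indices_def)
    ultimately have "(\<Sum>j<d. ?\<beta> j) \<le> m" by linarith
    then have "?\<beta> \<in> multi_indices d m" using \<alpha> i by (simp add: multi_indices_def)
    then show ?thesis using i by (intro image_eqI[of _ _ "(i, ?\<beta>)"]) auto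
  qed
qed

lemma multi_indices_0: "multi_indices d 0 = {\<lambda>_. 0}"
proof -
  have "\<alpha> = (\<lambda>_. 0)" if \<alpha>: "\<alpha> \<in> multi_indices d 0" for \<alpha>
  proof
    fix i show "\<alpha> i = 0"
      using \<alpha> by (cases "i < d") (simp_all add: multi_indices_def)
  qed
  moreover have "(\<lambda>_. 0) \<in> multi_indices d 0" by (simp add: multi_indices_def)
  ultimately show ?thesis by blast
qed

lemma finite_multi_indices: "finite (multi_indices d m)"
proof (induction m)
  case (Suc m)
  then show ?case by (intro finite_subset[OF multi_indices_Suc_subset] finite_imageI) simp
qed (simp add: multi_indices_0)

text \<open>Each monomial occurs in the expansion of the right-hand side with coefficient at least
  1. Counting the indices instead would bring in the dimension.\<close>

lemma sum_multi_indices_le: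
  fixes y :: "nat \<Rightarrow> real"
  assumes y: "\<And>i. 0 \<le> y i"
  shows "(\<Sum>\<alpha>\<in>multi_indices d m. \<Prod>i<d. y i ^ \<alpha> i) \<le> (1 + (\<Sum>i<d. y i)) ^ m"
proof (induction m)
  case (Suc m)
  let ?f = "\<lambda>(i, \<beta>). if i = d then \<beta> else \<beta>(i := Suc (\<beta> i))"
  let ?A = "{..d} \<times> multi_indices d m"
  let ?p = "\<lambda>\<alpha>. \<Prod>i<d. y i ^ \<alpha> i"
  have fin: "finite ?A" by (simp add: finite_multi_indices)
  have nn: "0 \<le> ?p \<alpha>" for \<alpha> by (intro prod_nonneg) (simp add: y)
  have pf: "?p (?f (i, \<beta>)) = (if i = d then 1 else y i) * ?p \<beta>" if "i \<le> d" for i \<beta>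
  proof (cases "i = d")
    case False
    then have i: "i < d" using that by simp
    have "(\<Prod>j<d. y j ^ (\<beta>(i := Suc (\<beta> i))) j) = y i ^ Suc (\<beta> i) * (\<Prod>j\<in>{..<d} - {i}. y j ^ (\<beta>(i := Suc (\<beta> i))) j)"
      using i by (subst prod.remove[of _ i]) auto
    also have "(\<Prod>j\<in>{..<d} - {i}. y j ^ (\<beta>(i := Suc (\<beta> i))) j) = (\<Prod>j\<in>{..<d} - {i}. y j ^ \<beta> j)"
      by (rule prod.cong) auto
    also have "y i ^ Suc (\<beta> i) * \<dots> = y i * ?p \<beta>"
      using i by (subst (2) prod.remove[of _ i]) auto
    finally show ?thesis using False by simp
  qed simp
  have "(\<Sum>\<alpha>\<in>multi_indices d (Suc m). ?p \<alpha>) \<le> (\<Sum>\<alpha>\<in>?f ` ?A. ?p \<alpha>)"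
    by (rule sum_mono2) (use fin multi_indices_Suc_subset nn in auto)
  \<comment> \<open>Different pairs may produce the same index; the terms are non-negative, so
    summing over pairs only adds.\<close>
  also have "\<dots> \<le> (\<Sum>a\<in>?A. ?p (?f a))"
    using sum_image_le[OF fin, of ?p ?f] nn by (simp add: o_def)
  also have "\<dots> = (\<Sum>(i, \<beta>)\<in>?A. ?p (?f (i, \<beta>)))"
  proof (rule sum.cong[OF refl])
    fix a :: "nat \<times> (nat \<Rightarrow> nat)"
    show "?p (?f a) = (case a of (i, \<beta>) \<Rightarrow> ?p (?f (i, \<beta>)))" by (cases a) (simp only: prod.case)
  qed
  also have "\<dots> = (\<Sum>i\<le>d. \<Sum>\<beta>\<in>multi_indices d m. ?p (?f (i, \<beta>)))"
    by (rule sum.cartesian_product[symmetric])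
  also have "\<dots> = (\<Sum>i\<le>d. (if i = d then 1 else y i) * (\<Sum>\<beta>\<in>multi_indices d m. ?p \<beta>))"
    unfolding sum_distrib_left by (intro sum.cong refl pf) simp
  also have "\<dots> = (\<Sum>i\<le>d. if i = d then 1 else y i) * (\<Sum>\<beta>\<in>multi_indices d m. ?p \<beta>)"
    by (rule sum_distrib_right[symmetric])
  also have "(\<Sum>i\<le>d. if i = d then 1 else y i) = 1 + (\<Sum>i<d. y i)"
    by (simp add: lessThan_Suc_atMost[symmetric])
  also have "(1 + (\<Sum>i<d. y i)) * (\<Sum>\<beta>\<in>multi_indices d m. ?p \<beta>) \<le> (1 + (\<Sum>i<d. y i)) * (1 + (\<Sum>i<d. y i)) ^ m"
    by (intro mult_left_mono Suc.IH) (simp add: sum_nonneg y)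
  finally show ?case by simp
qed (simp add: multi_indices_0)

text \<open>The cross term vanishes because \<open>Y\<close> minus its expectation is centred, and
  the variance is at most the second moment.\<close>

lemma (in prob_space) maurey_step_pointwise:
  fixes Y :: "'a \<Rightarrow> real"
  assumes [measurable]: "Y \<in> borel_measurable M" and K: "\<And>z. \<bar>Y z\<bar> \<le> K"
  shows "(\<integral>z. (s + (Y z - expectation Y))\<^sup>2 \<partial>M) \<le> s\<^sup>2 + (\<integral>z. (Y z)\<^sup>2 \<partial>M)"
proof -
  have i: "integrable M Y" by (rule integrable_const_bound[where B=K]) (use K in auto)
  have "\<bar>Y z\<bar>\<^sup>2 \<le> K\<^sup>2" for z using K[of z] by (intro power_mono) auto
  then have i2: "integrable M (\<lambda>z. (Y z)\<^sup>2)" by (intro integrable_const_bound[where B="K\<^sup>2"]) auto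
  let ?F = "expectation Y"
  have "(s + (Y z - ?F))\<^sup>2 = ((s - ?F)\<^sup>2 + 2 * (s - ?F) * Y z) + (Y z)\<^sup>2" for z
    by (simp add: power2_eq_square algebra_simps)
  then have "(\<integral>z. (s + (Y z - ?F))\<^sup>2 \<partial>M) = (s - ?F)\<^sup>2 + 2 * (s - ?F) * ?F + (\<integral>z. (Y z)\<^sup>2 \<partial>M)"
    using i i2 by (simp add: prob_space)
  also have "\<dots> = s\<^sup>2 - ?F\<^sup>2 + (\<integral>z. (Y z)\<^sup>2 \<partial>M)" by (simp add: power2_eq_square algebra_simps)
  finally show ?thesis by simp
qed

text \<open>
  The points are chosen one at a time: averaged over the next point, the squared error grows by at
  most \<open>K\<^sup>2\<close> times the mass of \<open>X\<close>, so some choice achieves this and no product measure is needed.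
\<close>

lemma maurey_sampling:
  fixes Y :: "'i \<Rightarrow> 'z \<Rightarrow> 'x \<Rightarrow> real"
  assumes "prob_space P" and "finite_measure X" and I: "finite I"
    and Ym: "\<And>i. i \<in> I \<Longrightarrow> (\<lambda>(z, x). Y i z x) \<in> borel_measurable (P \<Otimes>\<^sub>M X)"
    and YK: "\<And>z x. (\<Sum>i\<in>I. (Y i z x)\<^sup>2) \<le> K\<^sup>2"
    and good: "AE z in P. good z"
  shows "\<exists>zs :: nat \<Rightarrow> 'z. (\<forall>j<n. zs j \<in> space P \<and> good (zs j)) \<and>
    (\<Sum>i\<in>I. \<integral>x. (\<Sum>j<n. Y i (zs j) x - (\<integral>z. Y i z x \<partial>P))\<^sup>2 \<partial>X) \<le> real n * (K\<^sup>2 * measure X (space X))"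
proof (induction n)
  case (Suc n)
  interpret P: prob_space P by fact
  interpret X: finite_measure X by fact
  interpret PX: pair_sigma_finite P X by standard
  interpret PXf: finite_measure "P \<Otimes>\<^sub>M X" by (intro finite_measure_pair_measure assms P.finite_measure_axioms)
  let ?k = "\<bar>K\<bar>"
  define F where "F i x = (\<integral>z. Y i z x \<partial>P)" for i x
  define V where "V = K\<^sup>2 * measure X (space X)"
  obtain zs where zs: "\<And>j. j < n \<Longrightarrow> zs j \<in> space P" "\<And>j. j < n \<Longrightarrow> good (zs j)"
    and IH: "(\<Sum>i\<in>I. \<integral>x. (\<Sum>j<n. Y i (zs j) x - F i x)\<^sup>2 \<partial>X) \<le> real n * V"
    using Suc unfolding F_def V_def by blast
  define S where "S i x = (\<Sum>j<n. Y i (zs j) x - F i x)" for i x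
  have Yk: "\<bar>Y i z x\<bar> \<le> ?k" if "i \<in> I" for i z x
  proof -
    have "(Y i z x)\<^sup>2 \<le> (\<Sum>i\<in>I. (Y i z x)\<^sup>2)" using that I by (intro member_le_sum) auto
    also have "\<dots> \<le> K\<^sup>2" by (rule YK)
    finally show ?thesis by (simp add: abs_le_square_iff)
  qed
  have Yz: "Y i z \<in> borel_measurable X" if "i \<in> I" "z \<in> space P" for i z
    using measurable_compose[OF measurable_Pair1'[OF that(2)] Ym[OF that(1)]] by simp
  have Yx: "(\<lambda>z. Y i z x) \<in> borel_measurable P" if "i \<in> I" "x \<in> space X" for i x
    using measurable_compose[OF measurable_Pair2'[OF that(2)] Ym[OF that(1)]] by simp
  have Fm: "F i \<in> borel_measurable X" if "i \<in> I" for i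
  proof -
    have "(\<lambda>(x, z). Y i z x) \<in> borel_measurable (X \<Otimes>\<^sub>M P)"
      using measurable_compose[OF measurable_pair_swap' Ym[OF that]] by (simp add: split_beta)
    then show ?thesis unfolding F_def[abs_def] by (rule P.borel_measurable_lebesgue_integral)
  qed
  have Fk: "\<bar>F i x\<bar> \<le> ?k" if "i \<in> I" "x \<in> space X" for i x
  proof -
    have "\<bar>F i x\<bar> \<le> (\<integral>z. \<bar>Y i z x\<bar> \<partial>P)" unfolding F_def by (rule integral_abs_bound)
    also have "\<dots> \<le> (\<integral>z. ?k \<partial>P)"
      by (rule integral_mono)
        (use Yk[OF that(1)] Yx[OF that] in \<open>auto intro!: P.integrable_const_bound[where B="?k"]\<close>)
    finally show ?thesis by (simp add: P.prob_space)
  qed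
  have Sm: "S i \<in> borel_measurable X" if "i \<in> I" for i
    unfolding S_def[abs_def] using Yz[OF that zs(1)] Fm[OF that] by (intro borel_measurable_sum borel_measurable_diff) auto
  \<comment> \<open>These crude bounds grow with \<open>n\<close>; they only secure integrability
    for Fubini and do not enter the final estimate.\<close>
  have Sk: "\<bar>S i x\<bar> \<le> real n * (2 * ?k)" if "i \<in> I" "x \<in> space X" for i x
  proof -
    have "\<bar>S i x\<bar> \<le> (\<Sum>j<n. \<bar>Y i (zs j) x - F i x\<bar>)" unfolding S_def by (rule sum_abs)
    also have "\<dots> \<le> (\<Sum>j<n. 2 * ?k)"
    proof (rule sum_mono)
      fix j show "\<bar>Y i (zs j) x - F i x\<bar> \<le> 2 * ?k"
        using Yk[OF that(1), of "zs j" x] Fk[OF that] by linarith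
    qed
    finally show ?thesis by simp
  qed
  define R where "R i z x = (S i x + (Y i z x - F i x))\<^sup>2" for i z x
  have Ri: "integrable (P \<Otimes>\<^sub>M X) (\<lambda>(z, x). R i z x)" if "i \<in> I" for i
  proof (rule PXf.integrable_const_bound[where B="(real n * (2 * ?k) + 2 * ?k)\<^sup>2"])
    have [measurable]: "S i \<in> borel_measurable X" "F i \<in> borel_measurable X"
      "(\<lambda>p. Y i (fst p) (snd p)) \<in> borel_measurable (P \<Otimes>\<^sub>M X)"
      using Sm Fm Ym[OF that] that by (simp_all add: split_beta')
    show "(\<lambda>(z, x). R i z x) \<in> borel_measurable (P \<Otimes>\<^sub>M X)"
      unfolding R_def split_beta' by measurable
    have "R i z x \<le> (real n * (2 * ?k) + 2 * ?k)\<^sup>2" if x: "x \<in> space X" for z x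
    proof -
      have "\<bar>S i x + (Y i z x - F i x)\<bar> \<le> real n * (2 * ?k) + 2 * ?k"
        using Sk[OF \<open>i \<in> I\<close> x] Fk[OF \<open>i \<in> I\<close> x] Yk[OF \<open>i \<in> I\<close>, of z x] by linarith
      then have "\<bar>S i x + (Y i z x - F i x)\<bar>\<^sup>2 \<le> (real n * (2 * ?k) + 2 * ?k)\<^sup>2" by (intro power_mono) auto
      then show ?thesis by (simp add: R_def)
    qed
    then show "AE p in P \<Otimes>\<^sub>M X. norm (case p of (z, x) \<Rightarrow> R i z x) \<le> (real n * (2 * ?k) + 2 * ?k)\<^sup>2"
      by (intro AE_I2) (auto simp: space_pair_measure R_def)
  qed
  define Q where "Q z = (\<Sum>i\<in>I. \<integral>x. R i z x \<partial>X)" for z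
  have Qi: "integrable P Q" unfolding Q_def[abs_def]
    by (intro Bochner_Integration.integrable_sum PX.integrable_fst Ri)
  have Y2i: "integrable (P \<Otimes>\<^sub>M X) (\<lambda>(z, x). (Y i z x)\<^sup>2)" if "i \<in> I" for i
  proof (rule PXf.integrable_const_bound[where B="K\<^sup>2"])
    show "(\<lambda>(z, x). (Y i z x)\<^sup>2) \<in> borel_measurable (P \<Otimes>\<^sub>M X)"
      using Ym[OF that] by (simp add: split_beta')
    have "\<bar>Y i z x\<bar>\<^sup>2 \<le> ?k\<^sup>2" for z x using Yk[OF that, of z x] by (intro power_mono) auto
    then show "AE p in P \<Otimes>\<^sub>M X. norm (case p of (z, x) \<Rightarrow> (Y i z x)\<^sup>2) \<le> K\<^sup>2" by auto
  qed
  have S2i: "integrable X (\<lambda>x. (S i x)\<^sup>2)" if "i \<in> I" for i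
  proof (rule X.integrable_const_bound[where B="(real n * (2 * ?k))\<^sup>2"])
    have "\<bar>S i x\<bar>\<^sup>2 \<le> (real n * (2 * ?k))\<^sup>2" if "x \<in> space X" for x
      using Sk[OF \<open>i \<in> I\<close> that] by (intro power_mono) auto
    then show "AE x in X. norm ((S i x)\<^sup>2) \<le> (real n * (2 * ?k))\<^sup>2" by auto
  qed (use Sm[OF that] in simp)
  have "(\<integral>z. Q z \<partial>P) = (\<Sum>i\<in>I. \<integral>z. (\<integral>x. R i z x \<partial>X) \<partial>P)"
    unfolding Q_def by (intro Bochner_Integration.integral_sum PX.integrable_fst Ri)
  also have "\<dots> = (\<Sum>i\<in>I. \<integral>x. (\<integral>z. R i z x \<partial>P) \<partial>X)"
    by (intro sum.cong refl PX.Fubini_integral[symmetric] Ri)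
  also have "\<dots> \<le> (\<Sum>i\<in>I. \<integral>x. (S i x)\<^sup>2 + (\<integral>z. (Y i z x)\<^sup>2 \<partial>P) \<partial>X)"
  proof (intro sum_mono integral_mono)
    fix i assume i: "i \<in> I"
    show "integrable X (\<lambda>x. \<integral>z. R i z x \<partial>P)" by (rule PX.integrable_snd[OF Ri[OF i]])
    show "integrable X (\<lambda>x. (S i x)\<^sup>2 + (\<integral>z. (Y i z x)\<^sup>2 \<partial>P))"
      by (intro Bochner_Integration.integrable_add S2i[OF i] PX.integrable_snd[OF Y2i[OF i]])
    fix x assume x: "x \<in> space X"
    show "(\<integral>z. R i z x \<partial>P) \<le> (S i x)\<^sup>2 + (\<integral>z. (Y i z x)\<^sup>2 \<partial>P)"
      unfolding R_def F_def by (rule P.maurey_step_pointwise[OF Yx[OF i x] Yk[OF i]])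
  qed
  also have "\<dots> = (\<Sum>i\<in>I. \<integral>x. (S i x)\<^sup>2 \<partial>X) + (\<Sum>i\<in>I. \<integral>x. (\<integral>z. (Y i z x)\<^sup>2 \<partial>P) \<partial>X)"
    unfolding sum.distrib[symmetric]
    by (intro sum.cong refl Bochner_Integration.integral_add S2i PX.integrable_snd Y2i)
  also have "(\<Sum>i\<in>I. \<integral>x. (\<integral>z. (Y i z x)\<^sup>2 \<partial>P) \<partial>X) = (\<Sum>i\<in>I. integral\<^sup>L (P \<Otimes>\<^sub>M X) (\<lambda>(z, x). (Y i z x)\<^sup>2))"
    by (intro sum.cong refl PX.integral_snd Y2i)
  \<comment> \<open>The sum over \<open>I\<close> is pulled inside before estimating:
    \<open>YK\<close> bounds the whole vector at each point, so no factor \<open>card I\<close>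
    appears.\<close>
  also have "\<dots> = integral\<^sup>L (P \<Otimes>\<^sub>M X) (\<lambda>(z, x). \<Sum>i\<in>I. (Y i z x)\<^sup>2)"
    using Y2i by (subst Bochner_Integration.integral_sum[symmetric]) (auto simp: split_beta')
  also have "\<dots> \<le> integral\<^sup>L (P \<Otimes>\<^sub>M X) (\<lambda>_. K\<^sup>2)"
  proof (rule integral_mono)
    show "integrable (P \<Otimes>\<^sub>M X) (\<lambda>(z, x). \<Sum>i\<in>I. (Y i z x)\<^sup>2)"
      using Y2i by (simp add: split_beta')
  qed (use YK in auto)
  also have "\<dots> = V"
  proof -
    have "measure (P \<Otimes>\<^sub>M X) (space (P \<Otimes>\<^sub>M X)) = measure X (space X)"
      by (simp add: space_pair_measure measure_def X.emeasure_pair_measure_Times P.emeasure_space_1)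
    then show ?thesis by (simp add: V_def)
  qed
  finally have le: "(\<integral>z. Q z \<partial>P) \<le> real n * V + V" using IH by (simp add: S_def)
  \<comment> \<open>If every good point exceeded the bound, \<open>Q\<close> would exceed it almost
    everywhere, and so would its expectation.\<close>
  have "\<exists>z\<in>space P. good z \<and> Q z \<le> real n * V + V"
  proof (rule ccontr)
    assume neg: "\<not> ?thesis"
    have "AE z in P. real n * V + V < Q z"
      using good AE_space[of P]
    proof eventually_elim
      case (elim z)
      then show ?case using neg not_le by blast
    qed
    from P.expectation_greater[OF Qi this] le show False by simp
  qed
  then obtain z where z: "z \<in> space P" "good z" "Q z \<le> real n * V + V" by blast
  define zs' where "zs' = zs(n := z)"
  have "(\<Sum>j<Suc n. Y i (zs' j) x - F i x) = S i x + (Y i z x - F i x)" for i x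
    by (simp add: S_def zs'_def)
  then have "(\<Sum>i\<in>I. \<integral>x. (\<Sum>j<Suc n. Y i (zs' j) x - F i x)\<^sup>2 \<partial>X) = Q z"
    unfolding Q_def R_def by (simp only:)
  also have "\<dots> \<le> real (Suc n) * V" using z(3) by (simp add: distrib_right)
  finally have "(\<Sum>i\<in>I. \<integral>x. (\<Sum>j<Suc n. Y i (zs' j) x - F i x)\<^sup>2 \<partial>X) \<le> real (Suc n) * V" .
  moreover have "zs' j \<in> space P \<and> good (zs' j)" if "j < Suc n" for j
    using that zs z by (auto simp: zs'_def less_Suc_eq)
  ultimately show ?case unfolding F_def V_def by (intro exI[of _ zs'] conjI) simp_all
qed simp

section \<open>The approximation theorem\<close>

lemma AE_lborel_translate:
  assumes "AE t in lborel. P (t::real)"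
  shows "AE t in lborel. P (c + t)"
proof -
  obtain N where N: "{t \<in> space lborel. \<not> P t} \<subseteq> N" "emeasure lborel N = 0" "N \<in> sets lborel"
    using assms by (rule AE_E)
  have [measurable]: "N \<in> sets borel" using N(3) by simp
  have "AE t in lborel. t \<notin> N" using N(2,3) by (intro AE_not_in) auto
  then have "AE t in lborel. c + 1 * t \<notin> N" by (intro AE_borel_affine) auto
  then show ?thesis by eventually_elim (use N(1) in auto)
qed

text \<open>Values beyond the essential bound are set to 0, so the bound holds at every point. A
  neuron with zero inner weight evaluates its activation at a single point, which may lie in the
  exceptional set.\<close>

lemma L_infinity_borel_version:
  assumes "g \<in> L_infinity"
  shows "\<exists>h B. h \<in> borel_measurable borel \<and> (\<forall>t. \<bar>h t\<bar> \<le> B) \<and> (AE t in lborel. g t = h t)"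
proof -
  obtain B where B: "AE t in lebesgue. \<bar>g t\<bar> \<le> B" and g: "g \<in> borel_measurable lebesgue"
    using assms by (auto simp: L_infinity_def)
  obtain v where v: "v \<in> borel_measurable lborel" "AE t in lborel. g t = v t"
    using completion_ex_borel_measurable_real[OF g] by blast
  have [measurable]: "v \<in> borel_measurable borel" using v(1) by simp
  have "AE t in lborel. \<bar>g t\<bar> \<le> B" using B by (simp add: AE_completion_iff)
  then have "AE t in lborel. g t = (if \<bar>v t\<bar> \<le> \<bar>B\<bar> then v t else 0)"
    using v(2) by eventually_elim auto
  moreover have "(\<lambda>t. if \<bar>v t\<bar> \<le> \<bar>B\<bar> then v t else 0) \<in> borel_measurable borel" by measurable
  moreover have "\<bar>if \<bar>v t\<bar> \<le> \<bar>B\<bar> then v t else 0\<bar> \<le> \<bar>B\<bar>" for t by auto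
  ultimately show ?thesis by blast
qed

lemma test_function_real_deriv:
  assumes \<psi>: "test_function_real \<psi>"
  shows "test_function_real (deriv \<psi>)"
proof -
  have d: "(deriv ^^ k) \<psi> differentiable at t" for k t using \<psi> by (simp add: test_function_real_def)
  have "(deriv ^^ k) (deriv \<psi>) = (deriv ^^ Suc k) \<psi>" for k
    by (simp only: funpow_Suc_right o_apply)
  then have "(deriv ^^ k) (deriv \<psi>) differentiable at t" for k t using d[of "Suc k" t] by (simp only:)
  moreover have "{t. deriv \<psi> t \<noteq> 0} \<subseteq> closure {t. \<psi> t \<noteq> 0}"
  proof (rule ccontr)
    assume "\<not> ?thesis"
    then obtain t where t: "deriv \<psi> t \<noteq> 0" "t \<in> - closure {t. \<psi> t \<noteq> 0}" by blast
    have "(\<psi> has_real_derivative 0) (at t)"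
    proof (rule has_field_derivative_transform_within_open[OF DERIV_const _ t(2)])
      show "0 = \<psi> s" if "s \<in> - closure {t. \<psi> t \<noteq> 0}" for s
        using that closure_subset[of "{t. \<psi> t \<noteq> 0}"] by auto
    qed auto
    then show False using t(1) by (simp add: DERIV_imp_deriv)
  qed
  then have "bounded {t. deriv \<psi> t \<noteq> 0}"
    by (rule bounded_subset[rotated]) (use \<psi> in \<open>auto simp: test_function_real_def intro: bounded_closure\<close>)
  ultimately show ?thesis by (simp add: test_function_real_def)
qed

lemma test_function_real_measurable:
  assumes "test_function_real \<psi>"
  shows "\<psi> \<in> borel_measurable borel"
proof -
  have "(deriv ^^ 0) \<psi> differentiable at t" for t using assms unfolding test_function_real_def by blast
  then show ?thesis
    by (intro borel_measurable_continuous_onI continuous_at_imp_continuous_on ballI differentiable_imp_continuous_within) simp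
qed

text \<open>\<open>W_infinity\<close> relates every derivative to \<open>\<sigma>\<close> directly,
  while integration by parts proceeds one order at a time. Testing order \<open>k\<close> with
  \<open>deriv \<psi>\<close> and order \<open>k + 1\<close> with \<open>\<psi>\<close> gives the
  same integral of \<open>\<sigma>\<close>; comparing both yields the relation between consecutive
  orders.\<close>

lemma W_infinity_borel_versions:
  assumes \<sigma>: "\<sigma> \<in> W_infinity m"
  shows "\<exists>h B. (\<forall>k. h k \<in> borel_measurable borel) \<and> (\<forall>k t. \<bar>h k t\<bar> \<le> B) \<and>
    (AE t in lborel. \<sigma> t = h 0 t) \<and> (\<forall>k<m. weak_derivative_pair (h k) (h (Suc k)))"
proof -
  have "\<exists>g. k \<le> m \<longrightarrow> g \<in> L_infinity \<and> (if k = 0 then g = \<sigma> else has_weak_derivative_real k \<sigma> g)" for k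
    using \<sigma> by (cases "k = 0") (auto simp: W_infinity_def)
  then obtain g where g: "\<And>k. k \<le> m \<Longrightarrow> g k \<in> L_infinity"
      "\<And>k. k \<le> m \<Longrightarrow> if k = 0 then g k = \<sigma> else has_weak_derivative_real k \<sigma> (g k)"
    by metis
  have "\<exists>h B. k \<le> m \<longrightarrow> h \<in> borel_measurable borel \<and> (\<forall>t. \<bar>h t\<bar> \<le> B) \<and> (AE t in lborel. g k t = h t)" for k
    using L_infinity_borel_version[OF g(1)] by blast
  then obtain h' B' where h': "\<And>k. k \<le> m \<Longrightarrow> h' k \<in> borel_measurable borel"
     "\<And>k t. k \<le> m \<Longrightarrow> \<bar>h' k t\<bar> \<le> B' k" "\<And>k. k \<le> m \<Longrightarrow> AE t in lborel. g k t = h' k t"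
    by metis
  \<comment> \<open>Zero beyond order \<open>m\<close>, so that measurability and one common bound
    hold for all indices.\<close>
  define h where "h k = (if k \<le> m then h' k else (\<lambda>_. 0))" for k
  define B where "B = (\<Sum>k\<le>m. \<bar>B' k\<bar>)"
  have hm: "h k \<in> borel_measurable borel" for k using h'(1) by (simp add: h_def)
  have "\<bar>h k t\<bar> \<le> B" for k t
  proof (cases "k \<le> m")
    case True
    then have "\<bar>h k t\<bar> \<le> \<bar>B' k\<bar>" using h'(2)[of k t] by (simp add: h_def)
    also have "\<dots> \<le> B" unfolding B_def using True by (intro member_le_sum) auto
    finally show ?thesis .
  qed (simp add: h_def B_def sum_nonneg)
  moreover have "AE t in lborel. \<sigma> t = h 0 t" using h'(3)[of 0] g(2)[of 0] by (simp add: h_def)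
  moreover have "weak_derivative_pair (h k) (h (Suc k))" if k: "k < m" for k
    unfolding weak_derivative_pair_def
  proof (intro allI impI)
    fix \<psi> assume \<psi>: "test_function_real \<psi>"
    have conv: "(\<integral>t. g j t * \<eta> t \<partial>lebesgue) = (\<integral>t. h j t * \<eta> t \<partial>lborel)"
      if "j \<le> m" "test_function_real \<eta>" for j \<eta>
    proof (rule integral_completion_AE)
      show "(\<lambda>t. h j t * \<eta> t) \<in> borel_measurable lborel"
        using hm[of j] test_function_real_measurable[OF that(2)] by simp
      show "AE t in lborel. g j t * \<eta> t = h j t * \<eta> t"
        using h'(3)[OF that(1)] by eventually_elim (simp add: h_def that)
    qed
    have wd: "(\<integral>t. \<sigma> t * (deriv ^^ j) \<eta> t \<partial>lebesgue) = (-1) ^ j * (\<integral>t. g j t * \<eta> t \<partial>lebesgue)"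
      if "j \<le> m" "test_function_real \<eta>" for j \<eta>
      using g(2)[OF that(1)] that(2) by (cases "j = 0") (simp_all add: has_weak_derivative_real_def)
    have "(deriv ^^ k) (deriv \<psi>) = (deriv ^^ Suc k) \<psi>" by (simp only: funpow_Suc_right o_apply)
    then have "(-1) ^ k * (\<integral>t. g k t * deriv \<psi> t \<partial>lebesgue) = (-1) ^ Suc k * (\<integral>t. g (Suc k) t * \<psi> t \<partial>lebesgue)"
      using wd[of k "deriv \<psi>"] wd[of "Suc k" \<psi>] k \<psi> test_function_real_deriv[OF \<psi>] by simp
    then have "(\<integral>t. g k t * deriv \<psi> t \<partial>lebesgue) = - (\<integral>t. g (Suc k) t * \<psi> t \<partial>lebesgue)"
      by (cases "even k") simp_all
    then show "(\<integral>t. h k t * deriv \<psi> t \<partial>lborel) = - (\<integral>t. h (Suc k) t * \<psi> t \<partial>lborel)"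
      using conv[of k "deriv \<psi>"] conv[of "Suc k" \<psi>] k \<psi> test_function_real_deriv[OF \<psi>] by simp
  qed
  ultimately show ?thesis using hm by blast
qed

lemma test_function_partial_multi:
  assumes "test_function d \<Omega> \<phi>"
  shows "test_function d \<Omega> (partial_multi d \<alpha> \<phi>)"
  unfolding partial_multi_eq_foldr
  by (rule test_function_foldr_partial[OF assms]) (auto simp: in_lists_conv_set)

text \<open>Null sets, the completion and the restriction to \<open>\<Omega>\<close> are handled
  here once: \<open>g\<close> is replaced by its representative \<open>u\<close>, and test functions
  vanish off \<open>\<Omega>\<close>, so integrals may run over the whole space.\<close>

lemma has_weak_derivativeI:
  assumes u: "u \<in> borel_measurable (lborel_Rd d)" "\<And>x. x \<in> Rd d \<Longrightarrow> \<bar>u x\<bar> \<le> Bu"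
    and v: "v \<in> borel_measurable (lborel_Rd d)" "\<And>x. x \<in> Rd d \<Longrightarrow> \<bar>v x\<bar> \<le> Bv"
    and gu: "AE x in lborel_Rd d. g x = u x"
    and parts: "\<And>\<phi>. test_function d \<Omega> \<phi> \<Longrightarrow>
      (\<integral>x. u x * partial_multi d \<alpha> \<phi> x \<partial>lborel_Rd d) = (-1) ^ (\<Sum>i<d. \<alpha> i) * (\<integral>x. v x * \<phi> x \<partial>lborel_Rd d)"
  shows "has_weak_derivative d \<Omega> \<alpha> g v"
proof -
  have loc: "locally_integrable d \<Omega> r"
    if r: "r' \<in> borel_measurable (lborel_Rd d)" "\<And>x. x \<in> Rd d \<Longrightarrow> \<bar>r' x\<bar> \<le> C" "AE x in lborel_Rd d. r x = r' x" for r r' C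
    unfolding locally_integrable_def set_integrable_def
  proof (intro allI impI)
    fix K assume "K \<subseteq> \<Omega>" and K: "compactin (Rd_topology d) K"
    have Km [measurable]: "K \<in> sets (lborel_Rd d)" by (rule compactin_Rd_sets[OF K])
    note [measurable] = r(1)
    have "integrable (lborel_Rd d) (\<lambda>x. indicator K x *\<^sub>R r' x)"
    proof (rule Bochner_Integration.integrable_bound)
      show "integrable (lborel_Rd d) (\<lambda>x. C * indicator K x)"
        using emeasure_compactin_Rd_finite[OF K] by (intro integrable_mult_right integrable_real_indicator) auto
      show "AE x in lborel_Rd d. norm (indicator K x *\<^sub>R r' x) \<le> norm (C * indicator K x)"
        using r(2) by (intro AE_I2) (force simp: space_lborel_Rd split: split_indicator)
    qed measurable
    then show "integrable (lebesgue_Rd d) (\<lambda>x. indicator K x *\<^sub>R r x)"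
      by (subst integrable_lebesgue_Rd_AE[where v="\<lambda>x. indicator K x *\<^sub>R r' x"]) (use r(3) in auto)
  qed
  have int: "(LINT x:\<Omega>|lebesgue_Rd d. r x * \<psi> x) = (\<integral>x. r' x * \<psi> x \<partial>lborel_Rd d)"
    if r: "r' \<in> borel_measurable (lborel_Rd d)" "AE x in lborel_Rd d. r x = r' x" and \<psi>: "test_function d \<Omega> \<psi>" for r r' \<psi>
    unfolding set_lebesgue_integral_def
  proof (rule integral_lebesgue_Rd_AE)
    show "(\<lambda>x. r' x * \<psi> x) \<in> borel_measurable (lborel_Rd d)"
      using r(1) test_function_measurable[OF \<psi>] by simp
    have z: "x \<in> Rd d \<Longrightarrow> x \<notin> \<Omega> \<Longrightarrow> \<psi> x = 0" for x
      using \<psi> unfolding test_function_def by blast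
    show "AE x in lborel_Rd d. indicator \<Omega> x *\<^sub>R (r x * \<psi> x) = r' x * \<psi> x"
      using r(2) AE_space by eventually_elim (auto simp: z space_lborel_Rd split: split_indicator)
  qed
  show ?thesis unfolding has_weak_derivative_def
  proof (intro conjI allI impI)
    show "locally_integrable d \<Omega> g" by (rule loc[OF u gu])
    show "locally_integrable d \<Omega> v" by (rule loc[OF v AE_I2[OF refl]])
    fix \<phi> assume \<phi>: "test_function d \<Omega> \<phi>"
    show "(LINT x:\<Omega>|lebesgue_Rd d. g x * partial_multi d \<alpha> \<phi> x) = (-1) ^ (\<Sum>i<d. \<alpha> i) * (LINT x:\<Omega>|lebesgue_Rd d. v x * \<phi> x)"
      using parts[OF \<phi>] int[OF u(1) gu test_function_partial_multi[OF \<phi>]] int[OF v(1) AE_I2[OF refl] \<phi>] by simp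
  qed
qed

lemma bounded_domain_finite_measure:
  assumes "bounded_domain d \<Omega>"
  shows "\<Omega> \<in> sets (lborel_Rd d)" "emeasure (lborel_Rd d) \<Omega> < \<infinity>"
proof -
  have op: "openin (Rd_topology d) \<Omega>" using assms by (simp add: bounded_domain_def)
  then show "\<Omega> \<in> sets (lborel_Rd d)" by (rule openin_Rd_sets)
  obtain B where B: "\<forall>x\<in>\<Omega>. norm_Rd d x \<le> B" using assms by (auto simp: bounded_domain_def)
  have "\<Omega> \<subseteq> cbox_Rd d (\<lambda>_. - B) (\<lambda>_. B)"
  proof
    fix x assume x: "x \<in> \<Omega>"
    have "\<bar>x i\<bar> \<le> B" if "i < d" for i using abs_component_le_norm_Rd[OF that, of x] B x by fastforce
    moreover have "x \<in> Rd d" using openin_subset[OF op] x by (auto simp: topspace_Rd_topology)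
    ultimately show "x \<in> cbox_Rd d (\<lambda>_. - B) (\<lambda>_. B)"
      by (auto simp: cbox_Rd_def Rd_def PiE_iff abs_le_iff minus_le_iff)
  qed
  then show "emeasure (lborel_Rd d) \<Omega> < \<infinity>"
    using emeasure_mono[OF _ cbox_Rd_sets] emeasure_cbox_Rd_finite order_le_less_trans by metis
qed

text \<open>Uniqueness replaces the chosen derivatives by the explicit \<open>v \<alpha>\<close>;
  these are bounded and \<open>\<Omega>\<close> has finite measure, so their squares are
  integrable.\<close>

lemma sobolev_norm_eq:
  assumes \<Omega>: "bounded_domain d \<Omega>"
    and wd: "\<And>\<alpha>. \<alpha> \<in> multi_indices d m \<Longrightarrow> has_weak_derivative d \<Omega> \<alpha> g (v \<alpha>)"
    and v: "\<And>\<alpha>. \<alpha> \<in> multi_indices d m \<Longrightarrow> v \<alpha> \<in> borel_measurable (lborel_Rd d)"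
      "\<And>\<alpha> x. \<alpha> \<in> multi_indices d m \<Longrightarrow> x \<in> Rd d \<Longrightarrow> \<bar>v \<alpha> x\<bar> \<le> C"
  shows "sobolev_norm d \<Omega> m g = ennreal (sqrt (\<Sum>\<alpha>\<in>multi_indices d m. \<integral>x. indicator \<Omega> x * (v \<alpha> x)\<^sup>2 \<partial>lborel_Rd d))"
proof -
  have op: "openin (Rd_topology d) \<Omega>" using \<Omega> by (simp add: bounded_domain_def)
  note \<Omega>m [measurable] = bounded_domain_finite_measure(1)[OF \<Omega>]
  have AE: "AE x in lborel_Rd d. indicator \<Omega> x *\<^sub>R (weak_derivative d \<Omega> \<alpha> g x)\<^sup>2 = indicator \<Omega> x * (v \<alpha> x)\<^sup>2"
    if "\<alpha> \<in> multi_indices d m" for \<alpha>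
  proof -
    have "has_weak_derivative d \<Omega> \<alpha> g (weak_derivative d \<Omega> \<alpha> g)"
      unfolding weak_derivative_def by (rule someI[of _ "v \<alpha>"]) (rule wd[OF that])
    from weak_derivative_unique[OF op this wd[OF that]] show ?thesis
      by eventually_elim (auto split: split_indicator)
  qed
  have m: "(\<lambda>x. indicator \<Omega> x * (v \<alpha> x)\<^sup>2) \<in> borel_measurable (lborel_Rd d)" if "\<alpha> \<in> multi_indices d m" for \<alpha>
    using v(1)[OF that] by measurable
  have int: "integrable (lborel_Rd d) (\<lambda>x. indicator \<Omega> x * (v \<alpha> x)\<^sup>2)" if \<alpha>: "\<alpha> \<in> multi_indices d m" for \<alpha>
  proof (rule Bochner_Integration.integrable_bound[OF _ m[OF \<alpha>]])
    show "integrable (lborel_Rd d) (\<lambda>x. C\<^sup>2 * indicator \<Omega> x)"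
      using bounded_domain_finite_measure[OF \<Omega>] by (intro integrable_mult_right integrable_real_indicator)
    have "\<bar>v \<alpha> x\<bar>\<^sup>2 \<le> C\<^sup>2" if "x \<in> Rd d" for x using v(2)[OF \<alpha> that] by (intro power_mono) auto
    then show "AE x in lborel_Rd d. norm (indicator \<Omega> x * (v \<alpha> x)\<^sup>2) \<le> norm (C\<^sup>2 * indicator \<Omega> x)"
      by (intro AE_I2) (auto simp: space_lborel_Rd split: split_indicator)
  qed
  have "in_sobolev d \<Omega> m g"
    unfolding in_sobolev_def set_integrable_def
    using wd int integrable_lebesgue_Rd_AE[OF m AE] by blast
  moreover have "(\<Sum>\<alpha>\<in>multi_indices d m. LINT x:\<Omega>|lebesgue_Rd d. (weak_derivative d \<Omega> \<alpha> g x)\<^sup>2) =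
      (\<Sum>\<alpha>\<in>multi_indices d m. \<integral>x. indicator \<Omega> x * (v \<alpha> x)\<^sup>2 \<partial>lborel_Rd d)"
    unfolding set_lebesgue_integral_def by (intro sum.cong refl integral_lebesgue_Rd_AE m AE)
  ultimately show ?thesis by (simp add: sobolev_norm_def)
qed

lemma tempered_function_borel_version:
  assumes "tempered_function d g"
  shows "\<exists>G\<in>borel_measurable (lborel_Rd d). AE \<omega> in lborel_Rd d. g \<omega> = G \<omega>"
proof -
  obtain k where "integrable (lebesgue_Rd d) (\<lambda>x. g x / complex_of_real ((1 + norm_Rd d x) ^ k))"
    using assms unfolding tempered_function_def by blast
  then have m: "(\<lambda>x. g x / complex_of_real ((1 + norm_Rd d x) ^ k)) \<in> borel_measurable (lebesgue_Rd d)" by auto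
  have [measurable]: "norm_Rd d \<in> borel_measurable (lebesgue_Rd d)"
    by (rule measurable_lebesgue_Rd) measurable
  have "(\<lambda>x. (g x / complex_of_real ((1 + norm_Rd d x) ^ k)) * complex_of_real ((1 + norm_Rd d x) ^ k)) \<in> borel_measurable (lebesgue_Rd d)"
    by (intro borel_measurable_times m) measurable
  moreover have "(g x / complex_of_real ((1 + norm_Rd d x) ^ k)) * complex_of_real ((1 + norm_Rd d x) ^ k) = g x" for x
  proof -
    have "0 < 1 + norm_Rd d x" using norm_Rd_nonneg[of d x] by linarith
    then have "(1 + norm_Rd d x) ^ k \<noteq> 0" by simp
    then have "complex_of_real ((1 + norm_Rd d x) ^ k) \<noteq> 0" by (simp only: of_real_eq_0_iff not_False_eq_True)
    then show ?thesis by (metis nonzero_mult_div_cancel_right times_divide_eq_left)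
  qed
  ultimately have "g \<in> borel_measurable (lebesgue_Rd d)" by (simp only:)
  then show ?thesis by (rule lebesgue_Rd_borel_version_complex)
qed

text \<open>Derivatives of a ridge function grow with \<open>\<omega>\<close> like a power of degree
  at most \<open>m\<close>, and the assumption on \<open>amp\<close> forces the matching decay. By
  \<open>sum_multi_indices_le\<close> the squared monomials add up to at most
  \<open>(1 + cs^2 * |\<omega>|^2)^m\<close>, which keeps the bound free of
  \<open>d\<close>.\<close>

lemma sum_squares_ridge_le:
  fixes h :: "nat \<Rightarrow> real"
  assumes hB: "\<And>k. \<bar>h k\<bar> \<le> B"
    and A: "\<bar>amp\<bar> * (1 + norm_Rd d \<omega>) ^ m \<le> A"
  shows "(\<Sum>\<alpha>\<in>multi_indices d m. (amp * (\<Prod>i<d. (cs * \<omega> i) ^ \<alpha> i) * h (\<Sum>i<d. \<alpha> i))\<^sup>2)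
    \<le> (A * B * (1 + \<bar>cs\<bar>) ^ m)\<^sup>2"
proof -
  let ?r = "norm_Rd d \<omega>"
  have B: "0 \<le> B" using hB[of 0] abs_ge_zero[of "h 0"] by linarith
  have r: "0 \<le> ?r" by simp
  have "0 \<le> \<bar>amp\<bar> * (1 + ?r) ^ m" using r by simp
  then have A0: "0 \<le> A" using A by linarith
  have "(\<Sum>\<alpha>\<in>multi_indices d m. (amp * (\<Prod>i<d. (cs * \<omega> i) ^ \<alpha> i) * h (\<Sum>i<d. \<alpha> i))\<^sup>2)
      \<le> (\<Sum>\<alpha>\<in>multi_indices d m. (\<bar>amp\<bar> * B)\<^sup>2 * (\<Prod>i<d. ((cs * \<omega> i)\<^sup>2) ^ \<alpha> i))"
  proof (rule sum_mono)
    fix \<alpha> assume "\<alpha> \<in> multi_indices d m"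
    have "(amp * (\<Prod>i<d. (cs * \<omega> i) ^ \<alpha> i) * h (\<Sum>i<d. \<alpha> i))\<^sup>2 =
        (\<bar>amp\<bar> * \<bar>h (\<Sum>i<d. \<alpha> i)\<bar>)\<^sup>2 * (\<Prod>i<d. ((cs * \<omega> i)\<^sup>2) ^ \<alpha> i)"
      by (simp only: power_mult_distrib power2_abs prod_power_distrib power_mult[symmetric] mult.commute[of 2] mult_ac)
    also have "\<dots> \<le> (\<bar>amp\<bar> * B)\<^sup>2 * (\<Prod>i<d. ((cs * \<omega> i)\<^sup>2) ^ \<alpha> i)"
      by (intro mult_right_mono power_mono mult_left_mono hB prod_nonneg) auto
    finally show "(amp * (\<Prod>i<d. (cs * \<omega> i) ^ \<alpha> i) * h (\<Sum>i<d. \<alpha> i))\<^sup>2 \<le> (\<bar>amp\<bar> * B)\<^sup>2 * (\<Prod>i<d. ((cs * \<omega> i)\<^sup>2) ^ \<alpha> i)" .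
  qed
  also have "\<dots> = (\<bar>amp\<bar> * B)\<^sup>2 * (\<Sum>\<alpha>\<in>multi_indices d m. \<Prod>i<d. ((cs * \<omega> i)\<^sup>2) ^ \<alpha> i)"
    by (rule sum_distrib_left[symmetric])
  also have "\<dots> \<le> (\<bar>amp\<bar> * B)\<^sup>2 * (1 + (\<Sum>i<d. (cs * \<omega> i)\<^sup>2)) ^ m"
    by (intro mult_left_mono sum_multi_indices_le) auto
  also have "\<dots> \<le> (\<bar>amp\<bar> * B)\<^sup>2 * (((1 + \<bar>cs\<bar>) * (1 + ?r))\<^sup>2) ^ m"
  proof (intro mult_left_mono power_mono)
    have "?r\<^sup>2 = (\<Sum>i<d. \<omega> i * \<omega> i)"
      by (simp add: norm_Rd_def dot_def sum_nonneg)
    moreover have "(cs * \<omega> i)\<^sup>2 = cs\<^sup>2 * (\<omega> i * \<omega> i)" for i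
      by (simp only: power2_eq_square mult_ac)
    ultimately have "(\<Sum>i<d. (cs * \<omega> i)\<^sup>2) = (\<bar>cs\<bar> * ?r)\<^sup>2"
      by (simp only: power_mult_distrib power2_abs sum_distrib_left)
    moreover have "1 + (\<bar>cs\<bar> * ?r)\<^sup>2 \<le> (1 + \<bar>cs\<bar> * ?r)\<^sup>2"
      using r by (simp add: power2_sum)
    moreover have "(1 + \<bar>cs\<bar> * ?r)\<^sup>2 \<le> ((1 + \<bar>cs\<bar>) * (1 + ?r))\<^sup>2"
      using r by (intro power_mono) (auto simp: algebra_simps)
    ultimately show "1 + (\<Sum>i<d. (cs * \<omega> i)\<^sup>2) \<le> ((1 + \<bar>cs\<bar>) * (1 + ?r))\<^sup>2" by linarith
  qed (simp_all add: add_nonneg_nonneg sum_nonneg)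
  also have "\<dots> = (\<bar>amp\<bar> * (1 + ?r) ^ m * B * (1 + \<bar>cs\<bar>) ^ m)\<^sup>2"
    by (simp only: power_mult_distrib power_mult[symmetric] mult.commute[of 2] mult_ac)
  also have "\<dots> \<le> (A * B * (1 + \<bar>cs\<bar>) ^ m)\<^sup>2"
    using B r by (intro power_mono mult_right_mono A) auto
  finally show ?thesis .
qed

lemma integrable_if_weighted_integral_finite:
  fixes G :: "(nat \<Rightarrow> real) \<Rightarrow> complex"
  assumes [measurable]: "G \<in> borel_measurable (lborel_Rd d)"
    and fin: "(\<integral>\<^sup>+\<omega>. ennreal ((1 + norm_Rd d \<omega>) ^ m * cmod (G \<omega>)) \<partial>lborel_Rd d) < \<infinity>"
  shows "integrable (lborel_Rd d) G"
proof (rule integrableI_bounded)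
  have "(\<integral>\<^sup>+\<omega>. ennreal (cmod (G \<omega>)) \<partial>lborel_Rd d) \<le> (\<integral>\<^sup>+\<omega>. ennreal ((1 + norm_Rd d \<omega>) ^ m * cmod (G \<omega>)) \<partial>lborel_Rd d)"
  proof (intro nn_integral_mono ennreal_leI)
    fix \<omega>
    have "1 \<le> (1 + norm_Rd d \<omega>) ^ m" using norm_Rd_nonneg[of d \<omega>] by (intro one_le_power) linarith
    from mult_right_mono[OF this, of "cmod (G \<omega>)"]
    show "cmod (G \<omega>) \<le> (1 + norm_Rd d \<omega>) ^ m * cmod (G \<omega>)" by simp
  qed
  also have "\<dots> < \<infinity>" by (rule fin)
  finally show "(\<integral>\<^sup>+\<omega>. ennreal (cmod (G \<omega>)) \<partial>lborel_Rd d) < \<infinity>" .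
qed measurable

text \<open>A sample is a pair \<open>z\<close> of frequency and bias; the family
  \<open>Y \<alpha> z\<close> collects a random neuron and its weak derivatives, and its mean
  \<open>F\<close> collects those of \<open>f\<close>. Positivity of \<open>M\<close> lets the
  weighted transform be normalised to a probability density.\<close>

lemma network_approximation:
  fixes h :: "nat \<Rightarrow> real \<Rightarrow> real" and G :: "(nat \<Rightarrow> real) \<Rightarrow> complex"
  assumes T: "0 < T" and hm [measurable]: "\<And>k. h k \<in> borel_measurable borel" and hB: "\<And>k t. \<bar>h k t\<bar> \<le> B"
    and \<sigma>h: "AE t in lborel. \<sigma> t = h 0 t" and per: "\<And>t. \<sigma> (t + T) = \<sigma> t"
    and pair: "\<And>k. k < m \<Longrightarrow> weak_derivative_pair (h k) (h (Suc k))"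
    and k: "k \<noteq> 0" and c0: "fourier_coeff T (h 0) k \<noteq> 0"
    and \<Omega>: "bounded_domain d \<Omega>"
    and Gm [measurable]: "G \<in> borel_measurable (lborel_Rd d)"
    and M: "(\<integral>\<^sup>+\<omega>. ennreal ((1 + norm_Rd d \<omega>) ^ m * cmod (G \<omega>)) \<partial>lborel_Rd d) = ennreal M" "0 < M"
    and fG: "AE x in lborel_Rd d. f x = Re (\<integral>\<omega>. G \<omega> * cis (dot d \<omega> x) \<partial>lborel_Rd d)"
    and n: "1 \<le> n"
    and C: "C = T * B * (1 + \<bar>1 / (of_int k * (2 * pi / T))\<bar>) ^ m / cmod (fourier_coeff T (h 0) k)"
  shows "\<exists>g\<in>shallow_networks d n \<sigma>. sobolev_norm d \<Omega> m (\<lambda>x. f x - g x)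
    \<le> ennreal (sqrt (measure (lborel_Rd d) \<Omega>) * (M * C) / sqrt (real n))"
proof -
  let ?N = "lborel_Rd d"
  define c where "c = fourier_coeff T (h 0) k"
  define a where "a = of_int k * (2 * pi / T)"
  \<comment> \<open>Chosen with \<open>- a * cs = 1\<close>: translating by
    \<open>cs * dot d \<omega> x\<close> turns the Fourier coefficient \<open>c\<close> into
    \<open>c * cis (dot d \<omega> x)\<close>.\<close>
  define cs where "cs = - 1 / a"
  have a: "a \<noteq> 0" using k T by (simp add: a_def)
  have cpos: "0 < cmod c" using c0 by (simp add: c_def)
  have Ccs: "C = T * B * (1 + \<bar>cs\<bar>) ^ m / cmod c" by (simp add: C cs_def a_def c_def)
  have B: "0 \<le> B" using hB[of 0 0] abs_ge_zero[of "h 0 0"] by linarith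
  interpret NL: pair_sigma_finite ?N "lborel :: real measure" by standard
  let ?Z = "?N \<Otimes>\<^sub>M (lborel :: real measure)"
  interpret ZN: pair_sigma_finite ?Z ?N
    by (intro pair_sigma_finite.intro lborel_Rd_sigma.sigma_finite_measure_axioms NL.sigma_finite_measure_axioms)
  define W where "W \<omega> = (1 + norm_Rd d \<omega>) ^ m" for \<omega>
  have Wpos: "0 < W \<omega>" for \<omega> using norm_Rd_nonneg[of d \<omega>] unfolding W_def by (intro zero_less_power) linarith
  have [measurable]: "W \<in> borel_measurable ?N" unfolding W_def[abs_def] by measurable
  have Gi: "integrable ?N G"
    by (rule integrable_if_weighted_integral_finite[OF Gm, of m]) (simp add: M(1))
  \<comment> \<open>The law of the frequency has density \<open>W * |G| / M\<close>, normalised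
    since \<open>M\<close> is the weighted integral of \<open>G\<close>; the bias is independent and
    uniform on a period, which gives the factor \<open>1 / T\<close>.\<close>
  define dens where "dens z = W (fst z) * cmod (G (fst z)) * indicator {0..T} (snd z) / (M * T)" for z :: "(nat \<Rightarrow> real) \<times> real"
  have dens0: "0 \<le> dens z" for z
    using Wpos[of "fst z"] M(2) T by (simp add: dens_def)
  have densm [measurable]: "dens \<in> borel_measurable ?Z" unfolding dens_def[abs_def] by measurable
  define P where "P = density ?Z (\<lambda>z. ennreal (dens z))"
  have setsP [measurable_cong]: "sets P = sets ?Z" and spaceP: "space P = space ?Z" by (simp_all add: P_def)
  have "prob_space P"
  proof
    have "emeasure P (space P) = (\<integral>\<^sup>+z. ennreal (dens z) * indicator (space ?Z) z \<partial>?Z)"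
      unfolding P_def space_density by (rule emeasure_density[OF _ sets.top]) measurable
    also have "\<dots> = (\<integral>\<^sup>+z. ennreal (dens z) \<partial>?Z)"
      by (intro nn_integral_cong) simp
    also have "\<dots> = (\<integral>\<^sup>+\<omega>. \<integral>\<^sup>+b. ennreal (dens (\<omega>, b)) \<partial>lborel \<partial>?N)"
      by (rule lborel.nn_integral_fst[symmetric]) measurable
    also have "\<dots> = (\<integral>\<^sup>+\<omega>. ennreal (W \<omega> * cmod (G \<omega>)) * ennreal (1 / M) \<partial>?N)"
    proof (rule nn_integral_cong)
      fix \<omega>
      have q: "0 \<le> W \<omega> * cmod (G \<omega>) / (M * T)" using Wpos[of \<omega>] M(2) T by simp
      have "ennreal (dens (\<omega>, b)) = ennreal (W \<omega> * cmod (G \<omega>) / (M * T)) * indicator {0..T} b" for b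
        by (simp add: dens_def split: split_indicator)
      then have "(\<integral>\<^sup>+b. ennreal (dens (\<omega>, b)) \<partial>lborel) = ennreal (W \<omega> * cmod (G \<omega>) / (M * T)) * ennreal T"
        using T by (simp add: nn_integral_cmult emeasure_lborel_Icc_eq)
      also have "\<dots> = ennreal (W \<omega> * cmod (G \<omega>) / (M * T) * T)" using q T by (intro ennreal_mult[symmetric]) simp_all
      also have "W \<omega> * cmod (G \<omega>) / (M * T) * T = W \<omega> * cmod (G \<omega>) * (1 / M)" using T by simp
      also have "ennreal \<dots> = ennreal (W \<omega> * cmod (G \<omega>)) * ennreal (1 / M)"
        using Wpos[of \<omega>] M(2) by (intro ennreal_mult) auto
      finally show "(\<integral>\<^sup>+b. ennreal (dens (\<omega>, b)) \<partial>lborel) = ennreal (W \<omega> * cmod (G \<omega>)) * ennreal (1 / M)" .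
    qed
    also have "\<dots> = ennreal M * ennreal (1 / M)"
      by (subst nn_integral_multc) (simp_all add: M(1)[folded W_def])
    also have "\<dots> = 1" using M(2) by (simp flip: ennreal_mult)
    finally show "emeasure P (space P) = 1" .
  qed
  then interpret P: prob_space P .
  \<comment> \<open>Where \<open>G\<close> vanishes, so does \<open>\<rho>\<close>, because \<open>x / 0 = 0\<close>.\<close>
  define \<rho> where "\<rho> z = Re (G (fst z) / c * cis (a * snd z)) / cmod (G (fst z))" for z :: "(nat \<Rightarrow> real) \<times> real"
  \<comment> \<open>Importance weight: \<open>dens z * amp z\<close> is the indicator of the period
    times the real part of \<open>G / c * cis (a * b)\<close>, the integrand to be reproduced. The
    division by \<open>W\<close> pays for the growth of the derivatives in the frequency.\<close>
  define amp where "amp z = M * T * \<rho> z / W (fst z)" for z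
  define Y where "Y \<alpha> z x = amp z * (\<Prod>i<d. (cs * fst z i) ^ \<alpha> i) * h (\<Sum>i<d. \<alpha> i) (cs * dot d (fst z) x + snd z)"
    for \<alpha> :: "nat \<Rightarrow> nat" and z :: "(nat \<Rightarrow> real) \<times> real" and x :: "nat \<Rightarrow> real"
  define K where "K = M * C"
  have \<rho>: "\<bar>\<rho> z\<bar> \<le> 1 / cmod c" for z
  proof (cases "G (fst z) = 0")
    case False
    have "\<bar>Re (G (fst z) / c * cis (a * snd z))\<bar> \<le> cmod (G (fst z) / c * cis (a * snd z))" by (rule abs_Re_le_cmod)
    also have "\<dots> = cmod (G (fst z)) / cmod c" by (simp add: norm_mult norm_divide)
    finally show ?thesis using False cpos by (simp add: \<rho>_def abs_divide divide_simps mult.commute)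
  qed (simp add: \<rho>_def)
  have ampW: "\<bar>amp z\<bar> * W (fst z) \<le> M * T / cmod c" for z
  proof -
    have "\<bar>amp z\<bar> * W (fst z) = M * T * \<bar>\<rho> z\<bar>"
      using Wpos[of "fst z"] M(2) T by (simp add: amp_def abs_mult abs_divide)
    also have "\<dots> \<le> M * T * (1 / cmod c)" using \<rho>[of z] M(2) T by (intro mult_left_mono) auto
    finally show ?thesis by simp
  qed
  have YK: "(\<Sum>\<alpha>\<in>multi_indices d m. (Y \<alpha> z x)\<^sup>2) \<le> K\<^sup>2" for z x
    using sum_squares_ridge_le[of "\<lambda>j. h j (cs * dot d (fst z) x + snd z)" B "amp z" d "fst z" m "M * T / cmod c" cs,
        OF hB ampW[unfolded W_def]]
    by (simp add: Y_def K_def Ccs mult_ac)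
  have Y1: "\<bar>Y \<alpha> z x\<bar> \<le> \<bar>K\<bar>" if "\<alpha> \<in> multi_indices d m" for \<alpha> z x
  proof -
    have "(Y \<alpha> z x)\<^sup>2 \<le> (\<Sum>\<alpha>\<in>multi_indices d m. (Y \<alpha> z x)\<^sup>2)"
      using that finite_multi_indices by (intro member_le_sum) auto
    also have "\<dots> \<le> K\<^sup>2" by (rule YK)
    finally show ?thesis by (simp add: abs_le_square_iff)
  qed
  have ampm [measurable]: "amp \<in> borel_measurable ?Z" unfolding amp_def[abs_def] \<rho>_def by measurable
  have Ym0: "(\<lambda>p. Y \<alpha> (fst p) (snd p)) \<in> borel_measurable (?Z \<Otimes>\<^sub>M ?N)" for \<alpha>
  proof -
    have [measurable]: "(\<lambda>p. fst (fst p) i) \<in> borel_measurable (?Z \<Otimes>\<^sub>M ?N)" if "i < d" for i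
    proof -
      have "(\<lambda>p. fst (fst p)) \<in> ?Z \<Otimes>\<^sub>M ?N \<rightarrow>\<^sub>M ?N" by measurable
      from measurable_compose[OF this measurable_component_singleton[of i "{..<d}"]] that show ?thesis by simp
    qed
    show ?thesis unfolding Y_def by measurable
  qed
  have Ym: "(\<lambda>(z, x). Y \<alpha> z x) \<in> borel_measurable (P \<Otimes>\<^sub>M ?N)" for \<alpha>
    using Ym0[of \<alpha>] by (simp add: split_beta' measurable_cong_sets[OF sets_pair_measure_cong[OF setsP refl] refl])
  have Yx: "(\<lambda>z. Y \<alpha> z x) \<in> borel_measurable ?Z" if "x \<in> Rd d" for \<alpha> x
    using measurable_compose[OF measurable_Pair2'[of x ?N ?Z] Ym0[of \<alpha>]] that by (simp add: space_lborel_Rd)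
  have Yz: "Y \<alpha> z \<in> borel_measurable ?N" if "z \<in> space P" for \<alpha> z
    using measurable_compose[OF measurable_Pair1'[of z ?Z ?N] Ym0[of \<alpha>]] that by (simp add: spaceP)
  define F where "F \<alpha> x = (\<integral>z. Y \<alpha> z x \<partial>P)" for \<alpha> x
  have Fm [measurable]: "F \<alpha> \<in> borel_measurable ?N" for \<alpha>
  proof -
    have "(\<lambda>(x, z). Y \<alpha> z x) \<in> borel_measurable (?N \<Otimes>\<^sub>M P)"
      using measurable_compose[OF measurable_pair_swap' Ym[of \<alpha>]] by (simp add: split_beta)
    then show ?thesis unfolding F_def[abs_def] by (rule P.borel_measurable_lebesgue_integral)
  qed
  have FK: "\<bar>F \<alpha> x\<bar> \<le> \<bar>K\<bar>" if \<alpha>: "\<alpha> \<in> multi_indices d m" and x: "x \<in> Rd d" for \<alpha> x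
  proof -
    have [measurable]: "(\<lambda>z. Y \<alpha> z x) \<in> borel_measurable P"
      using Yx[OF x] by (simp add: measurable_cong_sets[OF setsP refl])
    have "\<bar>F \<alpha> x\<bar> \<le> (\<integral>z. \<bar>Y \<alpha> z x\<bar> \<partial>P)" unfolding F_def by (rule integral_abs_bound)
    also have "\<dots> \<le> (\<integral>z. \<bar>K\<bar> \<partial>P)"
      by (rule integral_mono) (use Y1[OF \<alpha>] in \<open>auto intro!: P.integrable_const_bound[where B="\<bar>K\<bar>"]\<close>)
    finally show ?thesis by (simp add: P.prob_space)
  qed
  let ?o = "\<lambda>_::nat. 0::nat"
  have o: "?o \<in> multi_indices d m" by (simp add: multi_indices_def)

  \<comment> \<open>Only the mean of order zero is evaluated; \<open>Fparts\<close> identifies the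
    others as its weak derivatives.\<close>
  have F0: "F ?o x = Re (\<integral>\<omega>. G \<omega> * cis (dot d \<omega> x) \<partial>?N)" if x: "x \<in> Rd d" for x
  proof -
    let ?g = "\<lambda>b. complex_of_real (indicator {0..T} b)"
    let ?k = "\<lambda>\<omega> b. complex_of_real (h 0 (cs * dot d \<omega> x + b)) * cis (a * b)"
    have [measurable]: "(\<lambda>\<omega>. dot d \<omega> x) \<in> borel_measurable ?N"
      using x by (intro measurable_dot measurable_ident_sets measurable_const) (auto simp: space_lborel_Rd)
    have Ei: "integrable ?Z (\<lambda>(\<omega>, b). (G \<omega> / c) * ?g b * ?k \<omega> b)"
    proof (rule NL.integrable_times_bounded_kernel[where C=B])
      show "integrable ?N (\<lambda>\<omega>. G \<omega> / c)" using Gi by simp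
      show "integrable lborel ?g"
        by (intro integrable_of_real integrable_real_indicator) (auto simp: emeasure_lborel_Icc_eq)
      show "(\<lambda>(\<omega>, b). ?k \<omega> b) \<in> borel_measurable ?Z" unfolding split_beta' by measurable
      show "cmod (?k \<omega> b) \<le> B" for \<omega> b using hB by (simp add: norm_mult)
    qed
    have Re_of_real_mult: "Re (complex_of_real r * q) = r * Re q" for r q by simp
    have eq: "dens z *\<^sub>R Y ?o z x = Re (case z of (\<omega>, b) \<Rightarrow> (G \<omega> / c) * ?g b * ?k \<omega> b)" for z
    proof -
      obtain \<omega> b where z: "z = (\<omega>, b)" by fastforce
      let ?q = "G \<omega> / c * cis (a * b)" and ?i = "indicator {0..T} b :: real" and ?h = "h 0 (cs * dot d \<omega> x + b)"
      have "dens z *\<^sub>R Y ?o z x = dens z * amp z * ?h" by (simp add: Y_def z mult.assoc)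
      also have "dens z * amp z = ?i * Re ?q"
        using Wpos[of \<omega>] M(2) T by (cases "G \<omega> = 0") (simp_all add: dens_def amp_def \<rho>_def z)
      also have "?i * Re ?q * ?h = Re (complex_of_real (?i * ?h) * ?q)"
        by (subst Re_of_real_mult) (simp only: mult_ac)
      also have "complex_of_real (?i * ?h) * ?q = (G \<omega> / c) * ?g b * ?k \<omega> b"
        by (simp only: of_real_mult mult_ac)
      finally show ?thesis by (simp only: z prod.case)
    qed
    have "F ?o x = (\<integral>z. dens z *\<^sub>R Y ?o z x \<partial>?Z)"
      unfolding F_def P_def using Yx[OF x] dens0 by (intro integral_density) auto
    also have "\<dots> = Re (integral\<^sup>L ?Z (\<lambda>(\<omega>, b). (G \<omega> / c) * ?g b * ?k \<omega> b))"
      unfolding eq by (rule integral_Re[OF Ei])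
    also have "integral\<^sup>L ?Z (\<lambda>(\<omega>, b). (G \<omega> / c) * ?g b * ?k \<omega> b) = (\<integral>\<omega>. (\<integral>b. (G \<omega> / c) * ?g b * ?k \<omega> b \<partial>lborel) \<partial>?N)"
      by (rule NL.integral_fst[OF Ei, symmetric])
    also have "\<dots> = (\<integral>\<omega>. G \<omega> * cis (dot d \<omega> x) \<partial>?N)"
    proof (intro Bochner_Integration.integral_cong refl)
      fix \<omega>
      have perh: "AE t in lborel. h 0 (t + T) = h 0 t"
        using \<sigma>h AE_lborel_translate[OF \<sigma>h, of T]
        by eventually_elim (metis per add.commute)
      have "(\<integral>b. (G \<omega> / c) * ?g b * ?k \<omega> b \<partial>lborel) =
          (\<integral>b. (G \<omega> / c) * (complex_of_real (indicator {0..T} b * h 0 (cs * dot d \<omega> x + b)) * cis (of_int k * (2 * pi / T * b))) \<partial>lborel)"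
        by (simp add: a_def mult_ac)
      also have "\<dots> = (G \<omega> / c) * (cis (- (of_int k * (2 * pi / T * (cs * dot d \<omega> x)))) * c)"
        unfolding integral_mult_right_zero fourier_coeff_translate[OF T hm hB perh] c_def ..
      also have "of_int k * (2 * pi / T * (cs * dot d \<omega> x)) = a * cs * dot d \<omega> x" by (simp add: a_def)
      also have "a * cs = - 1" using a by (simp add: cs_def)
      also have "(G \<omega> / c) * (cis (- (- 1 * dot d \<omega> x)) * c) = G \<omega> * cis (dot d \<omega> x)" using cpos by simp
      finally show "(\<integral>b. (G \<omega> / c) * ?g b * ?k \<omega> b \<partial>lborel) = G \<omega> * cis (dot d \<omega> x)" .
    qed
    finally show ?thesis .
  qed

  have ridge: "(\<integral>x. Y ?o z x * partial_multi d \<alpha> \<phi> x \<partial>?N) = (-1) ^ (\<Sum>i<d. \<alpha> i) * (\<integral>x. Y \<alpha> z x * \<phi> x \<partial>?N)"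
    if \<alpha>: "\<alpha> \<in> multi_indices d m" and \<phi>: "test_function d \<Omega> \<phi>" for \<alpha> \<phi> z
  proof -
    \<comment> \<open>Elements of \<open>Rd d\<close> are extensional, hence the restriction; on the
      coordinates below \<open>d\<close> this is the inner weight.\<close>
    define w where "w = restrict (\<lambda>i. cs * fst z i) {..<d}"
    have w: "w \<in> Rd d" by (simp add: w_def Rd_def)
    have dw: "cs * dot d (fst z) x = dot d w x" for x
      by (simp add: dot_def w_def sum_distrib_left mult.assoc)
    have pw: "(\<Prod>i<d. (cs * fst z i) ^ \<alpha> i) = (\<Prod>i<d. w i ^ \<alpha> i)" by (simp add: w_def)
    have "(\<integral>x. Y ?o z x * partial_multi d \<alpha> \<phi> x \<partial>?N) = amp z * (\<integral>x. h 0 (dot d w x + snd z) * partial_multi d \<alpha> \<phi> x \<partial>?N)"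
      unfolding Y_def dw by (simp add: mult.assoc)
    also have "\<dots> = amp z * ((-1) ^ (\<Sum>i<d. \<alpha> i) * (\<Prod>i<d. w i ^ \<alpha> i) * (\<integral>x. h (\<Sum>i<d. \<alpha> i) (dot d w x + snd z) * \<phi> x \<partial>?N))"
      by (subst ridge_integration_by_parts[where h=h and m=m and B=B, OF pair hm hB w \<phi> \<alpha>]) auto
    also have "\<dots> = (-1) ^ (\<Sum>i<d. \<alpha> i) * (\<integral>x. (amp z * (\<Prod>i<d. w i ^ \<alpha> i)) * (h (\<Sum>i<d. \<alpha> i) (dot d w x + snd z) * \<phi> x) \<partial>?N)"
      unfolding integral_mult_right_zero by (simp only: mult_ac)
    also have "\<dots> = (-1) ^ (\<Sum>i<d. \<alpha> i) * (\<integral>x. Y \<alpha> z x * \<phi> x \<partial>?N)"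
      unfolding Y_def dw pw by (simp only: mult.assoc)
    finally show ?thesis .
  qed

  interpret PN: pair_sigma_finite P ?N by standard
  have Yint: "integrable (P \<Otimes>\<^sub>M ?N) (\<lambda>(z, x). Y \<alpha> z x * \<psi> x)"
    if \<alpha>: "\<alpha> \<in> multi_indices d m" and \<psi>: "test_function d \<Omega> \<psi>" for \<alpha> \<psi>
  proof (rule Bochner_Integration.integrable_bound)
    have [measurable]: "\<psi> \<in> borel_measurable ?N" by (rule test_function_measurable[OF \<psi>])
    have \<psi>i: "integrable ?N \<psi>"
      using bounded_times_test_function_integrable[of "\<lambda>_. 1" d 1, OF _ _ \<psi>] by simp
    show "integrable (P \<Otimes>\<^sub>M ?N) (\<lambda>p. K * \<psi> (snd p))"
      by (rule PN.Fubini_integrable) (use \<psi>i in \<open>simp_all add: abs_mult\<close>)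
    show "(\<lambda>(z, x). Y \<alpha> z x * \<psi> x) \<in> borel_measurable (P \<Otimes>\<^sub>M ?N)"
      using Ym[of \<alpha>] by (simp add: split_beta')
    show "AE p in P \<Otimes>\<^sub>M ?N. norm (case p of (z, x) \<Rightarrow> Y \<alpha> z x * \<psi> x) \<le> norm (K * \<psi> (snd p))"
      by (intro AE_I2) (simp add: abs_mult split_beta' mult_right_mono[OF Y1[OF \<alpha>]])
  qed
  have Fswap: "(\<integral>x. F \<alpha> x * \<psi> x \<partial>?N) = (\<integral>z. (\<integral>x. Y \<alpha> z x * \<psi> x \<partial>?N) \<partial>P)"
    if \<alpha>: "\<alpha> \<in> multi_indices d m" and \<psi>: "test_function d \<Omega> \<psi>" for \<alpha> \<psi>
    unfolding F_def integral_mult_left_zero[symmetric] by (rule PN.Fubini_integral[OF Yint[OF \<alpha> \<psi>]])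
  \<comment> \<open>Integration by parts holds for each neuron; Fubini carries it over to the mean,
    since the signs do not depend on \<open>z\<close>.\<close>
  have Fparts: "(\<integral>x. F ?o x * partial_multi d \<alpha> \<phi> x \<partial>?N) = (-1) ^ (\<Sum>i<d. \<alpha> i) * (\<integral>x. F \<alpha> x * \<phi> x \<partial>?N)"
    if \<alpha>: "\<alpha> \<in> multi_indices d m" and \<phi>: "test_function d \<Omega> \<phi>" for \<alpha> \<phi>
    unfolding Fswap[OF o test_function_partial_multi[OF \<phi>]] Fswap[OF \<alpha> \<phi>] ridge[OF \<alpha> \<phi>]
    by (rule integral_mult_right_zero)

  \<comment> \<open>The network must use \<open>\<sigma>\<close>, the estimates use
    \<open>h 0\<close>. A bad sample exists already at frequency 0, where the neuron is the constant
    \<open>\<sigma> b\<close> and \<open>b\<close> may lie in the exceptional set.\<close>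
  define good where "good z \<longleftrightarrow> (AE x in ?N. \<sigma> (cs * dot d (fst z) x + snd z) = h 0 (cs * dot d (fst z) x + snd z))" for z
  have goodAE: "AE z in P. good z"
  proof -
    obtain N0 where N0: "{t \<in> space lborel. \<not> \<sigma> t = h 0 t} \<subseteq> N0" "emeasure lborel N0 = 0" "N0 \<in> sets lborel"
      using \<sigma>h by (rule AE_E)
    have [measurable]: "N0 \<in> sets borel" using N0(3) by simp
    have N0AE: "AE t in lborel. t \<notin> N0" using N0(2,3) by (intro AE_not_in) auto
    \<comment> \<open>For fixed \<open>x\<close> and frequency the argument is a translate of the
      bias and avoids the null set for almost every \<open>b\<close>. The quantifiers over
      \<open>x\<close> and \<open>z\<close> are then exchanged.\<close>
    have "AE x in ?N. AE z in ?Z. cs * dot d (fst z) x + snd z \<notin> N0"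
    proof (rule AE_I2)
      fix x assume "x \<in> space ?N"
      then have [measurable]: "(\<lambda>\<omega>. dot d \<omega> x) \<in> borel_measurable ?N"
        by (intro measurable_dot measurable_ident_sets measurable_const) auto
      show "AE z in ?Z. cs * dot d (fst z) x + snd z \<notin> N0"
      proof (rule NL.AE_pair_measure)
        show "{z \<in> space ?Z. cs * dot d (fst z) x + snd z \<notin> N0} \<in> sets ?Z" by measurable
        show "AE \<omega> in ?N. AE b in lborel. cs * dot d (fst (\<omega>, b)) x + snd (\<omega>, b) \<notin> N0"
          using AE_lborel_translate[OF N0AE] by simp
      qed
    qed
    moreover have "{p \<in> space (?Z \<Otimes>\<^sub>M ?N). cs * dot d (fst (fst p)) (snd p) + snd (fst p) \<notin> N0} \<in> sets (?Z \<Otimes>\<^sub>M ?N)"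
      by measurable
    ultimately have "AE z in ?Z. AE x in ?N. cs * dot d (fst z) x + snd z \<notin> N0"
      using ZN.AE_commute[of "\<lambda>z x. cs * dot d (fst z) x + snd z \<notin> N0"] by blast
    then have "AE z in ?Z. good z"
      unfolding good_def
    proof eventually_elim
      case (elim z)
      then show ?case by eventually_elim (use N0(1) in auto)
    qed
    then show ?thesis unfolding P_def by (subst AE_density) auto
  qed

  define X where "X = density ?N (indicator \<Omega>)"
  note \<Omega>m [measurable] = bounded_domain_finite_measure(1)[OF \<Omega>]
  have setsX [measurable_cong]: "sets X = sets ?N" by (simp add: X_def)
  have massX: "emeasure X (space X) = emeasure ?N \<Omega>"
  proof -
    have "emeasure X (space X) = (\<integral>\<^sup>+x. indicator \<Omega> x * indicator (space ?N) x \<partial>?N)"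
      unfolding X_def space_density by (rule emeasure_density[OF _ sets.top]) measurable
    also have "\<dots> = (\<integral>\<^sup>+x. indicator \<Omega> x \<partial>?N)" by (intro nn_integral_cong) simp
    finally show ?thesis by simp
  qed
  have "finite_measure X"
    by (rule finite_measureI) (use massX bounded_domain_finite_measure(2)[OF \<Omega>] in auto)
  have intX: "integral\<^sup>L X r = (\<integral>x. indicator \<Omega> x * r x \<partial>?N)" if "r \<in> borel_measurable ?N" for r :: "(nat \<Rightarrow> real) \<Rightarrow> real"
    using integral_density[OF that, of "indicator \<Omega>"] by (simp add: X_def ennreal_indicator)
  have YmX: "(\<lambda>(z, x). Y \<alpha> z x) \<in> borel_measurable (P \<Otimes>\<^sub>M X)" for \<alpha>
    using Ym[of \<alpha>] by (simp add: measurable_cong_sets[OF sets_pair_measure_cong[OF refl setsX] refl])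
  obtain zs where zs: "\<And>j. j < n \<Longrightarrow> zs j \<in> space P" "\<And>j. j < n \<Longrightarrow> good (zs j)"
    and le: "(\<Sum>\<alpha>\<in>multi_indices d m. \<integral>x. (\<Sum>j<n. Y \<alpha> (zs j) x - F \<alpha> x)\<^sup>2 \<partial>X) \<le> real n * (K\<^sup>2 * measure X (space X))"
    using maurey_sampling[where Y=Y and I="multi_indices d m" and K=K and n=n and good=good,
        OF P.prob_space_axioms \<open>finite_measure X\<close> finite_multi_indices YmX YK goodAE]
    unfolding F_def by blast
  define v where "v \<alpha> x = F \<alpha> x - (\<Sum>j<n. Y \<alpha> (zs j) x) / real n" for \<alpha> x
  define \<beta> where "\<beta> j = amp (zs j) / real n" for j
  define w where "w j = restrict (\<lambda>i. cs * fst (zs j) i) {..<d}" for j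
  define g where "g x = (\<Sum>j<n. \<beta> j * \<sigma> (dot d (w j) x + snd (zs j)))" for x
  have g: "g \<in> shallow_networks d n \<sigma>"
    unfolding shallow_networks_def g_def[abs_def]
    by (intro CollectI exI[of _ \<beta>] exI[of _ w] exI[of _ "\<lambda>j. snd (zs j)"]) (simp add: w_def Rd_def)
  have dw: "dot d (w j) x = cs * dot d (fst (zs j)) x" for j x
    by (simp add: dot_def w_def sum_distrib_left mult.assoc)
  have vm: "v \<alpha> \<in> borel_measurable ?N" for \<alpha>
    unfolding v_def[abs_def] using Yz[OF zs(1)] by (intro borel_measurable_diff borel_measurable_divide borel_measurable_sum Fm) auto
  have vB: "\<bar>v \<alpha> x\<bar> \<le> 2 * \<bar>K\<bar>" if \<alpha>: "\<alpha> \<in> multi_indices d m" and x: "x \<in> Rd d" for \<alpha> x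
  proof -
    have "\<bar>\<Sum>j<n. Y \<alpha> (zs j) x\<bar> \<le> (\<Sum>j<n. \<bar>K\<bar>)"
      by (rule order_trans[OF sum_abs]) (intro sum_mono Y1[OF \<alpha>])
    then have "\<bar>\<Sum>j<n. Y \<alpha> (zs j) x\<bar> / real n \<le> \<bar>K\<bar>"
      using n by (simp add: divide_simps mult.commute)
    then have "\<bar>(\<Sum>j<n. Y \<alpha> (zs j) x) / real n\<bar> \<le> \<bar>K\<bar>" by (simp add: abs_divide)
    then show ?thesis using FK[OF \<alpha> x] unfolding v_def by linarith
  qed
  have fg: "AE x in ?N. f x - g x = v ?o x"
  proof -
    have "AE x in ?N. \<forall>j\<in>{..<n}. \<sigma> (cs * dot d (fst (zs j)) x + snd (zs j)) = h 0 (cs * dot d (fst (zs j)) x + snd (zs j))"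
      by (rule AE_finite_allI) (use zs(2) in \<open>auto simp: good_def\<close>)
    then show ?thesis using fG AE_space
    proof eventually_elim
      case (elim x)
      have "g x = (\<Sum>j<n. Y ?o (zs j) x) / real n"
        unfolding g_def dw sum_divide_distrib using elim(1) by (intro sum.cong) (auto simp: \<beta>_def Y_def)
      then show ?case using elim F0[of x] by (simp add: v_def space_lborel_Rd)
    qed
  qed
  have wd: "has_weak_derivative d \<Omega> \<alpha> (\<lambda>x. f x - g x) (v \<alpha>)" if \<alpha>: "\<alpha> \<in> multi_indices d m" for \<alpha>
  proof (rule has_weak_derivativeI[OF vm vB[OF o] vm vB[OF \<alpha>] fg])
    fix \<phi> assume \<phi>: "test_function d \<Omega> \<phi>"
    have expand: "(\<integral>x. v \<gamma> x * \<psi> x \<partial>?N) = (\<integral>x. F \<gamma> x * \<psi> x \<partial>?N) - (\<Sum>j<n. (\<integral>x. Y \<gamma> (zs j) x * \<psi> x \<partial>?N)) / real n"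
      if \<gamma>: "\<gamma> \<in> multi_indices d m" and \<psi>: "test_function d \<Omega> \<psi>" for \<gamma> \<psi>
    proof -
      have iF: "integrable ?N (\<lambda>x. F \<gamma> x * \<psi> x)"
        by (rule bounded_times_test_function_integrable[OF Fm FK[OF \<gamma>] \<psi>])
      have iY: "integrable ?N (\<lambda>x. Y \<gamma> (zs j) x * \<psi> x)" if "j < n" for j
        by (rule bounded_times_test_function_integrable[OF Yz[OF zs(1)[OF that]] Y1[OF \<gamma>] \<psi>])
      have iS: "integrable ?N (\<lambda>x. (\<Sum>j<n. Y \<gamma> (zs j) x * \<psi> x) / real n)"
        by (intro integrable_divide_zero Bochner_Integration.integrable_sum) (use iY in simp)
      have "v \<gamma> x * \<psi> x = F \<gamma> x * \<psi> x - (\<Sum>j<n. Y \<gamma> (zs j) x * \<psi> x) / real n" for x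
        by (simp add: v_def left_diff_distrib sum_distrib_right)
      then have "(\<integral>x. v \<gamma> x * \<psi> x \<partial>?N) = (\<integral>x. F \<gamma> x * \<psi> x \<partial>?N) - (\<integral>x. (\<Sum>j<n. Y \<gamma> (zs j) x * \<psi> x) / real n \<partial>?N)"
        using iF iS by simp
      also have "(\<integral>x. (\<Sum>j<n. Y \<gamma> (zs j) x * \<psi> x) / real n \<partial>?N) = (\<Sum>j<n. (\<integral>x. Y \<gamma> (zs j) x * \<psi> x \<partial>?N)) / real n"
        using iY by (simp add: Bochner_Integration.integral_sum)
      finally show ?thesis .
    qed
    show "(\<integral>x. v ?o x * partial_multi d \<alpha> \<phi> x \<partial>?N) = (-1) ^ (\<Sum>i<d. \<alpha> i) * (\<integral>x. v \<alpha> x * \<phi> x \<partial>?N)"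
      unfolding expand[OF o test_function_partial_multi[OF \<phi>]] expand[OF \<alpha> \<phi>] Fparts[OF \<alpha> \<phi>] ridge[OF \<alpha> \<phi>]
      by (simp add: right_diff_distrib sum_distrib_left)
  qed
  have "sobolev_norm d \<Omega> m (\<lambda>x. f x - g x) = ennreal (sqrt (\<Sum>\<alpha>\<in>multi_indices d m. \<integral>x. indicator \<Omega> x * (v \<alpha> x)\<^sup>2 \<partial>?N))"
    by (rule sobolev_norm_eq[OF \<Omega> wd vm vB])
  also have "\<dots> \<le> ennreal (sqrt (measure ?N \<Omega>) * K / sqrt (real n))"
  proof (rule ennreal_leI)
    have "(\<Sum>\<alpha>\<in>multi_indices d m. \<integral>x. indicator \<Omega> x * (v \<alpha> x)\<^sup>2 \<partial>?N) =
        (\<Sum>\<alpha>\<in>multi_indices d m. \<integral>x. (\<Sum>j<n. Y \<alpha> (zs j) x - F \<alpha> x)\<^sup>2 / (real n)\<^sup>2 \<partial>X)"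
    proof (rule sum.cong[OF refl])
      fix \<alpha>
      have "(\<Sum>j<n. Y \<alpha> (zs j) x - F \<alpha> x) = - (real n * v \<alpha> x)" for x
        using n by (simp add: v_def sum_subtractf right_diff_distrib)
      then have "(\<Sum>j<n. Y \<alpha> (zs j) x - F \<alpha> x)\<^sup>2 / (real n)\<^sup>2 = (v \<alpha> x)\<^sup>2" for x
        using n by (simp add: power_mult_distrib)
      then show "(\<integral>x. indicator \<Omega> x * (v \<alpha> x)\<^sup>2 \<partial>?N) = (\<integral>x. (\<Sum>j<n. Y \<alpha> (zs j) x - F \<alpha> x)\<^sup>2 / (real n)\<^sup>2 \<partial>X)"
        using intX[of "\<lambda>x. (v \<alpha> x)\<^sup>2"] vm[of \<alpha>] by simp
    qed
    also have "\<dots> = (\<Sum>\<alpha>\<in>multi_indices d m. \<integral>x. (\<Sum>j<n. Y \<alpha> (zs j) x - F \<alpha> x)\<^sup>2 \<partial>X) / (real n)\<^sup>2"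
      by (simp add: sum_divide_distrib)
    \<comment> \<open>The summed error has squared norm of order \<open>n\<close>, averaging divides
      by \<open>n^2\<close>; the square root of the remaining \<open>1 / n\<close> is the
      rate.\<close>
    also have "\<dots> \<le> real n * (K\<^sup>2 * measure X (space X)) / (real n)\<^sup>2"
      by (intro divide_right_mono le) simp
    also have "\<dots> = (sqrt (measure ?N \<Omega>) * K / sqrt (real n))\<^sup>2"
    proof -
      have "measure X (space X) = measure ?N \<Omega>" using massX by (simp add: measure_def)
      then show ?thesis using n by (simp add: power_mult_distrib power_divide power2_eq_square)
    qed
    finally have sq: "(\<Sum>\<alpha>\<in>multi_indices d m. \<integral>x. indicator \<Omega> x * (v \<alpha> x)\<^sup>2 \<partial>?N) \<le> (sqrt (measure ?N \<Omega>) * K / sqrt (real n))\<^sup>2" .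
    have "sqrt (\<Sum>\<alpha>\<in>multi_indices d m. \<integral>x. indicator \<Omega> x * (v \<alpha> x)\<^sup>2 \<partial>?N) \<le> \<bar>sqrt (measure ?N \<Omega>) * K / sqrt (real n)\<bar>"
      using real_sqrt_le_mono[OF sq] by (simp only: real_sqrt_abs)
    also have "\<dots> = sqrt (measure ?N \<Omega>) * K / sqrt (real n)"
    proof -
      have "0 \<le> K" unfolding K_def Ccs using M(2) T B by simp
      then show ?thesis by simp
    qed
    finally show "sqrt (\<Sum>\<alpha>\<in>multi_indices d m. \<integral>x. indicator \<Omega> x * (v \<alpha> x)\<^sup>2 \<partial>?N) \<le> sqrt (measure ?N \<Omega>) * K / sqrt (real n)" .
  qed
  finally show ?thesis using g unfolding K_def by blast
qed

text \<open>The weight is at least 1, so a finite Barron norm makes the transform integrable, as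
  inversion demands.\<close>

lemma barron_space_fourier_data:
  assumes "f \<in> barron_space d (real m)"
  obtains G M where "G \<in> borel_measurable (lborel_Rd d)" "0 \<le> M" "barron_norm d (real m) f = ennreal M"
    "(\<integral>\<^sup>+\<omega>. ennreal ((1 + norm_Rd d \<omega>) ^ m * cmod (G \<omega>)) \<partial>lborel_Rd d) = ennreal M"
    "AE x in lborel_Rd d. f x = Re (\<integral>\<omega>. G \<omega> * cis (dot d \<omega> x) \<partial>lborel_Rd d)"
proof -
  have fin: "barron_norm d (real m) f < \<infinity>" using assms by (simp add: barron_space_def)
  then have ex: "\<exists>g. has_fourier_transform d f g" by (auto simp: barron_norm_def split: if_splits)
  define g where "g = fourier_transform d f"
  have g: "has_fourier_transform d f g" unfolding g_def fourier_transform_def using ex by (rule someI_ex)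
  then obtain G where G: "G \<in> borel_measurable (lborel_Rd d)" and gG: "AE \<omega> in lborel_Rd d. g \<omega> = G \<omega>"
    using tempered_function_borel_version[of d g] unfolding has_fourier_transform_def by blast
  have "barron_norm d (real m) f = (\<integral>\<^sup>+\<omega>. ennreal ((1 + norm_Rd d \<omega>) powr real m * cmod (g \<omega>)) \<partial>lborel_Rd d)"
    using ex by (simp add: barron_norm_def g_def lebesgue_Rd_def nn_integral_completion)
  also have "\<dots> = (\<integral>\<^sup>+\<omega>. ennreal ((1 + norm_Rd d \<omega>) ^ m * cmod (G \<omega>)) \<partial>lborel_Rd d)"
  proof (rule nn_integral_cong_AE)
    show "AE \<omega> in lborel_Rd d. ennreal ((1 + norm_Rd d \<omega>) powr real m * cmod (g \<omega>)) = ennreal ((1 + norm_Rd d \<omega>) ^ m * cmod (G \<omega>))"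
      using gG
    proof eventually_elim
      case (elim \<omega>)
      have "0 < 1 + norm_Rd d \<omega>" using norm_Rd_nonneg[of d \<omega>] by linarith
      then show ?case using elim by (simp add: powr_realpow)
    qed
  qed
  finally have eq: "barron_norm d (real m) f = (\<integral>\<^sup>+\<omega>. ennreal ((1 + norm_Rd d \<omega>) ^ m * cmod (G \<omega>)) \<partial>lborel_Rd d)" .
  obtain M where M: "0 \<le> M" "barron_norm d (real m) f = ennreal M"
    using fin by (cases "barron_norm d (real m) f") auto
  have Gi: "integrable (lborel_Rd d) G"
    by (rule integrable_if_weighted_integral_finite[OF G, of m]) (use eq fin in simp)
  show thesis
    by (rule that[OF G M _ fourier_inversion[OF g Gi gG]]) (use eq M(2) in simp)
qed

lemma sobolev_norm_zero:
  assumes \<Omega>: "bounded_domain d \<Omega>" and g: "AE x in lborel_Rd d. g x = 0"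
  shows "sobolev_norm d \<Omega> m g = 0"
proof -
  have wd: "has_weak_derivative d \<Omega> \<alpha> g (\<lambda>_. 0)" for \<alpha>
    by (rule has_weak_derivativeI[of "\<lambda>_. 0" d 0 "\<lambda>_. 0" 0]) (use g in auto)
  have "sobolev_norm d \<Omega> m g = ennreal (sqrt (\<Sum>\<alpha>\<in>multi_indices d m. \<integral>x. indicator \<Omega> x * ((\<lambda>_. 0) x)\<^sup>2 \<partial>lborel_Rd d))"
    by (rule sobolev_norm_eq[OF \<Omega>, of m g "\<lambda>_ _. 0" 0]) (use wd in auto)
  then show ?thesis by simp
qed

theorem theorem3:
  fixes m :: nat and \<sigma> :: "real \<Rightarrow> real"
  assumes "\<sigma> \<in> W_infinity m"
    and "\<exists>T>0. \<forall>t. \<sigma> (t + T) = \<sigma> t"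
    and "\<not> (\<exists>c. AE t in lebesgue. \<sigma> t = c)"
  shows "\<exists>C::real. C \<ge> 0 \<and>
    (\<forall>(d::nat) \<Omega> f (n::nat). d \<ge> 1 \<longrightarrow> bounded_domain d \<Omega> \<longrightarrow> f \<in> barron_space d (real m) \<longrightarrow> n \<ge> 1 \<longrightarrow>
      (INF f\<^sub>n \<in> shallow_networks d n \<sigma>. sobolev_norm d \<Omega> m (\<lambda>x. f x - f\<^sub>n x))
        \<le> ennreal (sqrt (measure (lebesgue_Rd d) \<Omega>) * C * real n powr (-1/2)) * barron_norm d (real m) f)"
proof -
  obtain T where T: "0 < T" and per: "\<And>t. \<sigma> (t + T) = \<sigma> t" using assms(2) by blast
  obtain h B where hm: "\<And>k. h k \<in> borel_measurable borel" and hB: "\<And>k t. \<bar>h k t\<bar> \<le> B"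
    and \<sigma>h: "AE t in lborel. \<sigma> t = h 0 t" and pair: "\<And>k. k < m \<Longrightarrow> weak_derivative_pair (h k) (h (Suc k))"
    using W_infinity_borel_versions[OF assms(1)] by blast
  obtain k where k: "k \<noteq> 0" "fourier_coeff T (h 0) k \<noteq> 0"
    using exists_fourier_coeff_nonzero[OF T hm hB \<sigma>h per assms(3)] by blast
  \<comment> \<open>\<open>T\<close> undoes the uniform density of the bias, \<open>B\<close> bounds
    the representatives, the power stems from the rescaled inner weights, and the Fourier
    coefficient is divided out of the plane wave. All of them are fixed before \<open>d\<close>,
    \<open>\<Omega>\<close>, \<open>f\<close> and \<open>n\<close> enter.\<close>
  define C where "C = T * B * (1 + \<bar>1 / (of_int k * (2 * pi / T))\<bar>) ^ m / cmod (fourier_coeff T (h 0) k)"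
  have "0 \<le> B" using hB[of 0 0] abs_ge_zero[of "h 0 0"] by linarith
  then have C0: "0 \<le> C" using T by (simp add: C_def)
  show ?thesis
  proof (intro exI[of _ C] conjI C0 allI impI)
    fix d \<Omega> f and n :: nat
    assume \<Omega>: "bounded_domain d \<Omega>" and f: "f \<in> barron_space d (real m)" and n: "1 \<le> n"
    obtain G M where G: "G \<in> borel_measurable (lborel_Rd d)" and M: "0 \<le> M" "barron_norm d (real m) f = ennreal M"
      "(\<integral>\<^sup>+\<omega>. ennreal ((1 + norm_Rd d \<omega>) ^ m * cmod (G \<omega>)) \<partial>lborel_Rd d) = ennreal M"
      and fG: "AE x in lborel_Rd d. f x = Re (\<integral>\<omega>. G \<omega> * cis (dot d \<omega> x) \<partial>lborel_Rd d)"
      using barron_space_fourier_data[OF f] by blast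
    have "\<exists>g\<in>shallow_networks d n \<sigma>. sobolev_norm d \<Omega> m (\<lambda>x. f x - g x) \<le>
        ennreal (sqrt (measure (lborel_Rd d) \<Omega>) * (M * C) / sqrt (real n))"
    proof (cases "M = 0")
      case True
      \<comment> \<open>With norm 0 there is no density to normalise. The transform is null, so
        \<open>f\<close> vanishes almost everywhere and a network with zero outer weights has error
        0.\<close>
      have "AE \<omega> in lborel_Rd d. ennreal ((1 + norm_Rd d \<omega>) ^ m * cmod (G \<omega>)) = 0"
        using M(3) G True by (subst nn_integral_0_iff_AE[symmetric]) auto
      then have "AE \<omega> in lborel_Rd d. G \<omega> = 0"
      proof eventually_elim
        case (elim \<omega>)
        have "0 < (1 + norm_Rd d \<omega>) ^ m" using norm_Rd_nonneg[of d \<omega>] by (intro zero_less_power) linarith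
        moreover have "(1 + norm_Rd d \<omega>) ^ m * cmod (G \<omega>) \<le> 0" using elim by (simp only: ennreal_eq_0_iff)
        ultimately show ?case by (simp add: mult_le_0_iff)
      qed
      then have "(\<integral>\<omega>. G \<omega> * cis (dot d \<omega> x) \<partial>lborel_Rd d) = 0" for x
        by (intro integral_eq_zero_AE) auto
      then have f0: "AE x in lborel_Rd d. f x = 0" using fG by simp
      define g where "g x = (\<Sum>i<n. 0 * \<sigma> (dot d (restrict (\<lambda>_. 0) {..<d}) x + 0))" for x
      have "g \<in> shallow_networks d n \<sigma>"
        unfolding shallow_networks_def g_def[abs_def]
        by (intro CollectI exI[of _ "\<lambda>_. 0"] exI[of _ "\<lambda>_. restrict (\<lambda>_. 0) {..<d}"]) (simp add: Rd_def)
      moreover have "sobolev_norm d \<Omega> m (\<lambda>x. f x - g x) = 0"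
        by (rule sobolev_norm_zero[OF \<Omega>]) (use f0 in \<open>simp add: g_def\<close>)
      ultimately show ?thesis by (intro bexI[of _ g]) simp_all
    next
      case False
      then have "0 < M" using M(1) by simp
      from network_approximation[where h=h and \<sigma>=\<sigma>, OF T hm hB \<sigma>h per pair k \<Omega> G M(3) this fG n C_def]
      show ?thesis .
    qed
    then have "(INF f\<^sub>n \<in> shallow_networks d n \<sigma>. sobolev_norm d \<Omega> m (\<lambda>x. f x - f\<^sub>n x))
        \<le> ennreal (sqrt (measure (lborel_Rd d) \<Omega>) * (M * C) / sqrt (real n))"
      by (auto intro: INF_lower2)
    also have "sqrt (measure (lborel_Rd d) \<Omega>) * (M * C) / sqrt (real n) =
        sqrt (measure (lebesgue_Rd d) \<Omega>) * C * real n powr (-1/2) * M"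
    proof -
      have "real n powr (- (1 / 2)) = 1 / sqrt (real n)"
        unfolding powr_minus_divide using n by (simp only: powr_half_sqrt of_nat_0_le_iff)
      moreover have "measure (lebesgue_Rd d) \<Omega> = measure (lborel_Rd d) \<Omega>"
        unfolding lebesgue_Rd_def by (rule measure_completion[OF bounded_domain_finite_measure(1)[OF \<Omega>]])
      ultimately show ?thesis by simp
    qed
    also have "ennreal \<dots> = ennreal (sqrt (measure (lebesgue_Rd d) \<Omega>) * C * real n powr (-1/2)) * barron_norm d (real m) f"
      unfolding M(2) using C0 M(1) by (intro ennreal_mult) auto
    finally show "(INF f\<^sub>n \<in> shallow_networks d n \<sigma>. sobolev_norm d \<Omega> m (\<lambda>x. f x - f\<^sub>n x))
        \<le> ennreal (sqrt (measure (lebesgue_Rd d) \<Omega>) * C * real n powr (-1/2)) * barron_norm d (real m) f" .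
  qed
qed

end
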